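(* Let $1<s<p<\infty$, $n\ge2$, let $\Omega\subseteq\mathbb{R}^n$ be a domain, let $a=(a_1,\dots,a_n)$ be a weight vector and $V\in M^q_{\mathrm{loc}}(p;\Omega)$ as in the context, and suppose that $Q_{p,s,a,V}\ge0$ on $C_c^\infty(\Omega)$. Put $M=\max\{s,2\}$. Fix a positive solution $u\in W^{1,p}_{\mathrm{loc}}(\Omega)\cap C(\Omega)$ of $Q'_{p,s,a,V}[v]=0$ in $\Omega$. Then for some positive constants $c(p,s)$, $C(p,s)$, $C(p,s,n)$ (depending only on the indicated parameters) and all nonnegative $\psi\in W^{1,p}(\Omega)\cap C_c(\Omega)$, $$Q_{p,s,a,V}[u\psi]\ge c(p,s)\int_\Omega R_1(\psi\nabla u,u\nabla\psi;M)\,dx+c(p,s)\int_\Omega R_2(\psi\nabla u,u\nabla\psi)\,dx$$ and $$Q_{p,s,a,V}[u\psi]\le C(p,s)\int_{\Omega_1}R_1(\psi\nabla u,u\nabla\psi;M)\,dx+C(p,s,n)\int_{\Omega_2}R_2(\psi\nabla u,u\nabla\psi)\,dx,$$ where $\Omega_1=\{x\in\Omega: |\psi\nabla u|_{s,a}\le|u\nabla\psi|_{s,a}\}$ and $\Omega_2=\{x\in\Omega: |\psi\nabla u|_{s,a}>|u\nabla\psi|_{s,a}\}$. In particular, there are constants $0<c\le C<\infty$ depending only on $p,s,n$ such that for all nonnegative $\psi\in W^{1,p}(\Omega)\cap C_c(\Omega)$, with $E(\psi)=\int_{\Omega_1}R_1(\psi\nabla u,u\nabla\psi;M)\,dx+\int_{\Omega_2}R_2(\psi\nabla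 u,u\nabla\psi)\,dx$, $$c\,E(\psi)\le Q_{p,s,a,V}[u\psi]\le C\,E(\psi).$$
   Context: $\omega\Subset\Omega$ means that the closure of $\omega$ is a compact subset of $\Omega$. $C_c(\Omega)$: continuous functions with compact support in $\Omega$. Weights: $a_1,\dots,a_n:\Omega\to(0,\infty)$ are Lebesgue measurable and for every domain $\omega\Subset\Omega$ there are constants $0<c_\omega\le C_\omega<\infty$ with $c_\omega\le a_i\le C_\omega$ a.e. in $\omega$. $|\xi|_{s,a}=(\sum_i a_i(x)|\xi_i|^s)^{1/s}$ and $\xi_i'=a_i(x)^{1/s}\xi_i$. For $\xi,\eta\in\mathbb{R}^n$ and $1<l<\infty$, $$R_1(\xi,\eta;l)=|\eta|_{s,a}^{l}(|\eta|_{s,a}+|\xi|_{s,a})^{p-l},\qquad R_2(\xi,\eta)=|\xi|_{s,a}^{p-s}\sum_{i=1}^n|\eta_i'|^2(|\eta_i'|+|\xi_i'|)^{s-2}.$$ Morrey space: for a domain $\omega\Subset\Omega$ and measurable $f$ on $\omega$: if $p<n$ and $q>n/p$, $\|f\|_{M^q(p;\omega)}=\sup_{y\in\omega,\,0<r<\mathrm{diam}(\omega)}r^{-n/q'}\int_{\omega\cap B_r(y)}|f|\,dx$ with $q'=q/(q-1)$; if $p=n$ and $q>n$, $\|f\|_{M^q(n;\omega)}=\sup_{y\in\omega,\,0<r<\mathrm{diam}(\omega)}(\log(\mathrm{diam}(\omega)/r))^{q/n'}\int_{\omega\cap B_r(y)}|f|\,dx$ with $n'=n/(n-1)$; in these cases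 $M^q(p;\omega)$ is the set of $f\in L^1_{\mathrm{loc}}(\omega)$ with finite norm. If $p>n$, $q=1$ and $M^q(p;\omega)=L^1(\omega)$. $M^q_{\mathrm{loc}}(p;\Omega)$ consists of functions lying in $M^q(p;\omega)$ for all domains $\omega\Subset\Omega$. Functional: $Q_{p,s,a,V}[\phi]=\int_\Omega(|\nabla\phi|_{s,a}^p+V|\phi|^p)\,dx$. A positive solution of $Q'_{p,s,a,V}[v]=0$ in $\Omega$ is a positive $v\in W^{1,p}_{\mathrm{loc}}(\Omega)$ with $\int_\Omega|\nabla v|_{s,a}^{p-s}\sum_i a_i|\partial_iv|^{s-2}\partial_iv\,\partial_i\phi\,dx+\int_\Omega V|v|^{p-2}v\phi\,dx=0$ for all $\phi\in C_c^\infty(\Omega)$. Conventions: $|t|^{s-2}t=0$ for $t=0$; $t^2(t+\tau)^{s-2}=0$ when $t=\tau=0$; $R_1(0,0;l)=0$. *)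

theory Defs
  imports "HOL-Analysis.Analysis"
begin

text \<open>
  The dimension \<open>n\<close> has to be a term and not a type: the constants \<open>c(p,s)\<close> and \<open>C(p,s)\<close> of the
  theorem are independent of \<open>n\<close>, i.e. they are chosen before \<open>n\<close> is. So $R^n$ is the carrier of
  the \<open>n\<close>-fold product measure, consisting of the functions on the naturals that are \<open>undefined\<close>
  outside \<open>{..<n}\<close>. Open, closed, compact and connected sets refer to the product topology of the
  library on \<open>nat \<Rightarrow> real\<close>, which induces the Euclidean topology on the (closed) set \<open>Rn n\<close>.
  Distances are Euclidean and are always written with \<open>L2_set\<close>; the library's \<open>dist\<close> on
  \<open>nat \<Rightarrow> real\<close> is a different metric. Vectors (as opposed to points) are functions
  \<open>nat \<Rightarrow> real\<close> of which only the components below \<open>n\<close> are ever used.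
\<close>

definition Rn :: "nat \<Rightarrow> (nat \<Rightarrow> real) set" where
  "Rn n = PiE {..<n} (\<lambda>_. UNIV)"

definition leb :: "nat \<Rightarrow> (nat \<Rightarrow> real) measure" where
  "leb n = completion (Pi\<^sub>M {..<n} (\<lambda>_. lborel))"

definition edist :: "nat \<Rightarrow> (nat \<Rightarrow> real) \<Rightarrow> (nat \<Rightarrow> real) \<Rightarrow> real" where
  "edist n x y = L2_set (\<lambda>i. x i - y i) {..<n}"

definition eball :: "nat \<Rightarrow> (nat \<Rightarrow> real) \<Rightarrow> real \<Rightarrow> (nat \<Rightarrow> real) set" where
  "eball n y r = {x \<in> Rn n. edist n x y < r}"

definition ediam :: "nat \<Rightarrow> (nat \<Rightarrow> real) set \<Rightarrow> real" where
  "ediam n A = Sup {edist n x y | x y. x \<in> A \<and> y \<in> A}"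

definition is_domain :: "nat \<Rightarrow> (nat \<Rightarrow> real) set \<Rightarrow> bool" where
  "is_domain n \<Omega> \<longleftrightarrow> openin (top_of_set (Rn n)) \<Omega> \<and> connected \<Omega> \<and> \<Omega> \<noteq> {}"

definition compactly_in :: "(nat \<Rightarrow> real) set \<Rightarrow> (nat \<Rightarrow> real) set \<Rightarrow> bool" where
  "compactly_in \<omega> \<Omega> \<longleftrightarrow> compact (closure \<omega>) \<and> closure \<omega> \<subseteq> \<Omega>"


section \<open>Function spaces\<close>

text \<open>
  Functions on \<open>\<Omega>\<close> are total functions; their values outside \<open>\<Omega>\<close> never matter.
\<close>

definition compact_support :: "(nat \<Rightarrow> real) set \<Rightarrow> ((nat \<Rightarrow> real) \<Rightarrow> real) \<Rightarrow> bool" where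
  "compact_support \<Omega> f \<longleftrightarrow>
     compact (closure {x \<in> \<Omega>. f x \<noteq> 0}) \<and> closure {x \<in> \<Omega>. f x \<noteq> 0} \<subseteq> \<Omega>"

definition Cc :: "(nat \<Rightarrow> real) set \<Rightarrow> ((nat \<Rightarrow> real) \<Rightarrow> real) \<Rightarrow> bool" where
  "Cc \<Omega> f \<longleftrightarrow> continuous_on \<Omega> f \<and> compact_support \<Omega> f"

text \<open>Classical partial derivative in the \<open>i\<close>-th coordinate.\<close>

definition pd :: "nat \<Rightarrow> ((nat \<Rightarrow> real) \<Rightarrow> real) \<Rightarrow> (nat \<Rightarrow> real) \<Rightarrow> real" where
  "pd i f x = deriv (\<lambda>t. f (x(i := t))) (x i)"

primrec Ck :: "nat \<Rightarrow> nat \<Rightarrow> (nat \<Rightarrow> real) set \<Rightarrow> ((nat \<Rightarrow> real) \<Rightarrow> real) \<Rightarrow> bool" where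
  "Ck n 0 \<Omega> f \<longleftrightarrow> continuous_on \<Omega> f"
| "Ck n (Suc k) \<Omega> f \<longleftrightarrow> continuous_on \<Omega> f \<and>
     (\<forall>i<n. (\<forall>x\<in>\<Omega>. (\<lambda>t. f (x(i := t))) differentiable (at (x i))) \<and> Ck n k \<Omega> (pd i f))"

definition Cc_infinity :: "nat \<Rightarrow> (nat \<Rightarrow> real) set \<Rightarrow> ((nat \<Rightarrow> real) \<Rightarrow> real) \<Rightarrow> bool" where
  "Cc_infinity n \<Omega> f \<longleftrightarrow> (\<forall>k. Ck n k \<Omega> f) \<and> compact_support \<Omega> f"

definition L1loc :: "nat \<Rightarrow> (nat \<Rightarrow> real) set \<Rightarrow> ((nat \<Rightarrow> real) \<Rightarrow> real) \<Rightarrow> bool" where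
  "L1loc n \<Omega> f \<longleftrightarrow> (\<forall>K. compact K \<and> K \<subseteq> \<Omega> \<longrightarrow> set_integrable (leb n) K f)"

definition Lp :: "nat \<Rightarrow> real \<Rightarrow> (nat \<Rightarrow> real) set \<Rightarrow> ((nat \<Rightarrow> real) \<Rightarrow> real) \<Rightarrow> bool" where
  "Lp n p A f \<longleftrightarrow> set_borel_measurable (leb n) A f \<and>
     set_integrable (leb n) A (\<lambda>x. \<bar>f x\<bar> powr p)"

definition Lploc :: "nat \<Rightarrow> real \<Rightarrow> (nat \<Rightarrow> real) set \<Rightarrow> ((nat \<Rightarrow> real) \<Rightarrow> real) \<Rightarrow> bool" where
  "Lploc n p \<Omega> f \<longleftrightarrow> (\<forall>K. compact K \<and> K \<subseteq> \<Omega> \<longrightarrow> Lp n p K f)"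

definition is_weak_grad ::
  "nat \<Rightarrow> (nat \<Rightarrow> real) set \<Rightarrow> ((nat \<Rightarrow> real) \<Rightarrow> real) \<Rightarrow> ((nat \<Rightarrow> real) \<Rightarrow> nat \<Rightarrow> real) \<Rightarrow> bool" where
  "is_weak_grad n \<Omega> f g \<longleftrightarrow> L1loc n \<Omega> f \<and>
     (\<forall>i<n. L1loc n \<Omega> (\<lambda>x. g x i) \<and>
        (\<forall>\<phi>. Cc_infinity n \<Omega> \<phi> \<longrightarrow>
           (LINT x:\<Omega>|leb n. f x * pd i \<phi> x) = - (LINT x:\<Omega>|leb n. g x i * \<phi> x)))"

text \<open>
  The weak gradient as a function of \<open>f\<close>; it is determined up to null sets, and only integrals
  of it are used.
\<close>

definition wgrad ::
  "nat \<Rightarrow> (nat \<Rightarrow> real) set \<Rightarrow> ((nat \<Rightarrow> real) \<Rightarrow> real) \<Rightarrow> (nat \<Rightarrow> real) \<Rightarrow> nat \<Rightarrow> real" where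
  "wgrad n \<Omega> f = (SOME g. is_weak_grad n \<Omega> f g)"

definition W1p :: "nat \<Rightarrow> real \<Rightarrow> (nat \<Rightarrow> real) set \<Rightarrow> ((nat \<Rightarrow> real) \<Rightarrow> real) \<Rightarrow> bool" where
  "W1p n p \<Omega> f \<longleftrightarrow> Lp n p \<Omega> f \<and>
     (\<exists>g. is_weak_grad n \<Omega> f g \<and> (\<forall>i<n. Lp n p \<Omega> (\<lambda>x. g x i)))"

definition W1ploc :: "nat \<Rightarrow> real \<Rightarrow> (nat \<Rightarrow> real) set \<Rightarrow> ((nat \<Rightarrow> real) \<Rightarrow> real) \<Rightarrow> bool" where
  "W1ploc n p \<Omega> f \<longleftrightarrow> Lploc n p \<Omega> f \<and>
     (\<exists>g. is_weak_grad n \<Omega> f g \<and> (\<forall>i<n. Lploc n p \<Omega> (\<lambda>x. g x i)))"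


section \<open>Weights, Morrey spaces\<close>

definition weight :: "nat \<Rightarrow> (nat \<Rightarrow> real) set \<Rightarrow> (nat \<Rightarrow> (nat \<Rightarrow> real) \<Rightarrow> real) \<Rightarrow> bool" where
  "weight n \<Omega> a \<longleftrightarrow>
     (\<forall>i<n. set_borel_measurable (leb n) \<Omega> (a i) \<and> (\<forall>x\<in>\<Omega>. 0 < a i x)) \<and>
     (\<forall>\<omega>. is_domain n \<omega> \<and> compactly_in \<omega> \<Omega> \<longrightarrow>
        (\<exists>c C. 0 < c \<and> c \<le> C \<and>
           (\<forall>i<n. AE x in leb n. x \<in> \<omega> \<longrightarrow> c \<le> a i x \<and> a i x \<le> C)))"

text \<open>
  The Morrey norm is \<open>ennreal\<close>-valued, so that the integrals and suprema may be infinite. It is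
  only meaningful for \<open>p \<le> n\<close>.
\<close>

definition morrey_norm ::
  "nat \<Rightarrow> real \<Rightarrow> real \<Rightarrow> (nat \<Rightarrow> real) set \<Rightarrow> ((nat \<Rightarrow> real) \<Rightarrow> real) \<Rightarrow> ennreal" where
  "morrey_norm n p q \<omega> f =
     (SUP y\<in>\<omega>. SUP r\<in>{0<..<ediam n \<omega>}.
        ennreal (if p < real n then r powr (- (real n / (q / (q - 1))))
                 else ln (ediam n \<omega> / r) powr (q / (real n / (real n - 1))))
        * (\<integral>\<^sup>+x\<in>\<omega> \<inter> eball n y r. ennreal \<bar>f x\<bar> \<partial>leb n))"

definition morrey_exponent :: "nat \<Rightarrow> real \<Rightarrow> real \<Rightarrow> bool" where
  "morrey_exponent n p q \<longleftrightarrow>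
     (if p < real n then q > real n / p else if p = real n then q > real n else q = 1)"

definition morrey ::
  "nat \<Rightarrow> real \<Rightarrow> real \<Rightarrow> (nat \<Rightarrow> real) set \<Rightarrow> ((nat \<Rightarrow> real) \<Rightarrow> real) \<Rightarrow> bool" where
  "morrey n p q \<omega> f \<longleftrightarrow>
     (if p \<le> real n then L1loc n \<omega> f \<and> morrey_norm n p q \<omega> f < \<infinity>
      else set_integrable (leb n) \<omega> f)"

definition morrey_loc ::
  "nat \<Rightarrow> real \<Rightarrow> real \<Rightarrow> (nat \<Rightarrow> real) set \<Rightarrow> ((nat \<Rightarrow> real) \<Rightarrow> real) \<Rightarrow> bool" where
  "morrey_loc n p q \<Omega> f \<longleftrightarrow>
     (\<forall>\<omega>. is_domain n \<omega> \<and> compactly_in \<omega> \<Omega> \<longrightarrow> morrey n p q \<omega> f)"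


section \<open>The functional and its remainders\<close>

text \<open>
  The conventions on \<open>|t|^(s-2) t\<close>, \<open>t\<^sup>2 (t + \<tau>)^(s-2)\<close> and \<open>R1(0,0;l)\<close> at zero hold because
  \<open>0 powr b = 0\<close> for every exponent \<open>b\<close>. The argument \<open>w\<close> stands for the vector of weights
  at the point under consideration.
\<close>

definition anorm :: "nat \<Rightarrow> real \<Rightarrow> (nat \<Rightarrow> real) \<Rightarrow> (nat \<Rightarrow> real) \<Rightarrow> real" where
  "anorm n s w \<xi> = (\<Sum>i<n. w i * \<bar>\<xi> i\<bar> powr s) powr (1 / s)"

definition R1 ::
  "nat \<Rightarrow> real \<Rightarrow> real \<Rightarrow> (nat \<Rightarrow> real) \<Rightarrow> (nat \<Rightarrow> real) \<Rightarrow> (nat \<Rightarrow> real) \<Rightarrow> real \<Rightarrow> real" where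
  "R1 n p s w \<xi> \<eta> l = anorm n s w \<eta> powr l * (anorm n s w \<eta> + anorm n s w \<xi>) powr (p - l)"

definition R2 ::
  "nat \<Rightarrow> real \<Rightarrow> real \<Rightarrow> (nat \<Rightarrow> real) \<Rightarrow> (nat \<Rightarrow> real) \<Rightarrow> (nat \<Rightarrow> real) \<Rightarrow> real" where
  "R2 n p s w \<xi> \<eta> = anorm n s w \<xi> powr (p - s) *
     (\<Sum>i<n. \<bar>w i powr (1 / s) * \<eta> i\<bar>\<^sup>2 *
        (\<bar>w i powr (1 / s) * \<eta> i\<bar> + \<bar>w i powr (1 / s) * \<xi> i\<bar>) powr (s - 2))"

definition Q ::
  "nat \<Rightarrow> real \<Rightarrow> real \<Rightarrow> (nat \<Rightarrow> (nat \<Rightarrow> real) \<Rightarrow> real) \<Rightarrow> ((nat \<Rightarrow> real) \<Rightarrow> real)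
    \<Rightarrow> (nat \<Rightarrow> real) set \<Rightarrow> ((nat \<Rightarrow> real) \<Rightarrow> real) \<Rightarrow> real" where
  "Q n p s a V \<Omega> \<phi> =
     (LINT x:\<Omega>|leb n. anorm n s (\<lambda>i. a i x) (wgrad n \<Omega> \<phi> x) powr p + V x * \<bar>\<phi> x\<bar> powr p)"

definition positive_solution ::
  "nat \<Rightarrow> real \<Rightarrow> real \<Rightarrow> (nat \<Rightarrow> (nat \<Rightarrow> real) \<Rightarrow> real) \<Rightarrow> ((nat \<Rightarrow> real) \<Rightarrow> real)
    \<Rightarrow> (nat \<Rightarrow> real) set \<Rightarrow> ((nat \<Rightarrow> real) \<Rightarrow> real) \<Rightarrow> bool" where
  "positive_solution n p s a V \<Omega> v \<longleftrightarrow>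
     W1ploc n p \<Omega> v \<and> (\<forall>x\<in>\<Omega>. 0 < v x) \<and>
     (\<forall>\<phi>. Cc_infinity n \<Omega> \<phi> \<longrightarrow>
        (LINT x:\<Omega>|leb n. anorm n s (\<lambda>i. a i x) (wgrad n \<Omega> v x) powr (p - s) *
           (\<Sum>i<n. a i x * \<bar>wgrad n \<Omega> v x i\<bar> powr (s - 2) * wgrad n \<Omega> v x i * pd i \<phi> x))
        + (LINT x:\<Omega>|leb n. V x * \<bar>v x\<bar> powr (p - 2) * v x * \<phi> x) = 0)"

end

theory Submission
  imports Defs "HOL-Real_Asymp.Real_Asymp"
begin

text \<open>
  Put \<open>\<xi> = \<psi> \<nabla>u\<close> and \<open>\<eta> = u \<nabla>\<psi>\<close>. Testing the equation of \<open>u\<close> with \<open>u \<psi>\<^sup>p\<close> eliminates the potential and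
  identifies the energy of \<open>u \<psi>\<close> with the integral of the first order Taylor remainder of
  \<open>\<bar>\<cdot>\<bar>\<^sup>p\<close> at \<open>\<xi>\<close> in direction \<open>\<eta>\<close>, which is then compared pointwise with \<open>R1\<close> and \<open>R2\<close>. The comparison
  follows from the scalar one, where the second order remainder of \<open>\<bar>t\<bar>\<^sup>s\<close> is comparable to
  \<open>y\<^sup>2 (\<bar>y\<bar> + \<bar>x\<bar>)\<^sup>s\<^sup>-\<^sup>2\<close>, by summation and by convexity of \<open>t\<^sup>p\<^sup>/\<^sup>s\<close>; all constants depend on \<open>p\<close> and \<open>s\<close> only.
  That \<open>u \<psi>\<^sup>p\<close> may be used as a test function is shown by mollification. The product and chain rules
  for weak gradients are needed for continuous functions only, so that every passage to the limit is an
  instance of \<open>\<integral> F (G * \<rho>\<^sub>\<epsilon>) \<rightarrow> \<integral> F G\<close>, which follows from the symmetry of this form in \<open>F\<close> and \<open>G\<close>,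
  the density of continuous functions in \<open>L\<^sup>1\<close> and Young's inequality.
\<close>

section \<open>The power function and its second order remainder\<close>

text \<open>The exponents \<open>s - 2\<close>, \<open>p - max s 2\<close> and
  \<open>p / s - 2\<close> have no fixed sign, so a power whose base is known up to a factor is
  bounded by its values at both endpoints. R2 carries the factor |xi|^(p - s): at xi = 0 it vanishes
  while the remainder is |eta|^p. Hence R2 cannot bound the remainder from above where xi is small,
  which explains the split into \<Omega>1 and \<Omega>2, and the lower bound by R1 cannot come from
  R2 there; in that range |xi + eta|^p dominates all other terms. On \<Omega>2 the obstacle is the
  squared increment of |.|^s, which Cauchy-Schwarz turns into the sum in R2 times a power of |xi|.
  The flux of u is only locally in L^(p/(p-1)) and V only locally integrable. On a fixed compact set
  each term is a pairing of a bounded with an integrable function, or of functions in dual Lebesgue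
  spaces, and convergence of such pairings suffices in place of norm convergence of mollifications.
  Cubes replace balls because the kernels are products.\<close>

lemma powr_between:
  fixes x a b e :: real
  assumes "0 < a" "a \<le> x" "x \<le> b"
  shows "x powr e \<le> max (a powr e) (b powr e)" "min (a powr e) (b powr e) \<le> x powr e"
proof -
  have "x powr e \<le> max (a powr e) (b powr e) \<and> min (a powr e) (b powr e) \<le> x powr e"
  proof (cases "e \<ge> 0")
    case True
    then have "a powr e \<le> x powr e" "x powr e \<le> b powr e"
      using assms by (auto intro!: powr_mono2)
    then show ?thesis by auto
  next
    case False
    then have "x powr e \<le> a powr e" "b powr e \<le> x powr e"
      using assms by (auto intro!: powr_mono2')
    then show ?thesis by auto
  qed
  then show "x powr e \<le> max (a powr e) (b powr e)" "min (a powr e) (b powr e) \<le> x powr e"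
    by auto
qed

lemma powr_remainder_Taylor:
  fixes s t :: real
  assumes "-1 < t" "t \<noteq> 0"
  obtains \<theta> where "min 0 t < \<theta>" "\<theta> < max 0 t"
    "\<bar>1 + t\<bar> powr s - 1 - s * t = s * (s - 1) / 2 * (1 + \<theta>) powr (s - 2) * t\<^sup>2"
proof -
  \<comment> \<open>\<open>Taylor\<close> with two terms reads \<open>d\<close> only at 0, 1 and 2,
    so the last branch may stand for every larger index. On the interval used, \<open>1 + x\<close>
    is positive and the absolute value disappears.\<close>
  define d where "d = (\<lambda>m::nat. if m = 0 then (\<lambda>x. (1 + x) powr s)
      else if m = 1 then (\<lambda>x. s * (1 + x) powr (s - 1))
      else (\<lambda>x::real. s * ((s - 1) * (1 + x) powr (s - 2))))"
  have "\<exists>\<theta>. (if t < 0 then t < \<theta> \<and> \<theta> < 0 else 0 < \<theta> \<and> \<theta> < t) \<and>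
    (1 + t) powr s = (\<Sum>m<2. (d m 0 / fact m) * (t - 0)^m) + (d 2 \<theta> / fact 2) * (t - 0)^2"
  proof (rule Taylor[where a = "min 0 t" and b = "max 0 t"])
    show "\<forall>m x. m < 2 \<and> min 0 t \<le> x \<and> x \<le> max 0 t \<longrightarrow> DERIV (d m) x :> d (Suc m) x"
    proof (intro allI impI)
      fix m x assume a: "m < (2::nat) \<and> min 0 t \<le> x \<and> x \<le> max 0 t"
      then have x: "1 + x > 0" using assms by (auto simp: min_def split: if_splits)
      have m: "m = 0 \<or> m = 1" using a by auto
      have e: "s - 1 - 1 = s - 2" by simp
      have "DERIV (\<lambda>x. (1 + x) powr s) x :> s * (1 + x) powr (s - 1)"
        using x by (auto intro!: derivative_eq_intros)
      moreover have "DERIV (\<lambda>x. s * (1 + x) powr (s - 1)) x :> s * ((s - 1) * (1 + x) powr (s - 2))"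
        using x by (auto intro!: derivative_eq_intros simp: e)
      ultimately show "DERIV (d m) x :> d (Suc m) x"
        using m by (auto simp: d_def)
    qed
  qed (use assms in \<open>auto simp: d_def\<close>)
  then obtain \<theta> where th: "if t < 0 then t < \<theta> \<and> \<theta> < 0 else 0 < \<theta> \<and> \<theta> < t"
    and eq: "(1 + t) powr s = (\<Sum>m<2. (d m 0 / fact m) * t^m) + (d 2 \<theta> / fact 2) * t^2"
    by auto
  show ?thesis
  proof
    show "min 0 t < \<theta>" "\<theta> < max 0 t" using th by (auto split: if_splits)
    show "\<bar>1 + t\<bar> powr s - 1 - s * t = s * (s - 1) / 2 * (1 + \<theta>) powr (s - 2) * t\<^sup>2"
      using eq assms by (simp add: d_def numeral_2_eq_2 lessThan_Suc)
  qed
qed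

text \<open>For t > -1 every factor of Lagrange's remainder is positive; for t \<le> -1 the linear
  part already is, since - 1 - s t \<ge> s - 1. Strictness makes the minimum in
  \<open>powr_remainder_far\<close> positive.\<close>

lemma powr_remainder_pos:
  fixes s t :: real
  assumes "1 < s" "t \<noteq> 0"
  shows "0 < \<bar>1 + t\<bar> powr s - 1 - s * t"
proof (cases "-1 < t")
  case True
  from powr_remainder_Taylor[OF this assms(2), of s] obtain \<theta> where
    "min 0 t < \<theta>" "\<bar>1 + t\<bar> powr s - 1 - s * t = s * (s - 1) / 2 * (1 + \<theta>) powr (s - 2) * t\<^sup>2"
    by metis
  moreover have "1 + \<theta> > 0" using True \<open>min 0 t < \<theta>\<close> by (auto simp: min_def split: if_splits)
  then have "0 < s * (s - 1) / 2 * (1 + \<theta>) powr (s - 2) * t\<^sup>2"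
    using assms by (intro mult_pos_pos) auto
  ultimately show ?thesis by linarith
next
  case False
  then have "s * t \<le> s * (-1)" using assms by (intro mult_left_mono) auto
  then have "- 1 - s * t > 0" using assms by linarith
  moreover have "0 \<le> \<bar>1 + t\<bar> powr s" by simp
  ultimately show ?thesis by linarith
qed

text \<open>Near 0 both \<open>1 + \<theta>\<close> and \<open>1 + \<bar>t\<bar>\<close> lie in
  [1/2, 3/2], so their powers with exponent \<open>s - 2\<close> differ at most by the factor
  \<open>M / m\<close>, whatever the sign of the exponent.\<close>

lemma powr_remainder_near:
  fixes s :: real
  assumes "1 < s"
  obtains c C where "0 < c" "0 < C"
    "\<And>t. \<bar>t\<bar> \<le> 1/2 \<Longrightarrow> c * (t\<^sup>2 * (1 + \<bar>t\<bar>) powr (s - 2)) \<le> \<bar>1 + t\<bar> powr s - 1 - s * t"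
    "\<And>t. \<bar>t\<bar> \<le> 1/2 \<Longrightarrow> \<bar>1 + t\<bar> powr s - 1 - s * t \<le> C * (t\<^sup>2 * (1 + \<bar>t\<bar>) powr (s - 2))"
proof -
  define m M where "m = min ((1/2) powr (s - 2)) ((3/2) powr (s - 2))"
    and "M = max ((1/2) powr (s - 2)) ((3/2::real) powr (s - 2))"
  have mM: "0 < m" "0 < M" by (auto simp: m_def M_def less_max_iff_disj)
  have b: "m \<le> x powr (s - 2)" "x powr (s - 2) \<le> M" if "1/2 \<le> x" "x \<le> 3/2" for x
    using powr_between[of "1/2" x "3/2" "s - 2"] that by (auto simp: m_def M_def)
  define k where "k = s * (s - 1) / 2"
  have k: "k > 0" using assms by (simp add: k_def)
  have *: "k * m / M * (t\<^sup>2 * (1 + \<bar>t\<bar>) powr (s - 2)) \<le> \<bar>1 + t\<bar> powr s - 1 - s * t \<and>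
     \<bar>1 + t\<bar> powr s - 1 - s * t \<le> k * M / m * (t\<^sup>2 * (1 + \<bar>t\<bar>) powr (s - 2))"
    if t: "\<bar>t\<bar> \<le> 1/2" for t
  proof (cases "t = 0")
    case False
    from t have "-1 < t" by auto
    from powr_remainder_Taylor[OF this False, of s] obtain \<theta> where th: "min 0 t < \<theta>" "\<theta> < max 0 t"
     and eq: "\<bar>1 + t\<bar> powr s - 1 - s * t = k * (1 + \<theta>) powr (s - 2) * t\<^sup>2"
      unfolding k_def by metis
    have th': "1/2 \<le> 1 + \<theta>" "1 + \<theta> \<le> 3/2" using t th by (auto simp: min_def max_def split: if_splits)
    have t': "1/2 \<le> 1 + \<bar>t\<bar>" "1 + \<bar>t\<bar> \<le> 3/2" using t by auto
    have "m / M * (1 + \<bar>t\<bar>) powr (s - 2) \<le> m / M * M"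
      using b(2)[OF t'] mM by (intro mult_left_mono) auto
    also have "\<dots> \<le> (1 + \<theta>) powr (s - 2)" using b(1)[OF th'] mM by simp
    finally have 1: "m / M * (1 + \<bar>t\<bar>) powr (s - 2) \<le> (1 + \<theta>) powr (s - 2)" .
    have "(1 + \<theta>) powr (s - 2) \<le> M / m * m" using b(2)[OF th'] mM by simp
    also have "\<dots> \<le> M / m * (1 + \<bar>t\<bar>) powr (s - 2)"
      using b(1)[OF t'] mM by (intro mult_left_mono) auto
    finally have 2: "(1 + \<theta>) powr (s - 2) \<le> M / m * (1 + \<bar>t\<bar>) powr (s - 2)" .
    have "k * t\<^sup>2 * (m / M * (1 + \<bar>t\<bar>) powr (s - 2)) \<le> k * t\<^sup>2 * (1 + \<theta>) powr (s - 2)"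
      using 1 k by (intro mult_left_mono) auto
    moreover have "k * t\<^sup>2 * (1 + \<theta>) powr (s - 2) \<le> k * t\<^sup>2 * (M / m * (1 + \<bar>t\<bar>) powr (s - 2))"
      using 2 k by (intro mult_left_mono) auto
    ultimately show ?thesis unfolding eq by (simp add: ac_simps)
  qed simp
  show ?thesis
    by (rule that[of "k * m / M" "k * M / m"]) (use k mM * in auto)
qed

text \<open>The quotient of the remainder and \<open>(1 + \<bar>t\<bar>) powr s\<close> tends to 1
  in both directions and is continuous and positive on the compact rest, so it has a positive lower
  bound. The constant is not explicit but depends on s only.\<close>

lemma powr_remainder_far:
  fixes s :: real
  assumes "1 < s"
  obtains c where "0 < c"
    "\<And>t. 1/2 \<le> \<bar>t\<bar> \<Longrightarrow> c * (1 + \<bar>t\<bar>) powr s \<le> \<bar>1 + t\<bar> powr s - 1 - s * t"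
proof -
  have "((\<lambda>t. ((1 + t) powr s - 1 - s * t) / (1 + t) powr s) \<longlongrightarrow> 1) at_top"
    using assms by real_asymp
  then have e1: "eventually (\<lambda>t. ((1 + t) powr s - 1 - s * t) / (1 + t) powr s > 1/2) at_top"
    by (rule order_tendstoD) auto
  \<comment> \<open>With \<open>- t\<close> in place of \<open>t\<close>, this is the limit at minus
    infinity.\<close>
  have "((\<lambda>t. ((t - 1) powr s - 1 + s * t) / (1 + t) powr s) \<longlongrightarrow> 1) at_top"
    using assms by real_asymp
  then have e2: "eventually (\<lambda>t. ((t - 1) powr s - 1 + s * t) / (1 + t) powr s > 1/2) at_top"
    by (rule order_tendstoD) auto
  obtain T0 where T0: "\<And>t. t \<ge> T0 \<Longrightarrow> ((1 + t) powr s - 1 - s * t) / (1 + t) powr s > 1/2 \<and>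
     ((t - 1) powr s - 1 + s * t) / (1 + t) powr s > 1/2"
    using eventually_conj[OF e1 e2] unfolding eventually_at_top_linorder by auto
  define T where "T = max T0 1"
  define g where "g = (\<lambda>t. (\<bar>1 + t\<bar> powr s - 1 - s * t) / (1 + \<bar>t\<bar>) powr s)"
  have gT: "g t > 1/2" if "\<bar>t\<bar> \<ge> T" for t
  proof (cases "t \<ge> 0")
    case True
    then show ?thesis using T0[of t] that by (auto simp: g_def T_def)
  next
    case False
    then have "\<bar>1 + t\<bar> = \<bar>t\<bar> - 1" and t: "t = - \<bar>t\<bar>" using that by (auto simp: T_def)
    then have "g t = ((\<bar>t\<bar> - 1) powr s - 1 + s * \<bar>t\<bar>) / (1 + \<bar>t\<bar>) powr s"
      using False by (simp add: g_def)
    then show ?thesis using T0[of "\<bar>t\<bar>"] that by (simp add: T_def)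
  qed
  define S where "S = {-T..-1/2} \<union> {1/2..T}"
  have cS: "compact S" "S \<noteq> {}" unfolding S_def T_def by auto
  have "continuous_on S g" unfolding g_def
    using assms by (intro continuous_on_divide continuous_on_diff continuous_on_powr' continuous_intros) auto
  from continuous_attains_inf[OF cS this] obtain t0 where t0: "t0 \<in> S" "\<And>t. t \<in> S \<Longrightarrow> g t0 \<le> g t"
    by auto
  have "t0 \<noteq> 0" using t0 by (auto simp: S_def)
  then have g0: "g t0 > 0" unfolding g_def using powr_remainder_pos[OF assms, of t0] by simp
  show ?thesis
  proof
    show "0 < min (g t0) (1/2)" using g0 by simp
    fix t :: real assume t: "1/2 \<le> \<bar>t\<bar>"
    have "min (g t0) (1/2) \<le> g t"
      using gT[of t] t0(2)[of t] t by (cases "\<bar>t\<bar> \<ge> T") (auto simp: S_def abs_if split: if_splits)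
    then show "min (g t0) (1/2) * (1 + \<bar>t\<bar>) powr s \<le> \<bar>1 + t\<bar> powr s - 1 - s * t"
      unfolding g_def by (subst (asm) pos_le_divide_eq) auto
  qed
qed

text \<open>All terms are homogeneous of degree s in (x, y), so for x \<noteq> 0 division by x
  leaves the single variable t = y / x. For x = 0 the expression \<open>\<bar>y\<bar> powr s\<close>
  is compared with itself.\<close>

lemma powr_remainder:
  fixes s :: real
  assumes "1 < s"
  obtains c C where "0 < c" "0 < C"
    "\<And>x y. c * (y\<^sup>2 * (\<bar>y\<bar> + \<bar>x\<bar>) powr (s - 2)) \<le>
       \<bar>x + y\<bar> powr s - \<bar>x\<bar> powr s - s * (\<bar>x\<bar> powr (s - 2) * x * y)"
    "\<And>x y. \<bar>x + y\<bar> powr s - \<bar>x\<bar> powr s - s * (\<bar>x\<bar> powr (s - 2) * x * y) \<le>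
       C * (y\<^sup>2 * (\<bar>y\<bar> + \<bar>x\<bar>) powr (s - 2))"
proof -
  obtain c1 C1 where 1: "0 < c1" "0 < C1"
    "\<And>t. \<bar>t\<bar> \<le> 1/2 \<Longrightarrow> c1 * (t\<^sup>2 * (1 + \<bar>t\<bar>) powr (s - 2)) \<le> \<bar>1 + t\<bar> powr s - 1 - s * t"
    "\<And>t. \<bar>t\<bar> \<le> 1/2 \<Longrightarrow> \<bar>1 + t\<bar> powr s - 1 - s * t \<le> C1 * (t\<^sup>2 * (1 + \<bar>t\<bar>) powr (s - 2))"
    using powr_remainder_near[OF assms] by metis
  obtain c2 where 2: "0 < c2"
    "\<And>t. 1/2 \<le> \<bar>t\<bar> \<Longrightarrow> c2 * (1 + \<bar>t\<bar>) powr s \<le> \<bar>1 + t\<bar> powr s - 1 - s * t"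
    using powr_remainder_far[OF assms] by metis
  \<comment> \<open>The entries 1 serve the case x = 0. The entry \<open>9 * (1 + s)\<close> serves
    |t| > 1/2: there 1 + |t| \<le> 3 |t|, and the remainder is at most
    \<open>(1 + s) * (1 + \<bar>t\<bar>) powr s\<close>.\<close>
  define c C where "c = min 1 (min c1 c2)" and "C = max 1 (max C1 (9 * (1 + s)))"
  have cC: "0 < c" "0 < C" "c \<le> 1" "c \<le> c1" "c \<le> c2" "1 \<le> C" "C1 \<le> C" "9 * (1 + s) \<le> C"
    using 1 2 by (auto simp: c_def C_def)
  have sq: "(1 + \<bar>t\<bar>) powr s = (1 + \<bar>t\<bar>)\<^sup>2 * (1 + \<bar>t\<bar>) powr (s - 2)" for t :: real
    by (simp add: powr_diff)
  have lo: "c * (t\<^sup>2 * (1 + \<bar>t\<bar>) powr (s - 2)) \<le> \<bar>1 + t\<bar> powr s - 1 - s * t" for t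
  proof (cases "\<bar>t\<bar> \<le> 1/2")
    case True
    have "c * (t\<^sup>2 * (1 + \<bar>t\<bar>) powr (s - 2)) \<le> c1 * (t\<^sup>2 * (1 + \<bar>t\<bar>) powr (s - 2))"
      using cC by (intro mult_right_mono) auto
    then show ?thesis using 1(3)[OF True] by linarith
  next
    case False
    have "t\<^sup>2 \<le> (1 + \<bar>t\<bar>)\<^sup>2" by (metis abs_ge_zero abs_le_square_iff abs_of_nonneg add_increasing le_add_same_cancel2 zero_le_one)
    then have "c * (t\<^sup>2 * (1 + \<bar>t\<bar>) powr (s - 2)) \<le> c2 * (1 + \<bar>t\<bar>) powr s"
      unfolding sq using cC by (intro mult_mono) auto
    then show ?thesis using 2(2)[of t] False by linarith
  qed
  have up: "\<bar>1 + t\<bar> powr s - 1 - s * t \<le> C * (t\<^sup>2 * (1 + \<bar>t\<bar>) powr (s - 2))" for t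
  proof (cases "\<bar>t\<bar> \<le> 1/2")
    case True
    have "C1 * (t\<^sup>2 * (1 + \<bar>t\<bar>) powr (s - 2)) \<le> C * (t\<^sup>2 * (1 + \<bar>t\<bar>) powr (s - 2))"
      using cC by (intro mult_right_mono) auto
    then show ?thesis using 1(4)[OF True] by linarith
  next
    case False
    have a: "\<bar>1 + t\<bar> powr s \<le> (1 + \<bar>t\<bar>) powr s"
      using assms by (intro powr_mono2) auto
    have "1 + \<bar>t\<bar> \<le> (1 + \<bar>t\<bar>) powr s" using assms powr_mono[of 1 s "1 + \<bar>t\<bar>"] by simp
    then have "s * (1 + \<bar>t\<bar>) \<le> s * (1 + \<bar>t\<bar>) powr s" using assms by (intro mult_left_mono) auto
    moreover have "- 1 - s * t \<le> s * (1 + \<bar>t\<bar>)" using assms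
      by (smt (verit, ccfv_SIG) mult_left_mono mult_minus_right)
    ultimately have b: "\<bar>1 + t\<bar> powr s - 1 - s * t \<le> (1 + s) * (1 + \<bar>t\<bar>) powr s"
      using a by (simp add: algebra_simps)
    have "(1 + \<bar>t\<bar>)\<^sup>2 \<le> (3 * \<bar>t\<bar>)\<^sup>2" using False by (intro power_mono) auto
    then have "(1 + \<bar>t\<bar>)\<^sup>2 \<le> 9 * t\<^sup>2" by (simp add: power_mult_distrib)
    then have "(1 + s) * (1 + \<bar>t\<bar>) powr s \<le> (1 + s) * (9 * t\<^sup>2 * (1 + \<bar>t\<bar>) powr (s - 2))"
      unfolding sq using assms by (intro mult_left_mono mult_right_mono) auto
    also have "\<dots> = (9 * (1 + s)) * (t\<^sup>2 * (1 + \<bar>t\<bar>) powr (s - 2))" by simp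
    also have "\<dots> \<le> C * (t\<^sup>2 * (1 + \<bar>t\<bar>) powr (s - 2))"
      using cC by (intro mult_right_mono) auto
    finally show ?thesis using b by linarith
  qed
  have main: "c * (y\<^sup>2 * (\<bar>y\<bar> + \<bar>x\<bar>) powr (s - 2)) \<le>
       \<bar>x + y\<bar> powr s - \<bar>x\<bar> powr s - s * (\<bar>x\<bar> powr (s - 2) * x * y) \<and>
      \<bar>x + y\<bar> powr s - \<bar>x\<bar> powr s - s * (\<bar>x\<bar> powr (s - 2) * x * y) \<le>
       C * (y\<^sup>2 * (\<bar>y\<bar> + \<bar>x\<bar>) powr (s - 2))" for x y
  proof (cases "x = 0")
    case True
    have e: "y\<^sup>2 * \<bar>y\<bar> powr (s - 2) = \<bar>y\<bar> powr s" by (cases "y = 0") (auto simp: powr_diff)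
    have "c * \<bar>y\<bar> powr s \<le> 1 * \<bar>y\<bar> powr s" "1 * \<bar>y\<bar> powr s \<le> C * \<bar>y\<bar> powr s"
      using cC by (intro mult_right_mono; simp)+
    with True e show ?thesis by simp
  next
    case False
    define t where "t = y / x"
    have y: "y = t * x" using False by (simp add: t_def)
    have x2: "\<bar>x\<bar> powr s = \<bar>x\<bar> powr (s - 2) * x\<^sup>2" using False by (simp add: powr_diff)
    have e1: "\<bar>x + y\<bar> powr s = \<bar>x\<bar> powr s * \<bar>1 + t\<bar> powr s"
    proof -
      have "\<bar>x + y\<bar> = \<bar>x\<bar> * \<bar>1 + t\<bar>" by (simp add: y algebra_simps flip: abs_mult)
      then show ?thesis by (simp add: powr_mult)
    qed
    have e2: "y\<^sup>2 * (\<bar>y\<bar> + \<bar>x\<bar>) powr (s - 2) = \<bar>x\<bar> powr s * (t\<^sup>2 * (1 + \<bar>t\<bar>) powr (s - 2))"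
    proof -
      have "\<bar>y\<bar> + \<bar>x\<bar> = \<bar>x\<bar> * (1 + \<bar>t\<bar>)" by (simp add: y algebra_simps abs_mult)
      then show ?thesis by (simp add: powr_mult x2 y power_mult_distrib)
    qed
    have e3: "s * (\<bar>x\<bar> powr (s - 2) * x * y) = \<bar>x\<bar> powr s * (s * t)"
      by (simp add: x2 y power2_eq_square)
    have e4: "\<bar>x + y\<bar> powr s - \<bar>x\<bar> powr s - s * (\<bar>x\<bar> powr (s - 2) * x * y)
       = \<bar>x\<bar> powr s * (\<bar>1 + t\<bar> powr s - 1 - s * t)"
      unfolding e1 e3 by (simp add: algebra_simps)
    show ?thesis unfolding e4 e2
      using mult_left_mono[OF lo[of t], of "\<bar>x\<bar> powr s"] mult_left_mono[OF up[of t], of "\<bar>x\<bar> powr s"]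
      by (simp add: ac_simps)
  qed
  show ?thesis by (rule that[of c C]) (use cC main in auto)
qed


section \<open>The comparison for vectors: the l^s norm and its first two variations\<close>

definition lnorm :: "'a set \<Rightarrow> real \<Rightarrow> ('a \<Rightarrow> real) \<Rightarrow> real" where
  "lnorm I s x = (\<Sum>i\<in>I. \<bar>x i\<bar> powr s) powr (1 / s)"

text \<open>Up to the factor s, this is the derivative of \<open>lnorm I s x powr s\<close> in
  direction y.\<close>

definition first_var :: "'a set \<Rightarrow> real \<Rightarrow> ('a \<Rightarrow> real) \<Rightarrow> ('a \<Rightarrow> real) \<Rightarrow> real" where
  "first_var I s x y = (\<Sum>i\<in>I. \<bar>x i\<bar> powr (s - 2) * x i * y i)"

text \<open>The sum in \<open>R2\<close> once the weights are absorbed into the vectors; it measures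
  the second order remainder of the sum of the |x_i|^s.\<close>

definition second_var :: "'a set \<Rightarrow> real \<Rightarrow> ('a \<Rightarrow> real) \<Rightarrow> ('a \<Rightarrow> real) \<Rightarrow> real" where
  "second_var I s x y = (\<Sum>i\<in>I. (y i)\<^sup>2 * (\<bar>y i\<bar> + \<bar>x i\<bar>) powr (s - 2))"

lemma lnorm_nonneg [simp]: "0 \<le> lnorm I s x"
  by (simp add: lnorm_def)

lemma second_var_nonneg [simp]: "0 \<le> second_var I s x y"
  by (simp add: second_var_def sum_nonneg)

lemma lnorm_powr: "0 < s \<Longrightarrow> lnorm I s x powr s = (\<Sum>i\<in>I. \<bar>x i\<bar> powr s)"
  by (simp add: lnorm_def powr_powr sum_nonneg)

text \<open>The sum is at most twice the larger summand. This crude form, with a constant depending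
  on s only, is used in place of Minkowski's inequality.\<close>

lemma abs_add_powr_le:
  fixes a b s :: real
  assumes "0 \<le> s"
  shows "\<bar>a + b\<bar> powr s \<le> 2 powr s * (\<bar>a\<bar> powr s + \<bar>b\<bar> powr s)"
proof -
  have "\<bar>a + b\<bar> powr s \<le> (2 * max \<bar>a\<bar> \<bar>b\<bar>) powr s"
    using assms by (intro powr_mono2) auto
  also have "\<dots> = 2 powr s * max \<bar>a\<bar> \<bar>b\<bar> powr s" by (simp add: powr_mult)
  also have "\<dots> \<le> 2 powr s * (\<bar>a\<bar> powr s + \<bar>b\<bar> powr s)"
    by (intro mult_left_mono) (auto simp: max_def)
  finally show ?thesis .
qed

lemma sum_abs_add_powr_le:
  fixes x y :: "'a \<Rightarrow> real"
  assumes "0 < s"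
  shows "(\<Sum>i\<in>I. \<bar>x i + y i\<bar> powr s) \<le> 2 powr s * (lnorm I s x powr s + lnorm I s y powr s)"
proof -
  have "(\<Sum>i\<in>I. \<bar>x i + y i\<bar> powr s) \<le> (\<Sum>i\<in>I. 2 powr s * (\<bar>x i\<bar> powr s + \<bar>y i\<bar> powr s))"
    using assms by (intro sum_mono abs_add_powr_le) auto
  then show ?thesis using assms by (simp add: lnorm_powr distrib_left sum.distrib sum_distrib_left)
qed

lemma lnorm_eq_0:
  assumes "finite I" "0 < s" "lnorm I s x = 0" "i \<in> I"
  shows "x i = 0"
proof -
  have "(\<Sum>i\<in>I. \<bar>x i\<bar> powr s) = 0"
    using assms lnorm_powr[of s I x] by simp
  then show ?thesis using assms by (subst (asm) sum_nonneg_eq_0_iff) auto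
qed

text \<open>Hoelder's inequality with the constant 2: splitting at \<open>\<bar>y i\<bar> = \<mu> \<bar>x i\<bar>\<close> avoids the sharp form.\<close>

lemma first_var_bound:
  assumes "finite I" "1 < s"
  shows "(\<Sum>i\<in>I. \<bar>x i\<bar> powr (s - 1) * \<bar>y i\<bar>) \<le> 2 * (lnorm I s x powr (s - 1) * lnorm I s y)"
proof (cases "lnorm I s x = 0 \<or> lnorm I s y = 0")
  case True
  then have "\<forall>i\<in>I. x i = 0 \<or> y i = 0" using lnorm_eq_0[OF assms(1), of s] assms(2) by force
  then have "(\<Sum>i\<in>I. \<bar>x i\<bar> powr (s - 1) * \<bar>y i\<bar>) = 0" by (intro sum.neutral) auto
  then show ?thesis by simp
next
  case False
  define \<alpha> \<beta> where "\<alpha> = lnorm I s x" and "\<beta> = lnorm I s y"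
  have pos: "0 < \<alpha>" "0 < \<beta>" using False by (auto simp: \<alpha>_def \<beta>_def less_le)
  \<comment> \<open>With this ratio both sums below have the same value:
    \<open>\<mu> * \<alpha> powr s\<close> and \<open>\<mu> powr (1 - s) * \<beta> powr s\<close>
    equal \<open>\<alpha> powr (s - 1) * \<beta>\<close>.\<close>
  define \<mu> where "\<mu> = \<beta> / \<alpha>"
  have l: "0 < \<mu>" using pos by (simp add: \<mu>_def)
  have *: "\<bar>a\<bar> powr (s - 1) * \<bar>b\<bar> \<le> \<mu> * \<bar>a\<bar> powr s + \<mu> powr (1 - s) * \<bar>b\<bar> powr s" for a b :: real
  proof (cases "\<bar>b\<bar> \<le> \<mu> * \<bar>a\<bar>")
    case True
    have "\<bar>a\<bar> powr (s - 1) * \<bar>b\<bar> \<le> \<bar>a\<bar> powr (s - 1) * (\<mu> * \<bar>a\<bar>)"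
      using True by (intro mult_left_mono) auto
    also have "\<dots> = \<mu> * \<bar>a\<bar> powr s" by (cases "a = 0") (auto simp: powr_diff)
    finally show ?thesis by (simp add: add_increasing2)
  next
    case False
    then have b: "b \<noteq> 0" using l by (auto simp: not_le mult_less_0_iff)
    have "\<bar>a\<bar> powr (s - 1) * \<bar>b\<bar> \<le> (\<bar>b\<bar> / \<mu>) powr (s - 1) * \<bar>b\<bar>"
      using False l assms by (intro mult_right_mono powr_mono2) (auto simp: field_simps)
    also have "\<dots> = \<mu> powr (1 - s) * \<bar>b\<bar> powr s"
      using b l by (simp add: powr_divide powr_diff field_simps)
    finally show ?thesis using l by (simp add: add_increasing)
  qed
  have "(\<Sum>i\<in>I. \<bar>x i\<bar> powr (s - 1) * \<bar>y i\<bar>) \<le>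
      (\<Sum>i\<in>I. \<mu> * \<bar>x i\<bar> powr s + \<mu> powr (1 - s) * \<bar>y i\<bar> powr s)"
    by (intro sum_mono *)
  also have "\<dots> = \<mu> * \<alpha> powr s + \<mu> powr (1 - s) * \<beta> powr s"
    using assms by (simp add: \<alpha>_def \<beta>_def lnorm_powr sum.distrib sum_distrib_left)
  also have "\<dots> = 2 * (\<alpha> powr (s - 1) * \<beta>)"
    using pos by (simp add: \<mu>_def powr_divide powr_diff field_simps)
  finally show ?thesis by (simp add: \<alpha>_def \<beta>_def)
qed

lemma abs_first_var_le:
  assumes "finite I" "1 < s"
  shows "\<bar>first_var I s x y\<bar> \<le> 2 * (lnorm I s x powr (s - 1) * lnorm I s y)"
proof -
  have "\<bar>\<bar>a\<bar> powr (s - 2) * a * b\<bar> = \<bar>a\<bar> powr (s - 1) * \<bar>b\<bar>" for a b :: real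
    by (cases "a = 0") (auto simp: abs_mult powr_diff field_simps power2_eq_square)
  then have "\<bar>first_var I s x y\<bar> \<le> (\<Sum>i\<in>I. \<bar>x i\<bar> powr (s - 1) * \<bar>y i\<bar>)"
    unfolding first_var_def by (intro order.trans[OF sum_abs]) auto
  then show ?thesis using first_var_bound[OF assms, of x y] by linarith
qed

lemma second_var_ge_2:
  assumes "2 \<le> s"
  shows "lnorm I s y powr s \<le> second_var I s x y"
proof -
  have "\<bar>y i\<bar> powr s \<le> (y i)\<^sup>2 * (\<bar>y i\<bar> + \<bar>x i\<bar>) powr (s - 2)" for i
  proof -
    have "\<bar>y i\<bar> powr s = (y i)\<^sup>2 * \<bar>y i\<bar> powr (s - 2)" by (cases "y i = 0") (auto simp: powr_diff)
    also have "\<dots> \<le> (y i)\<^sup>2 * (\<bar>y i\<bar> + \<bar>x i\<bar>) powr (s - 2)"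
      using assms by (intro mult_left_mono powr_mono2) auto
    finally show ?thesis .
  qed
  then show ?thesis using assms by (simp add: lnorm_powr second_var_def sum_mono)
qed

text \<open>In place of a reverse Hoelder inequality, the coordinates are split. Those where |y_i|
  is at most the fraction \<open>\<mu>\<close> of |y_i| + |x_i| contribute at most half of
  \<open>lnorm I s y powr s\<close> and are absorbed; in the others, as \<open>s - 2\<close> is
  negative, |y_i|^s is at most \<open>\<mu> powr (s - 2)\<close> times the summand of
  \<open>second_var\<close>.\<close>

lemma second_var_lt_2:
  assumes "1 < s" "s < 2"
  obtains \<kappa> where "0 < \<kappa>" "\<And>(I::'a set) x y. finite I \<Longrightarrow>
    \<kappa> * (lnorm I s y powr 2 * (lnorm I s y + lnorm I s x) powr (s - 2)) \<le> second_var I s x y"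
proof -
  \<comment> \<open>Chosen to give \<open>k powr s * (2 * 2 powr s) = 1 / 2\<close>: the factor
    \<open>2 powr s\<close> comes from the power of a sum, the factor 2 from bounding both norms by
    \<open>N\<close>, and 1/2 is what can be absorbed.\<close>
  define k where "k = (1 / (4 * 2 powr s)) powr (1 / s)"
  have k: "0 < k" by (simp add: k_def)
  have ks: "k powr s * (2 * 2 powr s) = 1 / 2"
    using assms by (simp add: k_def powr_powr)
  show ?thesis
  proof
    show "0 < k powr (2 - s) / 2" using k by simp
    fix I :: "'a set" and x y :: "'a \<Rightarrow> real" assume fin: "finite I"
    define \<alpha> \<beta> where "\<alpha> = lnorm I s x" and "\<beta> = lnorm I s y"
    show "k powr (2 - s) / 2 * (lnorm I s y powr 2 * (lnorm I s y + lnorm I s x) powr (s - 2)) \<le> second_var I s x y"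
    proof (cases "\<beta> = 0")
      case False
      then have b: "0 < \<beta>" by (simp add: \<beta>_def less_le)
      have a: "0 \<le> \<alpha>" by (simp add: \<alpha>_def)
      define N where "N = \<beta> + \<alpha>"
      have N: "0 < N" "\<beta> \<le> N" "\<alpha> \<le> N" using a b by (auto simp: N_def)
      define \<mu> where "\<mu> = k * \<beta> / N"
      have l: "0 < \<mu>" using k b N by (simp add: \<mu>_def)
      have *: "\<bar>v\<bar> powr s \<le> \<mu> powr (s - 2) * (v\<^sup>2 * (\<bar>v\<bar> + \<bar>u\<bar>) powr (s - 2)) + \<mu> powr s * \<bar>\<bar>v\<bar> + \<bar>u\<bar>\<bar> powr s"
        for u v :: real
      proof (cases "\<bar>v\<bar> \<le> \<mu> * (\<bar>v\<bar> + \<bar>u\<bar>)")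
        case True
        have "\<bar>v\<bar> powr s \<le> (\<mu> * (\<bar>v\<bar> + \<bar>u\<bar>)) powr s"
          using True assms by (intro powr_mono2) auto
        also have "\<dots> = \<mu> powr s * \<bar>\<bar>v\<bar> + \<bar>u\<bar>\<bar> powr s" using l by (simp add: powr_mult)
        finally show ?thesis by (simp add: add_increasing)
      next
        case False
        then have v: "v \<noteq> 0" using l by (auto simp: mult_less_0_iff not_le)
        have "\<bar>v\<bar> powr s = v\<^sup>2 * \<bar>v\<bar> powr (s - 2)" using v by (simp add: powr_diff)
        also have "\<dots> \<le> v\<^sup>2 * (\<mu> * (\<bar>v\<bar> + \<bar>u\<bar>)) powr (s - 2)"
          using False l v assms by (intro mult_left_mono powr_mono2') auto
        also have "\<dots> = \<mu> powr (s - 2) * (v\<^sup>2 * (\<bar>v\<bar> + \<bar>u\<bar>) powr (s - 2))"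
          using l by (simp add: powr_mult)
        finally show ?thesis by (simp add: add_increasing2)
      qed
      have "\<beta> powr s \<le> (\<Sum>i\<in>I. \<mu> powr (s - 2) * ((y i)\<^sup>2 * (\<bar>y i\<bar> + \<bar>x i\<bar>) powr (s - 2))
           + \<mu> powr s * \<bar>\<bar>y i\<bar> + \<bar>x i\<bar>\<bar> powr s)"
        using assms unfolding \<beta>_def by (subst lnorm_powr, simp, intro sum_mono *)
      also have "\<dots> = \<mu> powr (s - 2) * second_var I s x y + \<mu> powr s * (\<Sum>i\<in>I. \<bar>\<bar>y i\<bar> + \<bar>x i\<bar>\<bar> powr s)"
        by (simp add: second_var_def sum.distrib sum_distrib_left)
      also have "(\<Sum>i\<in>I. \<bar>\<bar>y i\<bar> + \<bar>x i\<bar>\<bar> powr s) \<le> 2 powr s * (\<beta> powr s + \<alpha> powr s)"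
        using sum_abs_add_powr_le[of s "\<lambda>i. \<bar>y i\<bar>" "\<lambda>i. \<bar>x i\<bar>" I] assms
        by (simp add: \<alpha>_def \<beta>_def lnorm_def)
      also have "\<beta> powr s + \<alpha> powr s \<le> 2 * N powr s"
        using powr_mono2[of s \<beta> N] powr_mono2[of s \<alpha> N] assms a b N by simp
      also have "\<mu> powr s * (2 powr s * (2 * N powr s)) = \<beta> powr s * (k powr s * (2 * 2 powr s))"
        using k b N by (simp add: \<mu>_def powr_divide powr_mult)
      also have "\<dots> = \<beta> powr s / 2" unfolding ks by simp
      finally have "\<beta> powr s / 2 \<le> \<mu> powr (s - 2) * second_var I s x y" by (simp add: mult_left_mono)
      then have "\<mu> powr (2 - s) * (\<beta> powr s / 2) \<le> \<mu> powr (2 - s) * (\<mu> powr (s - 2) * second_var I s x y)"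
        by (intro mult_left_mono) auto
      also have "\<dots> = second_var I s x y"
        using l by (simp add: powr_add[symmetric] mult.assoc[symmetric])
      finally have "\<mu> powr (2 - s) * (\<beta> powr s / 2) \<le> second_var I s x y" .
      moreover have "\<mu> powr (2 - s) * (\<beta> powr s / 2) = k powr (2 - s) / 2 * (\<beta> powr 2 * N powr (s - 2))"
        using k b N by (simp add: \<mu>_def powr_divide powr_mult powr_diff)
      ultimately show ?thesis by (simp add: \<alpha>_def \<beta>_def N_def)
    qed (simp add: \<beta>_def)
  qed
qed

text \<open>The origin of M = max{s, 2}: the second variation controls |y|^s for s \<ge> 2, but only
  |y|^2 (|y| + |x|)^(s - 2) for s < 2, and \<open>max s 2\<close> writes both in one
  formula.\<close>

lemma second_var_ge:
  assumes "1 < s"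
  obtains \<kappa> where "0 < \<kappa>" "\<And>(I::'a set) x y. finite I \<Longrightarrow>
    \<kappa> * (lnorm I s y powr (max s 2) * (lnorm I s y + lnorm I s x) powr (s - max s 2)) \<le> second_var I s x y"
proof (cases "2 \<le> s")
  case True
  have "1 * (lnorm I s y powr (max s 2) * (lnorm I s y + lnorm I s x) powr (s - max s 2)) \<le> second_var I s x y"
    for I :: "'a set" and x y
  proof -
    \<comment> \<open>A power with exponent 0 is 1, or 0 when its base vanishes; hence an inequality
      and not an equation.\<close>
    have "lnorm I s y powr s * (lnorm I s y + lnorm I s x) powr 0 \<le> lnorm I s y powr s"
      by (simp add: powr_def)
    with second_var_ge_2[OF True, of I y x] True show ?thesis by simp
  qed
  then show ?thesis by (intro that[of 1]) auto
next
  case False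
  then show ?thesis using second_var_lt_2[of s] assms that by (auto simp: max_def)
qed


text \<open>Since y = (x + y) - x, an x of at most a quarter of the size of y cannot cancel it: in
  the bound of |y|^s the share of x is absorbed because
  \<open>2 * 2 powr s \<le> 4 powr s\<close>.\<close>

lemma lnorm_add_ge:
  assumes "1 < s" "0 < lnorm I s y" "lnorm I s x \<le> lnorm I s y / 4"
  shows "(lnorm I s y / 4) powr s \<le> (\<Sum>i\<in>I. \<bar>x i + y i\<bar> powr s)"
proof -
  define \<beta> where "\<beta> = lnorm I s y"
  have b: "0 < \<beta>" using assms by (simp add: \<beta>_def)
  define Z where "Z = (\<Sum>i\<in>I. \<bar>x i + y i\<bar> powr s)"
  have "\<bar>y i\<bar> powr s \<le> 2 powr s * (\<bar>x i + y i\<bar> powr s + \<bar>x i\<bar> powr s)" for i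
    using abs_add_powr_le[of s "x i + y i" "- x i"] assms by simp
  then have "\<beta> powr s \<le> (\<Sum>i\<in>I. 2 powr s * (\<bar>x i + y i\<bar> powr s + \<bar>x i\<bar> powr s))"
    using assms by (simp add: \<beta>_def lnorm_powr sum_mono)
  also have "\<dots> = 2 powr s * (Z + lnorm I s x powr s)"
    using assms by (simp add: Z_def lnorm_powr distrib_left sum.distrib sum_distrib_left)
  also have "lnorm I s x powr s \<le> (\<beta> / 4) powr s"
    using assms by (intro powr_mono2) (auto simp: \<beta>_def)
  finally have "\<beta> powr s \<le> 2 powr s * (Z + (\<beta> / 4) powr s)" by (simp add: mult_left_mono)
  moreover have "2 * 2 powr s \<le> (4::real) powr s"
  proof -
    have "(2::real) * 2 powr s \<le> 2 powr s * 2 powr s"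
      using powr_mono[of 1 s 2] assms by simp
    also have "\<dots> = (2 * 2) powr s" by (simp only: powr_mult)
    finally show ?thesis by simp
  qed
  then have "2 * 2 powr s * (\<beta> / 4) powr s \<le> 4 powr s * (\<beta> / 4) powr s"
    by (intro mult_right_mono) auto
  then have "2 * 2 powr s * (\<beta> / 4) powr s \<le> \<beta> powr s"
    using b by (simp add: powr_divide)
  ultimately have "2 powr s * (\<beta> / 4) powr s \<le> 2 powr s * Z" unfolding distrib_left by linarith
  then show ?thesis by (simp add: \<beta>_def Z_def)
qed

text \<open>The subtracted linear term is the derivative of \<open>lnorm I s x powr p\<close> in
  direction y, by the chain rule for t^(p/s) applied to the s-th power of the norm. It vanishes when
  the norm of x does.\<close>

definition remainder :: "'a set \<Rightarrow> real \<Rightarrow> real \<Rightarrow> ('a \<Rightarrow> real) \<Rightarrow> ('a \<Rightarrow> real) \<Rightarrow> real" where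
  "remainder I p s x y = lnorm I s (\<lambda>i. x i + y i) powr p - lnorm I s x powr p
     - p * lnorm I s x powr (p - s) * first_var I s x y"

text \<open>The s-th power of the norm is a sum over coordinates, so the scalar comparison adds up
  without loss, and the constants depend neither on the index set nor on its size.\<close>

lemma sum_powr_remainder:
  assumes "1 < s"
  obtains c C where "0 < c" "0 < C"
    "\<And>(I::'a set) x y. lnorm I s x powr s + s * first_var I s x y + c * second_var I s x y
         \<le> lnorm I s (\<lambda>i. x i + y i) powr s"
    "\<And>(I::'a set) x y. lnorm I s (\<lambda>i. x i + y i) powr s
         \<le> lnorm I s x powr s + s * first_var I s x y + C * second_var I s x y"
proof -
  obtain c C where cC: "0 < c" "0 < C"
    "\<And>x y. c * (y\<^sup>2 * (\<bar>y\<bar> + \<bar>x\<bar>) powr (s - 2)) \<le>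
       \<bar>x + y\<bar> powr s - \<bar>x\<bar> powr s - s * (\<bar>x\<bar> powr (s - 2) * x * y)"
    "\<And>x y. \<bar>x + y\<bar> powr s - \<bar>x\<bar> powr s - s * (\<bar>x\<bar> powr (s - 2) * x * y) \<le>
       C * (y\<^sup>2 * (\<bar>y\<bar> + \<bar>x\<bar>) powr (s - 2))"
    using powr_remainder[OF assms] by metis
  have "lnorm I s x powr s + s * first_var I s x y + c * second_var I s x y
         \<le> lnorm I s (\<lambda>i. x i + y i) powr s"
    "lnorm I s (\<lambda>i. x i + y i) powr s
         \<le> lnorm I s x powr s + s * first_var I s x y + C * second_var I s x y"
    for I :: "'a set" and x y
  proof -
    have "(\<Sum>i\<in>I. \<bar>x i\<bar> powr s + s * (\<bar>x i\<bar> powr (s - 2) * x i * y i)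
        + c * ((y i)\<^sup>2 * (\<bar>y i\<bar> + \<bar>x i\<bar>) powr (s - 2))) \<le> (\<Sum>i\<in>I. \<bar>x i + y i\<bar> powr s)"
      using cC(3) by (intro sum_mono) (smt (verit))
    then show "lnorm I s x powr s + s * first_var I s x y + c * second_var I s x y
         \<le> lnorm I s (\<lambda>i. x i + y i) powr s"
      using assms by (simp add: lnorm_powr first_var_def second_var_def sum.distrib sum_distrib_left)
    have "(\<Sum>i\<in>I. \<bar>x i + y i\<bar> powr s) \<le> (\<Sum>i\<in>I. \<bar>x i\<bar> powr s + s * (\<bar>x i\<bar> powr (s - 2) * x i * y i)
        + C * ((y i)\<^sup>2 * (\<bar>y i\<bar> + \<bar>x i\<bar>) powr (s - 2)))"
      using cC(4) by (intro sum_mono) (smt (verit))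
    then show "lnorm I s (\<lambda>i. x i + y i) powr s
         \<le> lnorm I s x powr s + s * first_var I s x y + C * second_var I s x y"
      using assms by (simp add: lnorm_powr first_var_def second_var_def sum.distrib sum_distrib_left)
  qed
  with cC show ?thesis by (intro that[of c C]) auto
qed

text \<open>With m = p / s > 1, the function t^m lies above its tangent at X = |x|^s, and
  \<open>sum_powr_remainder\<close> bounds the increment Z - X from below, where Z = |x +
  y|^s.\<close>

lemma remainder_ge_second_var:
  assumes "1 < s" "s < p"
  obtains c where "0 < c"
    "\<And>(I::'a set) x y. c * (lnorm I s x powr (p - s) * second_var I s x y) \<le> remainder I p s x y"
proof -
  obtain c where c: "0 < c"
    "\<And>(I::'a set) x y. lnorm I s x powr s + s * first_var I s x y + c * second_var I s x y
         \<le> lnorm I s (\<lambda>i. x i + y i) powr s"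
    using sum_powr_remainder[OF assms(1), where 'a = 'a] by metis
  define m where "m = p / s"
  have m: "1 < m" using assms by (simp add: m_def)
  obtain c1 where c1: "0 < c1" "\<And>x y. c1 * (y\<^sup>2 * (\<bar>y\<bar> + \<bar>x\<bar>) powr (m - 2)) \<le>
       \<bar>x + y\<bar> powr m - \<bar>x\<bar> powr m - m * (\<bar>x\<bar> powr (m - 2) * x * y)"
    using powr_remainder[OF m] by metis
  have "p * c / s * (lnorm I s x powr (p - s) * second_var I s x y) \<le> remainder I p s x y"
    for I :: "'a set" and x y
  proof (cases "lnorm I s x = 0")
    case False
    define X Z where "X = lnorm I s x powr s" and "Z = lnorm I s (\<lambda>i. x i + y i) powr s"
    have X: "0 < X" "0 \<le> Z" using False by (auto simp: X_def Z_def)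
    have e: "lnorm I s x powr p = X powr m" "lnorm I s (\<lambda>i. x i + y i) powr p = Z powr m"
      "lnorm I s x powr (p - s) = X powr (m - 1)"
      using assms by (auto simp: X_def Z_def powr_powr m_def algebra_simps)
    \<comment> \<open>Dropping this nonnegative term turns the scalar comparison with exponent m
      into the tangent inequality for t^m.\<close>
    have "0 \<le> c1 * ((Z - X)\<^sup>2 * (\<bar>Z - X\<bar> + \<bar>X\<bar>) powr (m - 2))" using c1(1) by simp
    then have "m * (\<bar>X\<bar> powr (m - 2) * X * (Z - X)) \<le> \<bar>X + (Z - X)\<bar> powr m - \<bar>X\<bar> powr m"
      using c1(2)[of "Z - X" X] by linarith
    moreover have "X powr (m - 2) * X = X powr (m - 1)"
      using X by (simp add: powr_diff power2_eq_square)
    ultimately have "m * (X powr (m - 1) * (Z - X)) \<le> Z powr m - X powr m" using X by simp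
    moreover have "m * (X powr (m - 1) * (s * first_var I s x y + c * second_var I s x y))
      \<le> m * (X powr (m - 1) * (Z - X))"
      using c(2)[of I x y] m by (intro mult_left_mono) (auto simp: X_def Z_def)
    moreover have "m * (X powr (m - 1) * (s * first_var I s x y + c * second_var I s x y)) =
       p * X powr (m - 1) * first_var I s x y + p * c / s * (X powr (m - 1) * second_var I s x y)"
      using assms by (simp add: m_def field_simps)
    ultimately show ?thesis unfolding remainder_def e by linarith
  qed (use assms in \<open>simp add: remainder_def\<close>)
  with that[of "p * c / s"] c assms show ?thesis by auto
qed

text \<open>If the norm of x is at least a fixed fraction of that of y, the bound by the second
  variation suffices, because |x|^(p - s) is comparable to (|y| + |x|)^(p - s). Otherwise that
  factor may vanish, and |x + y|^p dominates the remaining terms.\<close>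

lemma remainder_ge_R1:
  assumes "1 < s" "s < p"
  obtains c where "0 < c"
    "\<And>(I::'a set) x y. finite I \<Longrightarrow>
      c * (lnorm I s y powr (max s 2) * (lnorm I s y + lnorm I s x) powr (p - max s 2)) \<le> remainder I p s x y"
proof -
  define M where "M = max s 2"
  obtain c1 where c1: "0 < c1"
    "\<And>(I::'a set) x y. c1 * (lnorm I s x powr (p - s) * second_var I s x y) \<le> remainder I p s x y"
    using remainder_ge_second_var[OF assms, where 'a = 'a] by metis
  obtain \<kappa> where k: "0 < \<kappa>" "\<And>(I::'a set) x y. finite I \<Longrightarrow>
    \<kappa> * (lnorm I s y powr M * (lnorm I s y + lnorm I s x) powr (s - M)) \<le> second_var I s x y"
    using second_var_ge[OF assms(1), where 'a = 'a] unfolding M_def by metis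
  \<comment> \<open>Half of the coefficient (1/4)^p in the lower bound of |x + y|^p by |y|^p. Next
    \<open>\<delta>\<close> is taken so small that the other terms use up at most the other
    half.\<close>
  define k0 where "k0 = (1/4) powr p / (2::real)"
  have k0: "0 < k0" by (simp add: k0_def)
  obtain \<delta> where \<delta>: "0 < \<delta>" "\<delta> \<le> 1/4" "\<delta> powr p + 2 * p * \<delta> powr (p - 1) \<le> k0"
  proof -
    have "((\<lambda>d::real. d powr p + 2 * p * d powr (p - 1)) \<longlongrightarrow> 0) (at_right 0)"
      using assms by real_asymp
    then have "eventually (\<lambda>d. d powr p + 2 * p * d powr (p - 1) < k0) (at_right 0)"
      using k0 by (rule order_tendstoD)
    moreover have "eventually (\<lambda>d::real. d \<in> {0<..<1/4}) (at_right 0)"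
      by (rule eventually_at_right_real) simp
    ultimately have "eventually (\<lambda>d. d \<in> {0<..<1/4} \<and> d powr p + 2 * p * d powr (p - 1) < k0) (at_right 0)"
      by eventually_elim auto
    then obtain d where "d \<in> {0<..<1/4} \<and> d powr p + 2 * p * d powr (p - 1) < k0"
      using eventually_happens'[OF trivial_limit_at_right_real] by blast
    then show ?thesis by (intro that[of d]) auto
  qed
  \<comment> \<open>Pays for replacing |y| + |x| by |y| when |x| \<le> |y|: the two differ by a
    factor of at most 2, in a power whose exponent \<open>p - M\<close> may have either
    sign.\<close>
  define B where "B = max (1::real) (2 powr (p - M))"
  have B: "0 < B" by (simp add: B_def less_max_iff_disj)
  define c2 where "c2 = c1 * ((\<delta> / (1 + \<delta>)) powr (p - s) * \<kappa>)"
  have c2: "0 < c2" using c1 k \<delta> by (simp add: c2_def)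
  have main: "min c2 (k0 / B) * (lnorm I s y powr M * (lnorm I s y + lnorm I s x) powr (p - M)) \<le> remainder I p s x y"
    if fin: "finite I" for I :: "'a set" and x y
  proof -
    define \<alpha> \<beta> where "\<alpha> = lnorm I s x" and "\<beta> = lnorm I s y"
    have ab: "0 \<le> \<alpha>" "0 \<le> \<beta>" by (auto simp: \<alpha>_def \<beta>_def)
    define R where "R = \<beta> powr M * (\<beta> + \<alpha>) powr (p - M)"
    have R: "0 \<le> R" by (simp add: R_def)
    have "c2 * R \<le> remainder I p s x y \<or> k0 / B * R \<le> remainder I p s x y"
    proof (cases "\<delta> * \<beta> \<le> \<alpha>")
      case True
      have "\<delta> / (1 + \<delta>) * (\<beta> + \<alpha>) \<le> \<alpha>" using True \<delta> by (simp add: field_simps)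
      then have "(\<delta> / (1 + \<delta>) * (\<beta> + \<alpha>)) powr (p - s) \<le> \<alpha> powr (p - s)"
        using assms ab \<delta> by (intro powr_mono2) auto
      then have 1: "(\<delta> / (1 + \<delta>)) powr (p - s) * (\<beta> + \<alpha>) powr (p - s) \<le> \<alpha> powr (p - s)"
        by (simp only: powr_mult)
      have "((\<delta> / (1 + \<delta>)) powr (p - s) * (\<beta> + \<alpha>) powr (p - s)) * (\<kappa> * (\<beta> powr M * (\<beta> + \<alpha>) powr (s - M)))
         \<le> \<alpha> powr (p - s) * second_var I s x y"
        using 1 k(2)[OF fin, of y x] k(1) ab by (intro mult_mono) (auto simp: \<alpha>_def \<beta>_def)
      moreover have "(\<beta> + \<alpha>) powr (p - M) = (\<beta> + \<alpha>) powr (p - s) * (\<beta> + \<alpha>) powr (s - M)"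
        by (simp add: powr_add[symmetric])
      ultimately have "c2 * R \<le> c1 * (\<alpha> powr (p - s) * second_var I s x y)"
        using c1(1) by (simp add: c2_def R_def ac_simps)
      also have "\<dots> \<le> remainder I p s x y" unfolding \<alpha>_def by (rule c1(2))
      finally show ?thesis by simp
    next
      case False
      then have b: "0 < \<beta>" using ab by (cases "\<beta> = 0") auto
      have a4: "\<alpha> \<le> \<beta> / 4" using False \<delta> b mult_right_mono[of \<delta> "1/4" \<beta>] by linarith
      have "(\<beta> / 4) powr s \<le> lnorm I s (\<lambda>i. x i + y i) powr s"
        using lnorm_add_ge[of s I y x] a4 b assms by (simp add: \<alpha>_def \<beta>_def lnorm_powr)
      from powr_mono2[OF _ _ this, of "p / s"]
      have "((\<beta> / 4) powr s) powr (p / s) \<le> (lnorm I s (\<lambda>i. x i + y i) powr s) powr (p / s)"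
        using assms by simp
      then have Z: "(\<beta> / 4) powr p \<le> lnorm I s (\<lambda>i. x i + y i) powr p"
        using assms by (simp add: powr_powr)
      have Z': "(\<beta> / 4) powr p = 2 * k0 * \<beta> powr p"
        using b by (simp add: k0_def powr_divide)
      have a: "\<alpha> \<le> \<delta> * \<beta>" using False by simp
      have X: "\<alpha> powr p \<le> \<delta> powr p * \<beta> powr p"
        using powr_mono2[of p \<alpha> "\<delta> * \<beta>"] a ab assms by (simp add: powr_mult)
      have X': "\<alpha> powr (p - 1) \<le> \<delta> powr (p - 1) * \<beta> powr (p - 1)"
        using powr_mono2[of "p - 1" \<alpha> "\<delta> * \<beta>"] a ab assms by (simp add: powr_mult)
      have "\<alpha> powr (p - s) * first_var I s x y \<le> \<alpha> powr (p - s) * (2 * (\<alpha> powr (s - 1) * \<beta>))"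
        using abs_first_var_le[OF fin assms(1), of x y]
        by (intro mult_left_mono) (auto simp: \<alpha>_def \<beta>_def)
      also have "\<dots> = 2 * \<alpha> powr (p - 1) * \<beta>"
        by (simp add: powr_add[symmetric] flip: mult.assoc)
      also have "\<dots> \<le> 2 * (\<delta> powr (p - 1) * \<beta> powr (p - 1)) * \<beta>"
        using X' b by (intro mult_right_mono mult_left_mono) auto
      also have "\<dots> = 2 * \<delta> powr (p - 1) * \<beta> powr p"
        using b by (simp add: powr_diff)
      finally have "p * (\<alpha> powr (p - s) * first_var I s x y) \<le> p * (2 * \<delta> powr (p - 1) * \<beta> powr p)"
        using assms by (intro mult_left_mono) auto
      then have "2 * k0 * \<beta> powr p - (\<delta> powr p + 2 * p * \<delta> powr (p - 1)) * \<beta> powr p \<le> remainder I p s x y"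
        using Z Z' X unfolding remainder_def by (simp add: \<alpha>_def algebra_simps)
      moreover have "(\<delta> powr p + 2 * p * \<delta> powr (p - 1)) * \<beta> powr p \<le> k0 * \<beta> powr p"
        using \<delta>(3) by (intro mult_right_mono) auto
      ultimately have D: "k0 * \<beta> powr p \<le> remainder I p s x y" by linarith
      have "(\<beta> + \<alpha>) powr (p - M) \<le> max (\<beta> powr (p - M)) ((2 * \<beta>) powr (p - M))"
        using b a4 ab by (intro powr_between) auto
      also have "\<dots> = B * \<beta> powr (p - M)" using b by (simp add: B_def powr_mult max_mult_distrib_right)
      finally have "R \<le> \<beta> powr M * (B * \<beta> powr (p - M))"
        unfolding R_def by (intro mult_left_mono) auto
      also have "\<dots> = B * \<beta> powr p" by (simp add: powr_add[symmetric])
      finally have "k0 / B * R \<le> k0 / B * (B * \<beta> powr p)"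
        using k0 B by (intro mult_left_mono) auto
      then show ?thesis using D B by simp
    qed
    moreover have "min c2 (k0 / B) * R \<le> c2 * R" "min c2 (k0 / B) * R \<le> k0 / B * R"
      using R by (intro mult_right_mono; simp)+
    ultimately show ?thesis unfolding R_def \<alpha>_def \<beta>_def by linarith
  qed
  show ?thesis
    by (rule that[of "min c2 (k0 / B)"]) (use c2 k0 B main in \<open>auto simp: M_def\<close>)
qed

lemma lnorm_add_powr_le:
  assumes "1 < s" "s < p"
  shows "lnorm I s (\<lambda>i. x i + y i) powr p \<le> (2 * 2 powr s) powr (p / s) * max (lnorm I s x) (lnorm I s y) powr p"
proof -
  define N where "N = max (lnorm I s x) (lnorm I s y)"
  have "lnorm I s x powr s \<le> N powr s" "lnorm I s y powr s \<le> N powr s"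
    using assms by (auto intro!: powr_mono2 simp: N_def)
  then have "2 powr s * (lnorm I s x powr s + lnorm I s y powr s) \<le> 2 powr s * (2 * N powr s)"
    by (intro mult_left_mono) auto
  then have "lnorm I s (\<lambda>i. x i + y i) powr s \<le> 2 powr s * (2 * N powr s)"
    using sum_abs_add_powr_le[of s x y I] lnorm_powr[of s I "\<lambda>i. x i + y i"] assms by linarith
  from powr_mono2[OF _ _ this, of "p / s"]
  have "(lnorm I s (\<lambda>i. x i + y i) powr s) powr (p / s) \<le> (2 * 2 powr s * N powr s) powr (p / s)"
    using assms by (simp add: ac_simps)
  then show ?thesis using assms by (simp add: powr_powr powr_mult N_def)
qed

text \<open>No cancellation is used: when x is not larger than y, every term of the remainder is at
  most a multiple of |y|^p, and |y|^p is comparable to the R1 expression because |y| + |x| lies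
  between |y| and 2 |y|.\<close>

lemma remainder_le_R1:
  assumes "1 < s" "s < p"
  obtains C where "0 < C"
    "\<And>(I::'a set) x y. finite I \<Longrightarrow> lnorm I s x \<le> lnorm I s y \<Longrightarrow>
      remainder I p s x y \<le> C * (lnorm I s y powr (max s 2) * (lnorm I s y + lnorm I s x) powr (p - max s 2))"
proof -
  define M where "M = max s 2"
  define B where "B = min (1::real) (2 powr (p - M))"
  have B: "0 < B" by (simp add: B_def)
  define A where "A = (2 * 2 powr s) powr (p / s) + 2 * p"
  have A: "0 < A" using assms by (simp add: A_def add_nonneg_pos)
  have "remainder I p s x y \<le> A / B * (lnorm I s y powr M * (lnorm I s y + lnorm I s x) powr (p - M))"
    if fin: "finite I" and le: "lnorm I s x \<le> lnorm I s y" for I :: "'a set" and x y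
  proof -
    define \<alpha> \<beta> where "\<alpha> = lnorm I s x" and "\<beta> = lnorm I s y"
    have ab: "0 \<le> \<alpha>" "\<alpha> \<le> \<beta>" "0 \<le> \<beta>" using le by (auto simp: \<alpha>_def \<beta>_def)
    have "lnorm I s (\<lambda>i. x i + y i) powr p \<le> (2 * 2 powr s) powr (p / s) * \<beta> powr p"
      using lnorm_add_powr_le[OF assms, of I x y] le by (simp add: \<beta>_def max_def split: if_splits)
    moreover have "- (\<alpha> powr (p - s) * first_var I s x y) \<le> 2 * \<beta> powr p"
    proof -
      have "\<alpha> powr (p - s) * - first_var I s x y \<le> \<alpha> powr (p - s) * (2 * (\<alpha> powr (s - 1) * \<beta>))"
        using abs_first_var_le[OF fin assms(1), of x y]
        by (intro mult_left_mono) (auto simp: \<alpha>_def \<beta>_def)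
      also have "\<dots> = 2 * (\<alpha> powr (p - 1) * \<beta>)"
        by (simp add: powr_add[symmetric] flip: mult.assoc)
      also have "\<dots> \<le> 2 * (\<beta> powr (p - 1) * \<beta>)"
        using ab assms by (intro mult_right_mono mult_left_mono powr_mono2) auto
      also have "\<beta> powr (p - 1) * \<beta> = \<beta> powr p"
        using ab by (cases "\<beta> = 0") (auto simp: powr_diff)
      finally show ?thesis by simp
    qed
    then have "p * - (\<alpha> powr (p - s) * first_var I s x y) \<le> p * (2 * \<beta> powr p)"
      using assms by (intro mult_left_mono) auto
    moreover have "remainder I p s x y = lnorm I s (\<lambda>i. x i + y i) powr p - \<alpha> powr p
       + p * - (\<alpha> powr (p - s) * first_var I s x y)"
      by (simp add: remainder_def \<alpha>_def)
    moreover have "A * \<beta> powr p = (2 * 2 powr s) powr (p / s) * \<beta> powr p + p * (2 * \<beta> powr p)"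
      by (simp add: A_def distrib_right)
    ultimately have D: "remainder I p s x y \<le> A * \<beta> powr p"
      using powr_ge_zero[of \<alpha> p] by linarith
    have "B * \<beta> powr p \<le> \<beta> powr M * (\<beta> + \<alpha>) powr (p - M)"
    proof (cases "\<beta> = 0")
      case False
      then have b: "0 < \<beta>" using ab by simp
      have "B * \<beta> powr (p - M) = min (\<beta> powr (p - M)) ((2 * \<beta>) powr (p - M))"
        using b by (simp add: B_def powr_mult min_mult_distrib_right)
      also have "\<dots> \<le> (\<beta> + \<alpha>) powr (p - M)"
        using b ab by (intro powr_between) auto
      finally have "\<beta> powr M * (B * \<beta> powr (p - M)) \<le> \<beta> powr M * (\<beta> + \<alpha>) powr (p - M)"
        by (intro mult_left_mono) auto
      moreover have "\<beta> powr M * (B * \<beta> powr (p - M)) = B * \<beta> powr p" by (simp add: powr_add[symmetric])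
      ultimately show ?thesis by linarith
    qed simp
    then have "A / B * (B * \<beta> powr p) \<le> A / B * (\<beta> powr M * (\<beta> + \<alpha>) powr (p - M))"
      using A B by (intro mult_left_mono) auto
    then have "A * \<beta> powr p \<le> A / B * (\<beta> powr M * (\<beta> + \<alpha>) powr (p - M))" using B by simp
    with D show ?thesis by (simp add: \<alpha>_def \<beta>_def)
  qed
  then show ?thesis using A B by (intro that[of "A / B"]) (auto simp: M_def)
qed

text \<open>The quadratic error of t^m at X = |x|^s has to be a multiple of
  \<open>X powr (m - 1)\<close> times the second variation S, which amounts to (Z - X)^2 being at
  most a multiple of S X. That y is smaller than x gives X > 0 and makes the sum of the (|y_i| +
  |x_i|)^s at most a multiple of X.\<close>

lemma remainder_le_R2:
  assumes "1 < s" "s < p"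
  obtains C where "0 < C"
    "\<And>(I::'a set) x y. finite I \<Longrightarrow> lnorm I s y < lnorm I s x \<Longrightarrow>
      remainder I p s x y \<le> C * (lnorm I s x powr (p - s) * second_var I s x y)"
proof -
  obtain c C where C: "0 < c" "0 < C"
    "\<And>(I::'a set) x y. lnorm I s x powr s + s * first_var I s x y + c * second_var I s x y
         \<le> lnorm I s (\<lambda>i. x i + y i) powr s"
    "\<And>(I::'a set) x y. lnorm I s (\<lambda>i. x i + y i) powr s
         \<le> lnorm I s x powr s + s * first_var I s x y + C * second_var I s x y"
    using sum_powr_remainder[OF assms(1), where 'a = 'a] by blast
  define m where "m = p / s"
  have m: "1 < m" using assms by (simp add: m_def)
  obtain C1 where C1: "0 < C1" "\<And>x y. \<bar>x + y\<bar> powr m - \<bar>x\<bar> powr m - m * (\<bar>x\<bar> powr (m - 2) * x * y) \<le>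
      C1 * (y\<^sup>2 * (\<bar>y\<bar> + \<bar>x\<bar>) powr (m - 2))"
    using powr_remainder[OF m] by metis
  \<comment> \<open>Z is at most \<open>2 * 2 powr s * X\<close>, so
    \<open>\<bar>Z - X\<bar> + \<bar>X\<bar>\<close> lies between \<open>X\<close> and
    \<open>H * X\<close>.\<close>
  define H where "H = 2 * 2 powr s + (2::real)"
  have H: "1 \<le> H" by (simp add: H_def add_increasing)
  define B where "B = max (1::real) (H powr (m - 2))"
  have B: "0 < B" by (simp add: B_def less_max_iff_disj)
  define E where "E = (s + C)\<^sup>2 * (2 powr s * 2)"
  have E: "0 < E" using assms C by (simp add: E_def)
  have "remainder I p s x y \<le> (C1 * B * E + m * C) * (lnorm I s x powr (p - s) * second_var I s x y)"
    if fin: "finite I" and less: "lnorm I s y < lnorm I s x" for I :: "'a set" and x y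
  proof -
    define X Z S where "X = lnorm I s x powr s" and "Z = lnorm I s (\<lambda>i. x i + y i) powr s"
      and "S = second_var I s x y"
    have S: "0 \<le> S" by (simp add: S_def)
    have x0: "0 < lnorm I s x" using less lnorm_nonneg[of I s y] by linarith
    then have X: "0 < X" "0 \<le> Z" by (auto simp: X_def Z_def)
    have yX: "lnorm I s y powr s \<le> X" unfolding X_def using less assms by (intro powr_mono2) auto
    have e: "lnorm I s x powr p = X powr m" "lnorm I s (\<lambda>i. x i + y i) powr p = Z powr m"
      "lnorm I s x powr (p - s) = X powr (m - 1)"
      using assms by (auto simp: X_def Z_def powr_powr m_def algebra_simps)
    define T where "T = (\<Sum>i\<in>I. \<bar>\<bar>y i\<bar> + \<bar>x i\<bar>\<bar> powr s)"
    have T: "T \<le> 2 powr s * (2 * X)"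
    proof -
      have "T \<le> 2 powr s * (lnorm I s y powr s + lnorm I s x powr s)"
        using sum_abs_add_powr_le[of s "\<lambda>i. \<bar>y i\<bar>" "\<lambda>i. \<bar>x i\<bar>" I] assms by (simp add: T_def lnorm_def)
      also have "\<dots> \<le> 2 powr s * (2 * X)" using yX by (intro mult_left_mono) (auto simp: X_def)
      finally show ?thesis .
    qed
    have Zle: "Z \<le> 2 powr s * (2 * X)"
    proof -
      have "Z \<le> 2 powr s * (lnorm I s x powr s + lnorm I s y powr s)"
        using sum_abs_add_powr_le[of s x y I] assms by (simp add: Z_def lnorm_powr)
      also have "\<dots> \<le> 2 powr s * (2 * X)" using yX by (intro mult_left_mono) (auto simp: X_def)
      finally show ?thesis .
    qed
    \<comment> \<open>A common bound for S and for the modulus of the first variation, and hence, up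
      to a factor, for |Z - X|. Splitting the exponent \<open>s - 1\<close> as
      \<open>(s - 2) / 2 + s / 2\<close> lets Cauchy-Schwarz bound its square by
      \<open>S * T\<close>.\<close>
    define W where "W = (\<Sum>i\<in>I. \<bar>y i\<bar> * (\<bar>y i\<bar> + \<bar>x i\<bar>) powr (s - 1))"
    have W: "W\<^sup>2 \<le> S * T"
    proof -
      have "W = (\<Sum>i\<in>I. (\<bar>y i\<bar> * (\<bar>y i\<bar> + \<bar>x i\<bar>) powr ((s - 2) / 2)) * (\<bar>y i\<bar> + \<bar>x i\<bar>) powr (s / 2))"
      proof -
        have "(s - 2) / 2 + s / 2 = s - 1" by (simp add: field_simps)
        then show ?thesis unfolding W_def mult.assoc powr_add[symmetric] by simp
      qed
      then have "W\<^sup>2 \<le> (\<Sum>i\<in>I. (\<bar>y i\<bar> * (\<bar>y i\<bar> + \<bar>x i\<bar>) powr ((s - 2) / 2))\<^sup>2) *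
         (\<Sum>i\<in>I. ((\<bar>y i\<bar> + \<bar>x i\<bar>) powr (s / 2))\<^sup>2)"
        by (simp only: Cauchy_Schwarz_ineq_sum)
      also have "\<dots> = S * T"
      proof -
        have "(a powr (e / 2))\<^sup>2 = a powr e" for a e :: real
          by (simp add: power2_eq_square powr_add[symmetric])
        then show ?thesis
          unfolding S_def second_var_def T_def by (simp add: power_mult_distrib)
      qed
      finally show ?thesis .
    qed
    have fv: "\<bar>first_var I s x y\<bar> \<le> W"
    proof -
      have "\<bar>\<bar>a\<bar> powr (s - 2) * a * b\<bar> \<le> \<bar>b\<bar> * (\<bar>b\<bar> + \<bar>a\<bar>) powr (s - 1)" for a b :: real
      proof -
        have "\<bar>\<bar>a\<bar> powr (s - 2) * a * b\<bar> = \<bar>b\<bar> * \<bar>a\<bar> powr (s - 1)"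
          by (cases "a = 0") (auto simp: abs_mult powr_diff field_simps power2_eq_square)
        also have "\<dots> \<le> \<bar>b\<bar> * (\<bar>b\<bar> + \<bar>a\<bar>) powr (s - 1)"
          using assms by (intro mult_left_mono powr_mono2) auto
        finally show ?thesis .
      qed
      then show ?thesis unfolding first_var_def W_def by (intro order.trans[OF sum_abs] sum_mono) auto
    qed
    have sv: "S \<le> W"
    proof -
      have "b\<^sup>2 * (\<bar>b\<bar> + \<bar>a\<bar>) powr (s - 2) \<le> \<bar>b\<bar> * (\<bar>b\<bar> + \<bar>a\<bar>) powr (s - 1)" for a b :: real
      proof (cases "b = 0")
        case False
        have "b\<^sup>2 * (\<bar>b\<bar> + \<bar>a\<bar>) powr (s - 2) = \<bar>b\<bar> * (\<bar>b\<bar> * (\<bar>b\<bar> + \<bar>a\<bar>) powr (s - 2))"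
          by (simp add: power2_eq_square flip: mult.assoc)
        also have "\<dots> \<le> \<bar>b\<bar> * ((\<bar>b\<bar> + \<bar>a\<bar>) * (\<bar>b\<bar> + \<bar>a\<bar>) powr (s - 2))"
          by (intro mult_left_mono mult_right_mono) auto
        also have "(\<bar>b\<bar> + \<bar>a\<bar>) * (\<bar>b\<bar> + \<bar>a\<bar>) powr (s - 2) = (\<bar>b\<bar> + \<bar>a\<bar>) powr (s - 1)"
          using False powr_mult_base[of "\<bar>b\<bar> + \<bar>a\<bar>" "s - 2"] by simp
        finally show ?thesis .
      qed simp
      then show ?thesis unfolding S_def second_var_def W_def by (intro sum_mono) auto
    qed
    have "\<bar>Z - X\<bar> \<le> (s + C) * W"
    proof -
      have "Z - X \<le> s * first_var I s x y + C * S" "s * first_var I s x y \<le> Z - X"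
        using C(4)[of I x y] C(3)[of I x y] mult_nonneg_nonneg[OF less_imp_le[OF C(1)] S]
        unfolding X_def Z_def S_def by linarith+
      moreover have "s * first_var I s x y \<le> s * W" "s * - first_var I s x y \<le> s * W"
        using fv assms by (intro mult_left_mono; simp)+
      moreover have "0 \<le> C * S" "C * S \<le> C * W" using sv S C by (auto intro!: mult_left_mono)
      ultimately show ?thesis unfolding distrib_right abs_le_iff mult_minus_right by linarith
    qed
    then have "(Z - X)\<^sup>2 \<le> ((s + C) * W)\<^sup>2" by (metis abs_le_square_iff abs_ge_zero abs_of_nonneg order.trans)
    also have "\<dots> \<le> (s + C)\<^sup>2 * (S * (2 powr s * (2 * X)))"
      using W T S mult_left_mono[OF T S] by (auto simp: power_mult_distrib intro!: mult_left_mono)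
    finally have sq: "(Z - X)\<^sup>2 \<le> E * S * X" by (simp add: E_def ac_simps)
    have "(\<bar>Z - X\<bar> + \<bar>X\<bar>) powr (m - 2) \<le> max (X powr (m - 2)) ((H * X) powr (m - 2))"
      using Zle X by (intro powr_between) (auto simp: H_def algebra_simps)
    also have "\<dots> = B * X powr (m - 2)"
      using X H by (simp add: B_def powr_mult max_mult_distrib_right)
    finally have "C1 * ((Z - X)\<^sup>2 * (\<bar>Z - X\<bar> + \<bar>X\<bar>) powr (m - 2)) \<le> C1 * ((E * S * X) * (B * X powr (m - 2)))"
      using sq C1 E S X by (intro mult_left_mono mult_mono) auto
    also have "\<dots> = C1 * B * E * (X powr (m - 1) * S)" using X by (simp add: powr_diff power2_eq_square)
    finally have "Z powr m - X powr m - m * (X powr (m - 2) * X * (Z - X)) \<le> C1 * B * E * (X powr (m - 1) * S)"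
      using C1(2)[of X "Z - X"] X by simp
    moreover have "X powr (m - 2) * X = X powr (m - 1)" using X by (simp add: powr_diff power2_eq_square)
    ultimately have "Z powr m - X powr m \<le> m * (X powr (m - 1) * (Z - X)) + C1 * B * E * (X powr (m - 1) * S)"
      by simp
    moreover have "m * (X powr (m - 1) * (Z - X)) \<le> m * (X powr (m - 1) * (s * first_var I s x y + C * S))"
      using C(4)[of I x y] m by (intro mult_left_mono) (auto simp: X_def Z_def S_def)
    moreover have "m * s = p" using assms by (simp add: m_def)
    then have "m * (X powr (m - 1) * (s * first_var I s x y + C * S)) =
       p * X powr (m - 1) * first_var I s x y + m * C * (X powr (m - 1) * S)"
      by (simp add: algebra_simps flip: \<open>m * s = p\<close>)
    ultimately show ?thesis unfolding remainder_def e S_def[symmetric]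
      by (simp add: distrib_right)
  qed
  moreover have "0 < C1 * B * E + m * C" using C C1 B E m by (simp add: add_pos_pos)
  ultimately show ?thesis by (intro that[of "C1 * B * E + m * C"]) auto
qed

section \<open>Smooth kernels on the line\<close>

text \<open>The derivatives are carried as an explicit sequence of functions; it later becomes the
  sequence \<open>D\<close> of a mollifier.\<close>

definition smooth :: "(real \<Rightarrow> real) \<Rightarrow> bool" where
  "smooth f \<longleftrightarrow> (\<exists>D :: nat \<Rightarrow> real \<Rightarrow> real. D 0 = f \<and> (\<forall>k x. (D k has_real_derivative D (Suc k) x) (at x)))"

lemma smoothI: "D 0 = f \<Longrightarrow> (\<And>k x. (D k has_real_derivative D (Suc k) x) (at x)) \<Longrightarrow> smooth f"
  for D :: "nat \<Rightarrow> real \<Rightarrow> real"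
  unfolding smooth_def by blast

lemma smooth_affine:
  assumes "smooth f"
  shows "smooth (\<lambda>x. f (a * x + b))"
proof -
  obtain D where D: "D 0 = f" "\<And>k x. (D k has_real_derivative D (Suc k) x) (at x)"
    using assms unfolding smooth_def by blast
  show ?thesis
  proof (rule smoothI[where D = "\<lambda>k x. a ^ k * D k (a * x + b)"])
    fix k x
    have "((\<lambda>x. D k (a * x + b)) has_real_derivative D (Suc k) (a * x + b) * a) (at x)"
      by (rule DERIV_chain2[OF D(2)]) (auto intro!: derivative_eq_intros)
    from DERIV_cmult[OF this, of "a ^ k"]
    show "((\<lambda>x. a ^ k * D k (a * x + b)) has_real_derivative a ^ Suc k * D (Suc k) (a * x + b)) (at x)"
      by (simp add: ac_simps)
  qed (use D in auto)
qed

lemma smooth_cmult: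
  assumes "smooth f"
  shows "smooth (\<lambda>x. c * f x)"
proof -
  obtain D where D: "D 0 = f" "\<And>k x. (D k has_real_derivative D (Suc k) x) (at x)"
    using assms unfolding smooth_def by blast
  show ?thesis
    by (rule smoothI[where D = "\<lambda>k x. c * D k x"]) (use D in \<open>auto intro: DERIV_cmult\<close>)
qed

lemma smooth_mult:
  assumes "smooth f" "smooth g"
  shows "smooth (\<lambda>x. f x * g x)"
proof -
  obtain D where D: "D 0 = f" "\<And>k x. (D k has_real_derivative D (Suc k) x) (at x)"
    using assms unfolding smooth_def by blast
  obtain E where E: "E 0 = g" "\<And>k x. (E k has_real_derivative E (Suc k) x) (at x)"
    using assms unfolding smooth_def by blast
  \<comment> \<open>Leibniz's formula for the k-th derivative of the product.\<close>
  define L where "L = (\<lambda>k x. \<Sum>j\<le>k. real (k choose j) * (D j x * E (k - j) x))"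
  show ?thesis
  proof (rule smoothI[where D = L])
    show "L 0 = (\<lambda>x. f x * g x)" by (simp add: L_def D E)
    fix k x
    have "(L k has_real_derivative (\<Sum>j\<le>k. real (k choose j) * (D j x * E (Suc (k - j)) x + D (Suc j) x * E (k - j) x))) (at x)"
      unfolding L_def by (intro DERIV_sum DERIV_cmult DERIV_mult' D E)
    also have "(\<Sum>j\<le>k. real (k choose j) * (D j x * E (Suc (k - j)) x + D (Suc j) x * E (k - j) x))
      = (\<Sum>j\<le>k. real (k choose j) * (D j x * E (Suc k - j) x)) +
        (\<Sum>j\<le>k. real (k choose j) * (D (Suc j) x * E (Suc k - Suc j) x))"
      by (simp add: sum.distrib[symmetric] distrib_left Suc_diff_le)
    \<comment> \<open>The added term with index \<open>Suc k\<close> has binomial coefficient 0.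
      After the shift of the index both sums run over the same terms and Pascal's rule combines
      them.\<close>
    also have "(\<Sum>j\<le>k. real (k choose j) * (D j x * E (Suc k - j) x)) =
        (\<Sum>j\<le>Suc k. real (k choose j) * (D j x * E (Suc k - j) x))"
      by simp
    also have "\<dots> = D 0 x * E (Suc k) x + (\<Sum>j\<le>k. real (k choose Suc j) * (D (Suc j) x * E (Suc k - Suc j) x))"
      by (subst sum.atMost_Suc_shift) simp
    also have "\<dots> + (\<Sum>j\<le>k. real (k choose j) * (D (Suc j) x * E (Suc k - Suc j) x)) =
      D 0 x * E (Suc k) x + (\<Sum>j\<le>k. real (Suc k choose Suc j) * (D (Suc j) x * E (Suc k - Suc j) x))"
      by (simp add: sum.distrib[symmetric] distrib_right add.commute)
    also have "\<dots> = L (Suc k) x"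
      unfolding L_def by (subst sum.atMost_Suc_shift) simp
    finally show "(L k has_real_derivative L (Suc k) x) (at x)" .
  qed
qed

text \<open>The functions P(1/x) exp(-1/x), extended by 0, form a class closed under
  differentiation: the polynomial P becomes X^2 (P - P'). A single first derivative therefore yields
  smoothness of all orders.\<close>

definition flat :: "real poly \<Rightarrow> real \<Rightarrow> real" where
  "flat P x = (if x > 0 then poly P (1 / x) * exp (- 1 / x) else 0)"

lemma poly_exp_tendsto_0:
  fixes P :: "real poly"
  shows "((\<lambda>y. poly P y * exp (- y)) \<longlongrightarrow> 0) at_top"
proof -
  have "((\<lambda>y. \<Sum>i\<le>degree P. coeff P i * (y ^ i / exp y)) \<longlongrightarrow> (\<Sum>i\<le>degree P. coeff P i * 0)) at_top"
    by (intro tendsto_sum tendsto_mult tendsto_const tendsto_power_div_exp_0)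
  then show ?thesis
    by (simp add: poly_altdef exp_minus divide_inverse sum_distrib_right mult.assoc)
qed

lemma flat_deriv: "(flat P has_real_derivative flat ([:0, 0, 1:] * (P - pderiv P)) x) (at x)"
proof -
  consider "x > 0" | "x < 0" | "x = 0" by linarith
  then show ?thesis
  proof cases
    case 1
    have "((\<lambda>x. poly P (1 / x) * exp (- 1 / x)) has_real_derivative flat ([:0, 0, 1:] * (P - pderiv P)) x) (at x)"
      using 1 by (auto intro!: derivative_eq_intros DERIV_chain'[OF _ poly_DERIV]
          simp: flat_def field_simps power2_eq_square)
    then show ?thesis
      by (rule has_field_derivative_transform_within_open[where S = "{0<..}"]) (use 1 in \<open>auto simp: flat_def\<close>)
  next
    case 2
    have "((\<lambda>x. 0) has_real_derivative flat ([:0, 0, 1:] * (P - pderiv P)) x) (at x)"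
      using 2 by (simp add: flat_def)
    then show ?thesis
      by (rule has_field_derivative_transform_within_open[where S = "{..<0}"]) (use 2 in \<open>auto simp: flat_def\<close>)
  next
    case 3
    have "((\<lambda>h. flat P h / h) \<longlongrightarrow> 0) (at_left 0)"
      by (rule tendsto_eventually) (auto simp: flat_def eventually_at_filter)
    moreover have "((\<lambda>h. flat P h / h) \<longlongrightarrow> 0) (at_right 0)"
    proof -
      \<comment> \<open>Division by h multiplies the polynomial by X, so the difference quotient at
        0 is again of the form that the exponential sends to 0.\<close>
      have "((\<lambda>h. poly ([:0, 1:] * P) (inverse h) * exp (- inverse h)) \<longlongrightarrow> 0) (at_right 0)"
        by (rule filterlim_compose[OF poly_exp_tendsto_0 filterlim_inverse_at_top_right])
      then show ?thesis
        by (rule Lim_transform_eventually)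
          (auto simp: flat_def eventually_at_filter field_simps)
    qed
    ultimately have "((\<lambda>h. flat P h / h) \<longlongrightarrow> 0) (at 0)"
      by (simp add: filterlim_split_at)
    then show ?thesis using 3 by (simp add: DERIV_def flat_def)
  qed
qed

lemma smooth_flat: "smooth (flat P)"
  by (rule smoothI[where D = "\<lambda>k. flat (((\<lambda>P. [:0, 0, 1:] * (P - pderiv P)) ^^ k) P)"])
    (auto intro: flat_deriv[simplified])

text \<open>\<open>D k\<close> is the \<open>k\<close>-th derivative of an even mollifying kernel on the line.\<close>

definition mollifier :: "real \<Rightarrow> (nat \<Rightarrow> real \<Rightarrow> real) \<Rightarrow> bool" where
  "mollifier \<epsilon> D \<longleftrightarrow> 0 < \<epsilon> \<and> (\<forall>k x. (D k has_real_derivative D (Suc k) x) (at x)) \<and>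
     (\<forall>k x. \<epsilon> \<le> \<bar>x\<bar> \<longrightarrow> D k x = 0) \<and> (\<forall>x. 0 \<le> D 0 x) \<and> (\<forall>x. D 0 (- x) = D 0 x) \<and>
     integrable lborel (D 0) \<and> (LINT x|lborel. D 0 x) = 1"

lemma mollifier_exists:
  assumes "0 < \<epsilon>"
  shows "\<exists>D. mollifier \<epsilon> D"
proof -
  \<comment> \<open>Positive exactly on the open interval from \<open>- \<epsilon>\<close> to
    \<open>\<epsilon>\<close>, and even because a reflection exchanges the two factors.\<close>
  define h where "h = (\<lambda>x. flat 1 (x + \<epsilon>) * flat 1 (\<epsilon> - x))"
  have h: "h x = (if \<bar>x\<bar> < \<epsilon> then exp (- 1 / (x + \<epsilon>)) * exp (- 1 / (\<epsilon> - x)) else 0)" for x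
    by (auto simp: h_def flat_def)
  have smh: "smooth h"
    unfolding h_def
    using smooth_mult[OF smooth_affine[OF smooth_flat, of 1 1 \<epsilon>] smooth_affine[OF smooth_flat, of 1 "-1" \<epsilon>]]
    by (simp add: add.commute)
  then have "continuous_on UNIV h"
    unfolding smooth_def by (metis DERIV_continuous_on)
  then have int: "set_integrable lborel {-\<epsilon>..\<epsilon>} h"
    unfolding set_integrable_def by (intro borel_integrable_compact) (auto intro: continuous_on_subset)
  have ind: "indicator {-\<epsilon>..\<epsilon>} x *\<^sub>R h x = h x" for x by (auto simp: h indicator_def)
  have int: "integrable lborel h" using int unfolding set_integrable_def ind .
  define J where "J = (LINT x|lborel. h x)"
  have "J > 0"
  proof -
    have "J \<noteq> 0"
    proof
      assume "J = 0"
      then have "AE x in lborel. h x = 0"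
        unfolding J_def using int by (subst (asm) integral_nonneg_eq_0_iff_AE) (auto simp: h)
      then have "AE x in lborel. x \<notin> {-\<epsilon><..<\<epsilon>}"
        by eventually_elim (auto simp: h abs_less_iff split: if_splits)
      then have "{-\<epsilon><..<\<epsilon>} \<in> null_sets lborel" by (subst AE_iff_null_sets) auto
      then show False using assms by (auto dest!: null_setsD1)
    qed
    moreover have "0 \<le> J" unfolding J_def by (rule integral_nonneg_AE) (auto simp: h)
    ultimately show ?thesis by simp
  qed
  obtain D where D: "D 0 = (\<lambda>x. 1 / J * h x)" "\<And>k x. (D k has_real_derivative D (Suc k) x) (at x)"
    using smooth_cmult[OF smh, of "1 / J"] unfolding smooth_def by blast
  have z1: "D k x = 0" if "\<epsilon> < \<bar>x\<bar>" for k x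
    using that
  proof (induction k arbitrary: x)
    case (Suc k)
    have "((\<lambda>x. 0) has_real_derivative D (Suc k) x) (at x)"
      by (rule has_field_derivative_transform_within_open[OF D(2), where S = "{x. \<epsilon> < \<bar>x\<bar>}"])
        (use Suc in \<open>auto intro!: open_Collect_less continuous_intros\<close>)
    then show ?case by (metis DERIV_const DERIV_unique)
  qed (use D in \<open>auto simp: h\<close>)
  \<comment> \<open>The support condition includes the two endpoints, where the derivatives vanish
    by continuity.\<close>
  have z: "D k x = 0" if "\<epsilon> \<le> \<bar>x\<bar>" for k x
  proof -
    have cont: "isCont (D k) y" for y using D(2) by (rule DERIV_isCont)
    have "closed {x. D k x = 0}"
      by (intro closed_Collect_eq continuous_at_imp_continuous_on ballI cont continuous_on_const)
    then have "closure {x. \<epsilon> < \<bar>x\<bar>} \<subseteq> {x. D k x = 0}" using z1 by (intro closure_minimal) auto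
    moreover have "x \<in> closure {x. \<epsilon> < \<bar>x\<bar>}"
    proof (subst closure_approachable, intro allI impI)
      fix e :: real assume e: "0 < e"
      show "\<exists>y\<in>{x. \<epsilon> < \<bar>x\<bar>}. dist y x < e"
        by (rule bexI[of _ "if x \<ge> 0 then x + e / 2 else x - e / 2"]) (use e that assms in \<open>auto simp: dist_real_def\<close>)
    qed
    ultimately show ?thesis by blast
  qed
  have "mollifier \<epsilon> D"
    unfolding mollifier_def
  proof (intro conjI allI impI)
    show "integrable lborel (D 0)" using int by (simp add: D(1))
    show "(LINT x|lborel. D 0 x) = 1" using \<open>J > 0\<close> by (simp add: D(1) flip: J_def)
  qed (use assms D z \<open>J > 0\<close> in \<open>auto simp: h mult.commute add.commute\<close>)
  then show ?thesis by blast
qed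

section \<open>Boxes and Lebesgue measure on the carrier of dimension n\<close>

text \<open>Cubes are products, so compactness, connectedness and finite measure come from
  intervals, and they are the supports of product kernels. Only the coordinates of the centre below
  n are read, so \<open>\<lambda>_. 0\<close> can serve as a centre without lying in
  \<open>Rn n\<close>.\<close>

definition closed_box :: "nat \<Rightarrow> (nat \<Rightarrow> real) \<Rightarrow> real \<Rightarrow> (nat \<Rightarrow> real) set" where
  "closed_box n x r = {y \<in> Rn n. \<forall>i<n. \<bar>y i - x i\<bar> \<le> r}"

definition open_box :: "nat \<Rightarrow> (nat \<Rightarrow> real) \<Rightarrow> real \<Rightarrow> (nat \<Rightarrow> real) set" where
  "open_box n x r = {y \<in> Rn n. \<forall>i<n. \<bar>y i - x i\<bar> < r}"

lemma Rn_iff: "x \<in> Rn n \<longleftrightarrow> (\<forall>i. \<not> i < n \<longrightarrow> x i = undefined)"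
  by (auto simp: Rn_def PiE_def extensional_def)

text \<open>Coordinates from n on are frozen at \<open>undefined\<close>. Writing this as singleton
  factors displays a set in the carrier as a product over all naturals, to which the theorems on
  product topologies apply.\<close>

lemma PiE_UNIV_if:
  "PiE UNIV (\<lambda>i. if i < n then X i else {undefined}) = {y \<in> Rn n. \<forall>i<n. y i \<in> X i}"
proof -
  have "PiE UNIV X = {y. \<forall>i. y i \<in> X i}" for X :: "nat \<Rightarrow> real set"
    by (auto simp: PiE_UNIV_domain)
  then show ?thesis unfolding Rn_iff by (simp add: if_split_mem2) blast
qed

lemma closed_box_PiE: "closed_box n x r = PiE UNIV (\<lambda>i. if i < n then {x i - r..x i + r} else {undefined})"
  unfolding PiE_UNIV_if closed_box_def atLeastAtMost_iff abs_le_iff by (simp add: algebra_simps) meson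

lemma open_box_PiE: "open_box n x r = PiE UNIV (\<lambda>i. if i < n then {x i - r<..<x i + r} else {undefined})"
  unfolding PiE_UNIV_if open_box_def greaterThanLessThan_iff abs_less_iff by (simp add: algebra_simps) meson

lemma compact_closed_box: "compact (closed_box n x r)"
proof -
  have "compactin (product_topology (\<lambda>i. euclidean) UNIV) (closed_box n x r)"
    unfolding closed_box_PiE compactin_PiE by (auto simp: compactin_euclidean_iff)
  then show ?thesis by (simp add: euclidean_product_topology)
qed

lemma connected_open_box: "connected (open_box n x r)"
proof -
  have "connected (if i < n then {x i - r<..<x i + r} else {undefined})" for i
    by (cases "i < n") (simp_all only: if_True if_False connected_Ioo connected_sing)
  then have "connectedin (product_topology (\<lambda>i. euclidean) UNIV) (open_box n x r)"
    unfolding open_box_PiE connectedin_PiE by (simp add: connectedin_iff_connected)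
  then show ?thesis by (simp add: euclidean_product_topology)
qed

lemma openin_open_box: "openin (top_of_set (Rn n)) (open_box n x r)"
proof -
  have "open {y. \<forall>i\<in>{..<n}. y i \<in> {x i - r<..<x i + r}}"
    by (rule product_topology_basis') auto
  moreover have "open_box n x r = Rn n \<inter> {y. \<forall>i\<in>{..<n}. y i \<in> {x i - r<..<x i + r}}"
    unfolding open_box_def greaterThanLessThan_iff abs_less_iff by (simp add: algebra_simps) blast
  ultimately show ?thesis by (auto simp: openin_open)
qed

lemma closed_box_subset_Rn: "closed_box n x r \<subseteq> Rn n"
  and open_box_subset_closed_box: "open_box n x r \<subseteq> closed_box n x r"
  by (auto simp: closed_box_def open_box_def less_imp_le)

lemma mem_open_box: "x \<in> Rn n \<Longrightarrow> 0 < r \<Longrightarrow> x \<in> open_box n x r"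
  by (simp add: open_box_def)

lemma openin_Rn_subset: "openin (top_of_set (Rn n)) U \<Longrightarrow> U \<subseteq> Rn n"
  using openin_imp_subset by blast

lemma openin_Rn_closed_box:
  assumes "openin (top_of_set (Rn n)) U" "x \<in> U"
  obtains r where "0 < r" "closed_box n x r \<subseteq> U"
proof -
  obtain T where T: "open T" "U = Rn n \<inter> T" using assms(1) by (auto simp: openin_open)
  then have "openin (product_topology (\<lambda>i. euclidean) UNIV) T" "x \<in> T"
    using assms by (auto simp: euclidean_product_topology)
  from product_topology_open_contains_basis[OF this]
  obtain X where X: "x \<in> PiE UNIV X" "\<And>i. open (X i)" "PiE UNIV X \<subseteq> T"
    by auto
  have "\<exists>e>0. \<forall>y. \<bar>y - x i\<bar> \<le> e \<longrightarrow> y \<in> X i" for i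
  proof -
    have "x i \<in> X i" using X(1) by auto
    then obtain e where "e > 0" "cball (x i) e \<subseteq> X i" using X(2) open_contains_cball by meson
    then show ?thesis by (intro exI[of _ e]) (auto simp: subset_eq dist_real_def abs_minus_commute)
  qed
  then obtain e where e: "\<And>i. e i > 0" "\<And>i y. \<bar>y - x i\<bar> \<le> e i \<Longrightarrow> y \<in> X i" by metis
  \<comment> \<open>Inside the carrier only the coordinates below n can move, so finitely many radii
    matter; the entry 1 keeps the set nonempty for n = 0.\<close>
  define r where "r = Min (insert 1 (e ` {..<n}))"
  have r: "0 < r" "\<And>i. i < n \<Longrightarrow> r \<le> e i" by (auto simp: r_def e)
  have "closed_box n x r \<subseteq> U"
  proof
    fix y assume y: "y \<in> closed_box n x r"
    have "y i \<in> X i" for i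
    proof (cases "i < n")
      case True
      then show ?thesis using y r(2)[OF True] by (intro e(2)) (force simp: closed_box_def)
    next
      case False
      have "y \<in> Rn n" "x \<in> Rn n" using y assms T by (auto simp: closed_box_def)
      then have "y i = x i" using False by (auto simp: Rn_def PiE_def extensional_def)
      then show ?thesis using X(1) by auto
    qed
    then show "y \<in> U" using X(3) y T by (auto simp: closed_box_def)
  qed
  with r that show ?thesis by blast
qed

text \<open>A finite subcover with a common lower bound of its radii stands in for a Lebesgue
  number; it is phrased with cubes because \<open>dist\<close> on functions is a different
  metric.\<close>

lemma compact_box_cover:
  assumes "compact K" "K \<subseteq> Rn n" "\<And>x. x \<in> K \<Longrightarrow> 0 < r x"
  obtains F \<delta> where "finite F" "F \<subseteq> K" "0 < \<delta>" "\<And>z. z \<in> F \<Longrightarrow> \<delta> \<le> r z"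
    "\<And>x. x \<in> K \<Longrightarrow> \<exists>z\<in>F. x \<in> open_box n z (r z)"
proof -
  have "\<forall>z\<in>K. \<exists>T. open T \<and> open_box n z (r z) = Rn n \<inter> T"
    using openin_open_box by (auto simp: openin_open)
  then obtain T where T: "\<And>z. z \<in> K \<Longrightarrow> open (T z)" "\<And>z. z \<in> K \<Longrightarrow> open_box n z (r z) = Rn n \<inter> T z"
    by metis
  have "K \<subseteq> (\<Union>z\<in>K. T z)"
  proof
    fix x assume x: "x \<in> K"
    then have "x \<in> open_box n x (r x)" using mem_open_box assms by blast
    then show "x \<in> (\<Union>z\<in>K. T z)" using T(2)[OF x] x by blast
  qed
  with compactE_image[OF assms(1), of K T] T(1)
  obtain F where F: "F \<subseteq> K" "finite F" "K \<subseteq> (\<Union>z\<in>F. T z)" by auto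
  define \<delta> where "\<delta> = Min (insert 1 (r ` F))"
  show ?thesis
  proof
    show "0 < \<delta>" using F assms by (auto simp: \<delta>_def)
    show "\<delta> \<le> r z" if "z \<in> F" for z using F that by (auto simp: \<delta>_def)
    show "\<exists>z\<in>F. x \<in> open_box n z (r z)" if "x \<in> K" for x
    proof -
      obtain z where z: "z \<in> F" "x \<in> T z" using F \<open>x \<in> K\<close> by blast
      then have "z \<in> K" using F by blast
      then have "x \<in> open_box n z (r z)" using T(2)[of z] z \<open>x \<in> K\<close> assms(2) by blast
      then show ?thesis using z by blast
    qed
  qed (use F in auto)
qed

text \<open>The cubes of a finite cover are doubled: a point within \<open>\<delta>\<close> of a
  cube of radius r stays in the cube of radius 2 r. This is the room that mollification at a uniform
  scale needs.\<close>

lemma compact_nbhd: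
  assumes "openin (top_of_set (Rn n)) U" "compact K" "K \<subseteq> U"
  obtains \<epsilon> K' where "0 < \<epsilon>" "compact K'" "K' \<subseteq> U" "K \<subseteq> K'" "\<And>x. x \<in> K \<Longrightarrow> closed_box n x \<epsilon> \<subseteq> K'"
proof -
  have U: "U \<subseteq> Rn n" using assms openin_Rn_subset by blast
  have "\<forall>x\<in>K. \<exists>r>0. closed_box n x (2 * r) \<subseteq> U"
  proof
    fix x assume "x \<in> K"
    then obtain r where "0 < r" "closed_box n x r \<subseteq> U" using openin_Rn_closed_box[OF assms(1)] assms by blast
    then show "\<exists>r>0. closed_box n x (2 * r) \<subseteq> U" by (intro exI[of _ "r / 2"]) auto
  qed
  then obtain r where r: "\<And>x. x \<in> K \<Longrightarrow> 0 < r x" "\<And>x. x \<in> K \<Longrightarrow> closed_box n x (2 * r x) \<subseteq> U" by metis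
  obtain F \<delta> where F: "finite F" "F \<subseteq> K" "0 < \<delta>" "\<And>z. z \<in> F \<Longrightarrow> \<delta> \<le> r z"
    "\<And>x. x \<in> K \<Longrightarrow> \<exists>z\<in>F. x \<in> open_box n z (r z)"
    using compact_box_cover[OF assms(2) subset_trans[OF assms(3) U], of r] r(1) by blast
  define K' where "K' = (\<Union>z\<in>F. closed_box n z (2 * r z))"
  have sub: "closed_box n x \<delta> \<subseteq> K'" if x: "x \<in> K" for x
  proof
    fix y assume y: "y \<in> closed_box n x \<delta>"
    obtain z where z: "z \<in> F" "x \<in> open_box n z (r z)" using F(5) x by blast
    have "y \<in> closed_box n z (2 * r z)"
      using y z F(4)[OF z(1)] unfolding closed_box_def open_box_def
      by (smt (verit, best) mem_Collect_eq)
    then show "y \<in> K'" using z by (auto simp: K'_def)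
  qed
  show ?thesis
  proof
    show "compact K'" unfolding K'_def using F by (intro compact_UN) (auto simp: compact_closed_box)
    show "K' \<subseteq> U" unfolding K'_def using r F by blast
    show "K \<subseteq> K'"
    proof
      fix x assume "x \<in> K"
      moreover have "x \<in> closed_box n x \<delta>" using \<open>x \<in> K\<close> assms U F by (auto simp: closed_box_def)
      ultimately show "x \<in> K'" using sub by blast
    qed
  qed (use F(3) sub in blast)+
qed

text \<open>Heine-Cantor around K: the centre ranges over K but its neighbours over U, as an average
  taken at a point of K also reads values outside K.\<close>

lemma uniform_continuous_boxes:
  fixes f :: "(nat \<Rightarrow> real) \<Rightarrow> real"
  assumes "openin (top_of_set (Rn n)) U" "compact K" "K \<subseteq> U" "continuous_on U f" "0 < e"
  obtains \<delta> where "0 < \<delta>" "\<And>x y. x \<in> K \<Longrightarrow> y \<in> closed_box n x \<delta> \<Longrightarrow> y \<in> U \<and> \<bar>f y - f x\<bar> \<le> e"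
proof -
  have U: "U \<subseteq> Rn n" using assms openin_Rn_subset by blast
  have "\<forall>x\<in>K. \<exists>r>0. closed_box n x (2 * r) \<subseteq> {y \<in> U. \<bar>f y - f x\<bar> < e / 2}"
  proof
    fix x assume x: "x \<in> K"
    have "openin (top_of_set U) (U \<inter> f -` {f x - e / 2<..<f x + e / 2})"
      by (rule continuous_openin_preimage_gen[OF assms(4)]) auto
    then have "openin (top_of_set (Rn n)) (U \<inter> f -` {f x - e / 2<..<f x + e / 2})"
      using assms(1) openin_trans by blast
    then obtain r where "0 < r" "closed_box n x r \<subseteq> U \<inter> f -` {f x - e / 2<..<f x + e / 2}"
      using x assms by (auto elim!: openin_Rn_closed_box)
    moreover have "U \<inter> f -` {f x - e / 2<..<f x + e / 2} \<subseteq> {y \<in> U. \<bar>f y - f x\<bar> < e / 2}"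
    proof
      fix y assume "y \<in> U \<inter> f -` {f x - e / 2<..<f x + e / 2}"
      then have "y \<in> U" "f x - e / 2 < f y" "f y < f x + e / 2" by auto
      then have "y \<in> U \<and> \<bar>f y - f x\<bar> < e / 2" unfolding abs_less_iff by linarith
      then show "y \<in> {y \<in> U. \<bar>f y - f x\<bar> < e / 2}" by simp
    qed
    ultimately show "\<exists>r>0. closed_box n x (2 * r) \<subseteq> {y \<in> U. \<bar>f y - f x\<bar> < e / 2}"
      by (intro exI[of _ "r / 2"]) auto
  qed
  from bchoice[OF this] obtain r where "\<forall>x\<in>K. 0 < r x \<and> closed_box n x (2 * r x) \<subseteq> {y \<in> U. \<bar>f y - f x\<bar> < e / 2}"
    by blast
  then have r: "0 < r x" "closed_box n x (2 * r x) \<subseteq> {y \<in> U. \<bar>f y - f x\<bar> < e / 2}" if "x \<in> K" for x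
    using that by blast+
  obtain F \<delta> where F: "finite F" "F \<subseteq> K" "0 < \<delta>" "\<And>z. z \<in> F \<Longrightarrow> \<delta> \<le> r z"
    "\<And>x. x \<in> K \<Longrightarrow> \<exists>z\<in>F. x \<in> open_box n z (r z)"
    using compact_box_cover[OF assms(2) subset_trans[OF assms(3) U], of r] r(1) by blast
  show ?thesis
  proof
    fix x y assume x: "x \<in> K" and y: "y \<in> closed_box n x \<delta>"
    obtain z where z: "z \<in> F" "x \<in> open_box n z (r z)" using F(5) x by blast
    have "y \<in> closed_box n z (2 * r z)"
      using y z F(4)[OF z(1)] unfolding closed_box_def open_box_def
      by (smt (verit, best) mem_Collect_eq)
    moreover have "x \<in> closed_box n z (2 * r z)"
      using z F(3) F(4)[OF z(1)] unfolding closed_box_def open_box_def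
      by (smt (verit, best) mem_Collect_eq)
    ultimately have "y \<in> U" "\<bar>f y - f z\<bar> < e / 2" "\<bar>f x - f z\<bar> < e / 2"
      using r(2)[of z] z F by blast+
    then show "y \<in> U \<and> \<bar>f y - f x\<bar> \<le> e" by linarith
  qed (use F in auto)
qed

lemma space_leb [simp]: "space (leb n) = Rn n"
  by (simp add: leb_def space_PiM Rn_def)

interpretation lborel_prod: product_sigma_finite "\<lambda>_::nat. lborel :: real measure"
  by standard

text \<open>Links the product sigma-algebra over \<open>{..<n}\<close> to the Borel sets of
  \<open>nat \<Rightarrow> real\<close>. Through it compact sets, relatively open sets and
  continuous functions become measurable on the carrier.\<close>

lemma measurable_id_PiM: "(\<lambda>x. x) \<in> Pi\<^sub>M {..<n} (\<lambda>_. lborel) \<rightarrow>\<^sub>M (borel :: (nat \<Rightarrow> real) measure)"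
proof -
  have "(\<lambda>x. x) \<in> Pi\<^sub>M {..<n} (\<lambda>_. lborel) \<rightarrow>\<^sub>M Pi\<^sub>M UNIV (\<lambda>_. borel :: real measure)"
  proof (rule measurable_PiM_single')
    fix i show "(\<lambda>x. x i) \<in> Pi\<^sub>M {..<n} (\<lambda>_. lborel) \<rightarrow>\<^sub>M (borel :: real measure)"
    proof (cases "i < n")
      case False
      have "(\<lambda>x. undefined) \<in> Pi\<^sub>M {..<n} (\<lambda>_. lborel) \<rightarrow>\<^sub>M (borel :: real measure)" by simp
      then show ?thesis
        by (rule measurable_cong[THEN iffD1, rotated]) (use False in \<open>auto simp: space_PiM PiE_def extensional_def\<close>)
    next
      case True
      then show ?thesis using measurable_component_singleton[of i "{..<n}" "\<lambda>_. lborel"] by simp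
    qed
  qed auto
  then show ?thesis by (simp cong: measurable_cong_sets add: sets_PiM_equal_borel)
qed

lemma measurable_id_leb: "(\<lambda>x. x) \<in> leb n \<rightarrow>\<^sub>M (borel :: (nat \<Rightarrow> real) measure)"
  unfolding leb_def by (rule measurable_completion[OF measurable_id_PiM])

lemma borel_Int_Rn: "A \<in> sets borel \<Longrightarrow> A \<inter> Rn n \<in> sets (leb n)"
  using measurable_sets[OF measurable_id_leb, of A n] by (simp add: vimage_def Collect_conj_eq)

lemma compact_sets_leb: "compact K \<Longrightarrow> K \<subseteq> Rn n \<Longrightarrow> K \<in> sets (leb n)"
  using borel_Int_Rn[of K n] by (simp add: Int_absorb2 borel_compact)

lemma openin_sets_leb: "openin (top_of_set (Rn n)) U \<Longrightarrow> U \<in> sets (leb n)"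
  by (auto simp: openin_open Int_commute intro!: borel_Int_Rn)

lemma emeasure_closed_box: "emeasure (leb n) (closed_box n x r) < \<infinity>"
proof -
  have eq: "closed_box n x r = PiE {..<n} (\<lambda>i. {x i - r..x i + r})"
    by (auto simp: closed_box_PiE PiE_def extensional_def split: if_splits)
  have "emeasure (leb n) (closed_box n x r) = emeasure (Pi\<^sub>M {..<n} (\<lambda>_. lborel)) (PiE {..<n} (\<lambda>i. {x i - r..x i + r}))"
    unfolding leb_def eq by (subst emeasure_completion) (auto intro!: sets_PiM_I_finite)
  also have "\<dots> = (\<Prod>i<n. emeasure lborel {x i - r..x i + r})"
    by (rule lborel_prod.emeasure_PiM) auto
  also have "\<dots> < \<infinity>"
    by (simp add: ennreal_prod_eq_top less_top[symmetric]) (auto simp: top_unique emeasure_lborel_Icc_eq)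
  finally show ?thesis .
qed

lemma compact_subset_closed_box:
  assumes "compact K" "K \<subseteq> Rn n"
  obtains r where "0 < r" "K \<subseteq> closed_box n (\<lambda>_. 0) r"
proof -
  have "\<forall>i. bounded ((\<lambda>x. x i) ` K)"
    by (intro allI compact_imp_bounded compact_continuous_image[OF _ assms(1)]
      continuous_on_subset[OF continuous_on_product_coordinates]) simp
  then obtain b where b: "\<And>i x. x \<in> K \<Longrightarrow> \<bar>x i\<bar> \<le> b i"
    unfolding bounded_iff by simp metis
  define r where "r = Max (insert 1 (b ` {..<n}))"
  have r: "0 < r" "\<And>i. i < n \<Longrightarrow> b i \<le> r"
    by (auto simp: r_def less_max_iff_disj Max_gr_iff)
  show ?thesis
  proof (rule that[OF r(1)])
    show "K \<subseteq> closed_box n (\<lambda>_. 0) r"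
    proof
      fix x assume x: "x \<in> K"
      have "\<bar>x i\<bar> \<le> r" if "i < n" for i using b[OF x, of i] r(2)[OF that] by linarith
      then show "x \<in> closed_box n (\<lambda>_. 0) r" using x assms by (auto simp: closed_box_def)
    qed
  qed
qed

lemma emeasure_compact_leb:
  assumes "compact K" "K \<subseteq> Rn n"
  shows "emeasure (leb n) K < \<infinity>"
proof -
  obtain r where "K \<subseteq> closed_box n (\<lambda>_. 0) r" using compact_subset_closed_box[OF assms] .
  then have "emeasure (leb n) K \<le> emeasure (leb n) (closed_box n (\<lambda>_. 0) r)"
    by (intro emeasure_mono compact_sets_leb compact_closed_box closed_box_subset_Rn)
  then show ?thesis using emeasure_closed_box[of n "\<lambda>_. 0" r] by order
qed

interpretation leb: sigma_finite_measure "leb n" for n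
proof
  have "(\<Union>k. closed_box n (\<lambda>_. 0) (real k)) = Rn n"
  proof (intro equalityI subsetI)
    fix x assume x: "x \<in> Rn n"
    have "{x} \<subseteq> Rn n" using x by simp
    then obtain r where "x \<in> closed_box n (\<lambda>_. 0) r" using compact_subset_closed_box[of "{x}" n] by auto
    moreover obtain k where "r \<le> real k" using real_arch_simple by blast
    ultimately have "x \<in> closed_box n (\<lambda>_. 0) (real k)" by (force simp: closed_box_def)
    then show "x \<in> (\<Union>k. closed_box n (\<lambda>_. 0) (real k))" by blast
  qed (auto simp: closed_box_def)
  then show "\<exists>A. countable A \<and> A \<subseteq> sets (leb n) \<and> \<Union> A = space (leb n) \<and> (\<forall>a\<in>A. emeasure (leb n) a \<noteq> \<infinity>)"
    using emeasure_closed_box compact_closed_box closed_box_subset_Rn compact_sets_leb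
    by (intro exI[of _ "range (\<lambda>k. closed_box n (\<lambda>_. 0) (real k))"]) (force simp: less_top[symmetric])
qed

interpretation leb: complete_measure "leb n" for n
  unfolding leb_def ..

interpretation leb2: pair_sigma_finite "leb n" "leb n" for n
  by standard

lemma continuous_on_measurable_leb:
  fixes f :: "(nat \<Rightarrow> real) \<Rightarrow> real"
  assumes "continuous_on A f" "A \<in> sets borel" "A \<subseteq> Rn n"
  shows "set_borel_measurable (leb n) A f"
proof -
  have "(\<lambda>x. indicator A x *\<^sub>R f x) \<in> borel_measurable borel"
    using borel_measurable_continuous_on_indicator[OF assms(2,1)] .
  from measurable_compose[OF measurable_id_leb this] show ?thesis
    by (simp add: set_borel_measurable_def)
qed

lemma set_integrable_bounded:
  fixes f :: "(nat \<Rightarrow> real) \<Rightarrow> real"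
  assumes "set_borel_measurable (leb n) K f" "K \<in> sets (leb n)" "emeasure (leb n) K < \<infinity>"
    "\<And>x. x \<in> K \<Longrightarrow> \<bar>f x\<bar> \<le> B"
  shows "set_integrable (leb n) K f"
proof -
  have "K \<inter> Rn n = K" using sets.sets_into_space[OF assms(2)] by auto
  then have "integrable (leb n) (\<lambda>x. B * indicator K x)"
    using assms by (intro integrable_mult_right) (simp add: integrable_indicator_iff)
  then show ?thesis unfolding set_integrable_def
  proof (rule Bochner_Integration.integrable_bound)
    show "AE x in leb n. norm (indicator K x *\<^sub>R f x) \<le> norm (B * indicator K x)"
      using assms(4) by (intro AE_I2) (force simp: indicator_def)
  qed (use assms in \<open>simp add: set_borel_measurable_def\<close>)
qed

lemma continuous_on_compact_bounded:
  fixes f :: "'a::topological_space \<Rightarrow> real"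
  assumes "compact K" "continuous_on K f"
  obtains B where "0 < B" "\<And>x. x \<in> K \<Longrightarrow> \<bar>f x\<bar> \<le> B"
  using compact_imp_bounded[OF compact_continuous_image[OF assms(2,1)]]
  unfolding bounded_pos by auto

lemma set_integrable_continuous:
  fixes f :: "(nat \<Rightarrow> real) \<Rightarrow> real"
  assumes "compact K" "K \<subseteq> Rn n" "continuous_on K f"
  shows "set_integrable (leb n) K f"
proof -
  obtain B where "\<And>x. x \<in> K \<Longrightarrow> \<bar>f x\<bar> \<le> B" using continuous_on_compact_bounded[OF assms(1,3)] by blast
  then show ?thesis
    using assms by (intro set_integrable_bounded[where B = B] continuous_on_measurable_leb emeasure_compact_leb compact_sets_leb borel_compact)
qed

section \<open>Mollification\<close>

text \<open>\<open>\<alpha>\<close> is a multi-index: \<open>mol n D \<alpha> f\<close> is the derivative of order \<open>\<alpha>\<close> of the mollified function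
  \<open>mol n D (\<lambda>_. 0) f\<close>.\<close>

definition kern :: "nat \<Rightarrow> (nat \<Rightarrow> real \<Rightarrow> real) \<Rightarrow> (nat \<Rightarrow> nat) \<Rightarrow> (nat \<Rightarrow> real) \<Rightarrow> (nat \<Rightarrow> real) \<Rightarrow> real" where
  "kern n D \<alpha> x y = (\<Prod>i<n. D (\<alpha> i) (x i - y i))"

definition mol :: "nat \<Rightarrow> (nat \<Rightarrow> real \<Rightarrow> real) \<Rightarrow> (nat \<Rightarrow> nat) \<Rightarrow> ((nat \<Rightarrow> real) \<Rightarrow> real) \<Rightarrow> (nat \<Rightarrow> real) \<Rightarrow> real" where
  "mol n D \<alpha> f x = (LINT y|leb n. f y * kern n D \<alpha> x y)"

lemma mollifier_deriv: "mollifier \<epsilon> D \<Longrightarrow> (D k has_real_derivative D (Suc k) x) (at x)"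
  and mollifier_0: "mollifier \<epsilon> D \<Longrightarrow> \<epsilon> \<le> \<bar>x\<bar> \<Longrightarrow> D k x = 0"
  and mollifier_nonneg: "mollifier \<epsilon> D \<Longrightarrow> 0 \<le> D 0 x"
  and mollifier_even: "mollifier \<epsilon> D \<Longrightarrow> D 0 (- x) = D 0 x"
  by (auto simp: mollifier_def)

lemma mollifier_cont: "mollifier \<epsilon> D \<Longrightarrow> continuous_on A (D k)"
  by (meson DERIV_continuous_on has_field_derivative_at_within mollifier_deriv)

lemma mollifier_measurable: "mollifier \<epsilon> D \<Longrightarrow> D k \<in> borel_measurable borel"
  by (intro borel_measurable_continuous_onI mollifier_cont)

lemma mollifier_odd: "mollifier \<epsilon> D \<Longrightarrow> D (Suc 0) (- x) = - D (Suc 0) x"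
proof -
  assume m: "mollifier \<epsilon> D"
  have "((\<lambda>x. D 0 (- x)) has_real_derivative D (Suc 0) (- x) * - 1) (at x)"
    by (rule DERIV_chain2[OF mollifier_deriv[OF m]]) (auto intro!: derivative_eq_intros)
  then have "(D 0 has_real_derivative - D (Suc 0) (- x)) (at x)"
    using mollifier_even[OF m] by simp
  then show ?thesis using mollifier_deriv[OF m, of 0 x] DERIV_unique by fastforce
qed

lemma mollifier_bounded:
  assumes "mollifier \<epsilon> D"
  obtains B where "\<And>k. 0 < B k" "\<And>k x. \<bar>D k x\<bar> \<le> B k"
proof -
  have "\<exists>B>0. \<forall>x. \<bar>D k x\<bar> \<le> B" for k
  proof -
    obtain B where B: "0 < B" "\<And>x. x \<in> {-\<epsilon>..\<epsilon>} \<Longrightarrow> \<bar>D k x\<bar> \<le> B"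
      using continuous_on_compact_bounded[OF _ mollifier_cont[OF assms], of "{-\<epsilon>..\<epsilon>}" k] by auto
    have "\<bar>D k x\<bar> \<le> B" for x
    proof (cases "\<bar>x\<bar> \<le> \<epsilon>")
      case True
      then have "x \<in> {-\<epsilon>..\<epsilon>}" by auto
      then show ?thesis by (rule B(2))
    qed (use B(1) mollifier_0[OF assms, of x k] in simp)
    then show ?thesis using B by blast
  qed
  then show ?thesis using that by metis
qed

lemma kern_bounded:
  assumes "mollifier \<epsilon> D"
  obtains B where "0 < B" "\<And>x y. \<bar>kern n D \<alpha> x y\<bar> \<le> B"
proof -
  obtain B where B: "\<And>k. 0 < B k" "\<And>k x. \<bar>D k x\<bar> \<le> B k" using mollifier_bounded[OF assms] by blast
  show ?thesis
  proof
    show "0 < (\<Prod>i<n. B (\<alpha> i))" using B by (intro prod_pos) auto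
    show "\<bar>kern n D \<alpha> x y\<bar> \<le> (\<Prod>i<n. B (\<alpha> i))" for x y
      unfolding kern_def abs_prod using B by (intro prod_mono) auto
  qed
qed

lemma kern_measurable:
  assumes "mollifier \<epsilon> D" and [measurable]: "f \<in> M \<rightarrow>\<^sub>M borel" "g \<in> M \<rightarrow>\<^sub>M (borel :: (nat \<Rightarrow> real) measure)"
  shows "(\<lambda>z. kern n D \<alpha> (f z) (g z)) \<in> borel_measurable M"
proof -
  note [measurable] = mollifier_measurable[OF assms(1)]
  have c: "(\<lambda>x. x i) \<in> borel_measurable (borel :: (nat \<Rightarrow> real) measure)" for i
    by (intro borel_measurable_continuous_onI) simp
  have [measurable]: "(\<lambda>z. f z i) \<in> borel_measurable M" "(\<lambda>z. g z i) \<in> borel_measurable M" for i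
    using measurable_compose[OF assms(2) c] measurable_compose[OF assms(3) c] by auto
  show ?thesis unfolding kern_def by measurable
qed

lemma kern_measurable_leb:
  assumes "mollifier \<epsilon> D"
  shows "(\<lambda>y. kern n D \<alpha> x y) \<in> borel_measurable (leb n)" "(\<lambda>x. kern n D \<alpha> x y) \<in> borel_measurable (leb n)"
  by (intro kern_measurable[OF assms] measurable_id_leb measurable_const; simp)+

lemma kern_split:
  assumes "i < n"
  shows "kern n D (\<alpha>(i := k)) (x(i := t)) y = D k (t - y i) * (\<Prod>j\<in>{..<n} - {i}. D (\<alpha> j) (x j - y j))"
proof -
  have "(\<Prod>j\<in>{..<n} - {i}. D ((\<alpha>(i := k)) j) ((x(i := t)) j - y j)) = (\<Prod>j\<in>{..<n} - {i}. D (\<alpha> j) (x j - y j))"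
    by (intro prod.cong) auto
  then show ?thesis unfolding kern_def using assms by (subst prod.remove[of _ i]) auto
qed

text \<open>The error is quadratic in h with a constant that is uniform in x and y, so the estimate
  survives integration against an integrable function; differentiation under the integral then needs
  only \<open>DERIV_quadratic\<close>.\<close>

lemma kern_expansion:
  assumes m: "mollifier \<epsilon> D" and i: "i < n"
  obtains B where "0 < B" "\<And>x y h. \<bar>kern n D \<alpha> (x(i := x i + h)) y - kern n D \<alpha> x y
     - h * kern n D (\<alpha>(i := Suc (\<alpha> i))) x y\<bar> \<le> B * h\<^sup>2"
proof -
  obtain B where B: "0 < B" "\<And>x y. \<bar>kern n D (\<alpha>(i := Suc (Suc (\<alpha> i)))) x y\<bar> \<le> B"
    using kern_bounded[OF m] by metis
  have "\<bar>kern n D \<alpha> (x(i := x i + h)) y - kern n D \<alpha> x y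
     - h * kern n D (\<alpha>(i := Suc (\<alpha> i))) x y\<bar> \<le> B * h\<^sup>2" for x y h
  proof -
    define R where "R = (\<Prod>j\<in>{..<n} - {i}. D (\<alpha> j) (x j - y j))"
    define k where "k = \<alpha> i"
    have e: "kern n D (\<alpha>(i := k)) (x(i := t)) y = D k (t - y i) * R" for k t
      unfolding R_def by (rule kern_split[OF i])
    have e1: "kern n D (\<alpha>(i := k)) x y = D k (x i - y i) * R" for k
      using e[of k "x i"] by simp
    have e2: "kern n D \<alpha> (x(i := t)) y = D k (t - y i) * R" for t
      using e[of k t] by (simp add: k_def)
    have e3: "kern n D \<alpha> x y = D k (x i - y i) * R"
      using e2[of "x i"] by simp
    define s where "s = x i - y i"
    have "\<exists>t. \<bar>t\<bar> \<le> \<bar>h\<bar> \<and> D k (s + h) = (\<Sum>m<2. (D (k + m) (s + 0) / fact m) * h ^ m) + (D (k + 2) (s + t) / fact 2) * h ^ 2"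
    proof (rule Maclaurin_all_le[where f = "\<lambda>h. D k (s + h)" and diff = "\<lambda>m h. D (k + m) (s + h)"])
      show "\<forall>m x. DERIV (\<lambda>h. D (k + m) (s + h)) x :> D (k + Suc m) (s + x)"
      proof (intro allI)
        fix m x
        have "((\<lambda>h. D (k + m) (s + h)) has_real_derivative D (Suc (k + m)) (s + x) * 1) (at x)"
          by (rule DERIV_chain2[OF mollifier_deriv[OF m]]) (auto intro!: derivative_eq_intros)
        then show "DERIV (\<lambda>h. D (k + m) (s + h)) x :> D (k + Suc m) (s + x)" by simp
      qed
    qed simp
    then obtain t where
      "D k (s + h) = (\<Sum>m<2. (D (k + m) (s + 0) / fact m) * h ^ m) + (D (k + 2) (s + t) / fact 2) * h ^ 2"
      by blast
    then have "D k (s + h) = D k s + D (Suc k) s * h + D (Suc (Suc k)) (s + t) / 2 * h\<^sup>2"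
      by (simp add: numeral_2_eq_2 lessThan_Suc)
    moreover have "x i + h - y i = s + h" by (simp add: s_def)
    ultimately have 1: "kern n D \<alpha> (x(i := x i + h)) y - kern n D \<alpha> x y - h * kern n D (\<alpha>(i := Suc (\<alpha> i))) x y
      = (D (Suc (Suc k)) (s + t) * R) / 2 * h\<^sup>2"
      by (simp only: e1 e2 e3 flip: k_def s_def) (simp add: algebra_simps)
    \<comment> \<open>Up to the factor h^2 / 2, the remainder is again a kernel, with the order in
      coordinate i raised by 2, evaluated at an intermediate point; hence the uniform bound.\<close>
    define Y where "Y = D (Suc (Suc k)) (s + t) * R"
    have "Y = kern n D (\<alpha>(i := Suc (Suc (\<alpha> i)))) (x(i := x i + t)) y"
      unfolding e k_def Y_def by (simp add: s_def algebra_simps)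
    then have Y: "\<bar>Y\<bar> / 2 \<le> B"
      using B(2)[of "x(i := x i + t)" y] B(1) by linarith
    have "\<bar>Y / 2 * h\<^sup>2\<bar> = \<bar>Y\<bar> / 2 * h\<^sup>2" by (simp add: abs_mult)
    also have "\<dots> \<le> B * h\<^sup>2" using Y by (rule mult_right_mono) simp
    finally show ?thesis unfolding 1 Y_def .
  qed
  with B that show ?thesis by blast
qed

lemma DERIV_quadratic:
  fixes F :: "real \<Rightarrow> real"
  assumes "\<And>h. \<bar>F (x + h) - F x - h * L\<bar> \<le> B * h\<^sup>2"
  shows "(F has_real_derivative L) (at x)"
proof -
  have "((\<lambda>h. (F (x + h) - F x) / h - L) \<longlongrightarrow> 0) (at 0)"
  proof (rule Lim_null_comparison)
    show "eventually (\<lambda>h. norm ((F (x + h) - F x) / h - L) \<le> B * \<bar>h\<bar>) (at 0)"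
    proof (rule eventually_at_filter[THEN iffD2], intro always_eventually allI impI)
      fix h :: real assume h: "h \<noteq> 0"
      have "(F (x + h) - F x) / h - L = (F (x + h) - F x - h * L) / h" using h by (simp add: field_simps)
      also have "\<bar>\<dots>\<bar> \<le> B * h\<^sup>2 / \<bar>h\<bar>" using assms[of h] by (simp add: divide_right_mono)
      also have "\<dots> = B * \<bar>h\<bar>" using h by (simp add: field_simps power2_eq_square)
      finally show "norm ((F (x + h) - F x) / h - L) \<le> B * \<bar>h\<bar>" by simp
    qed
    show "((\<lambda>h. B * \<bar>h\<bar>) \<longlongrightarrow> 0) (at 0)" by (auto intro!: tendsto_eq_intros)
  qed
  then show ?thesis unfolding DERIV_def by (simp add: LIM_zero_cancel)
qed

lemma kern_deriv:
  assumes "mollifier \<epsilon> D" "i < n"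
  shows "((\<lambda>t. kern n D \<alpha> (x(i := t)) y) has_real_derivative kern n D (\<alpha>(i := Suc (\<alpha> i))) x y) (at (x i))"
  by (rule kern_expansion[OF assms, of \<alpha>], rule DERIV_quadratic) simp

lemma integrable_mult_kern:
  assumes "mollifier \<epsilon> D" "integrable (leb n) f"
  shows "integrable (leb n) (\<lambda>y. f y * kern n D \<alpha> x y)"
proof -
  obtain B where B: "0 < B" "\<And>x y. \<bar>kern n D \<alpha> x y\<bar> \<le> B" using kern_bounded[OF assms(1)] by metis
  note [measurable] = kern_measurable_leb[OF assms(1)]
  have [measurable]: "f \<in> borel_measurable (leb n)" using assms by auto
  show ?thesis
  proof (rule Bochner_Integration.integrable_bound)
    show "integrable (leb n) (\<lambda>y. B * f y)" using assms by simp
    show "AE y in leb n. norm (f y * kern n D \<alpha> x y) \<le> norm (B * f y)"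
      using B by (intro AE_I2) (auto simp: abs_mult mult.commute[of B] intro!: mult_left_mono)
  qed measurable
qed

lemma mol_deriv:
  assumes "mollifier \<epsilon> D" "i < n" "integrable (leb n) f"
  shows "((\<lambda>t. mol n D \<alpha> f (x(i := t))) has_real_derivative mol n D (\<alpha>(i := Suc (\<alpha> i))) f x) (at (x i))"
proof -
  obtain B where B: "0 < B" "\<And>x y h. \<bar>kern n D \<alpha> (x(i := x i + h)) y - kern n D \<alpha> x y
     - h * kern n D (\<alpha>(i := Suc (\<alpha> i))) x y\<bar> \<le> B * h\<^sup>2" using kern_expansion[OF assms(1,2)] by metis
  note int = integrable_mult_kern[OF assms(1,3)]
  show ?thesis
  proof (rule DERIV_quadratic)
    fix h
    define g where "g = (\<lambda>y. kern n D \<alpha> (x(i := x i + h)) y - kern n D \<alpha> x y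
      - h * kern n D (\<alpha>(i := Suc (\<alpha> i))) x y)"
    have eq: "mol n D \<alpha> f (x(i := x i + h)) - mol n D \<alpha> f x - h * mol n D (\<alpha>(i := Suc (\<alpha> i))) f x
      = (LINT y|leb n. f y * kern n D \<alpha> (x(i := x i + h)) y - f y * kern n D \<alpha> x y
          - h * (f y * kern n D (\<alpha>(i := Suc (\<alpha> i))) x y))"
      unfolding mol_def using int by simp
    have g: "f y * kern n D \<alpha> (x(i := x i + h)) y - f y * kern n D \<alpha> x y
          - h * (f y * kern n D (\<alpha>(i := Suc (\<alpha> i))) x y) = f y * g y" for y
      by (simp add: g_def algebra_simps)
    have "\<bar>LINT y|leb n. f y * g y\<bar> \<le> (LINT y|leb n. \<bar>f y\<bar> * (B * h\<^sup>2))"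
    proof (rule order.trans[OF integral_abs_bound integral_mono])
      fix y show "\<bar>f y * g y\<bar> \<le> \<bar>f y\<bar> * (B * h\<^sup>2)"
        unfolding abs_mult using B(2)[of x h y] by (intro mult_left_mono) (auto simp: g_def)
      show "integrable (leb n) (\<lambda>y. \<bar>f y * g y\<bar>)"
        unfolding g[symmetric] using int by simp
    qed (use assms in auto)
    moreover have "(LINT y|leb n. \<bar>f y\<bar> * (B * h\<^sup>2)) = (LINT y|leb n. \<bar>f y\<bar>) * B * h\<^sup>2"
      by (simp only: integral_mult_left_zero mult.assoc)
    ultimately show "\<bar>mol n D \<alpha> f (x(i := x i + h)) - mol n D \<alpha> f (x(i := x i)) - h * mol n D (\<alpha>(i := Suc (\<alpha> i))) f x\<bar>
      \<le> (LINT y|leb n. \<bar>f y\<bar>) * B * h\<^sup>2" unfolding fun_upd_triv eq g by linarith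
  qed
qed

lemma continuous_on_kern: "mollifier \<epsilon> D \<Longrightarrow> continuous_on A (\<lambda>x. kern n D \<alpha> x y)"
  unfolding kern_def
proof (intro continuous_on_prod)
  fix i assume m: "mollifier \<epsilon> D"
  have "continuous_on A (\<lambda>x. x i - y i)"
    by (intro continuous_intros continuous_on_subset[OF continuous_on_product_coordinates]) auto
  then show "continuous_on A (\<lambda>x. D (\<alpha> i) (x i - y i))"
    by (rule continuous_on_compose2[OF mollifier_cont[OF m, of UNIV]]) auto
qed

lemma continuous_on_mol:
  assumes "mollifier \<epsilon> D" "integrable (leb n) f"
  shows "continuous_on A (mol n D \<alpha> f)"
proof (rule continuous_on_subset[of UNIV])
  obtain B where B: "0 < B" "\<And>x y. \<bar>kern n D \<alpha> x y\<bar> \<le> B" using kern_bounded[OF assms(1)] by metis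
  note [measurable] = kern_measurable_leb[OF assms(1)]
  have [measurable]: "f \<in> borel_measurable (leb n)" using assms by auto
  have "isCont (mol n D \<alpha> f) a" for a
    unfolding continuous_at_sequentially
  proof (intro allI impI)
    fix x assume x: "x \<longlonglongrightarrow> a"
    show "(mol n D \<alpha> f \<circ> x) \<longlonglongrightarrow> mol n D \<alpha> f a"
      unfolding mol_def comp_def
    proof (rule integral_dominated_convergence[where w = "\<lambda>y. \<bar>f y\<bar> * B"])
      show "AE y in leb n. (\<lambda>k. f y * kern n D \<alpha> (x k) y) \<longlonglongrightarrow> f y * kern n D \<alpha> a y"
      proof (intro AE_I2 tendsto_mult tendsto_const)
        fix y
        have "isCont (\<lambda>x. kern n D \<alpha> x y) a"
          using continuous_on_kern[OF assms(1), of UNIV] by (simp add: continuous_on_eq_continuous_at)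
        then show "(\<lambda>k. kern n D \<alpha> (x k) y) \<longlonglongrightarrow> kern n D \<alpha> a y"
          using x by (rule isCont_tendsto_compose)
      qed
      show "AE y in leb n. norm (f y * kern n D \<alpha> (x k) y) \<le> \<bar>f y\<bar> * B" for k
        using B by (intro AE_I2) (auto simp: abs_mult intro!: mult_left_mono)
    qed (use assms in auto)
  qed
  then show "continuous_on UNIV (mol n D \<alpha> f)"
    by (simp add: continuous_at_imp_continuous_on)
qed simp

lemma pd_mol:
  assumes "mollifier \<epsilon> D" "i < n" "integrable (leb n) f"
  shows "pd i (mol n D \<alpha> f) = mol n D (\<alpha>(i := Suc (\<alpha> i))) f"
  unfolding pd_def using DERIV_imp_deriv[OF mol_deriv[OF assms]] by blast

lemma pd_kern:
  assumes "mollifier \<epsilon> D" "i < n"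
  shows "pd i (\<lambda>x. kern n D \<alpha> x y) = (\<lambda>x. kern n D (\<alpha>(i := Suc (\<alpha> i))) x y)"
  unfolding pd_def using DERIV_imp_deriv[OF kern_deriv[OF assms]] by blast

lemma Ck_mol:
  assumes "mollifier \<epsilon> D" "integrable (leb n) f"
  shows "Ck n k A (mol n D \<alpha> f)"
proof (induction k arbitrary: \<alpha>)
  case (Suc k)
  have "(\<lambda>t. mol n D \<alpha> f (x(i := t))) differentiable (at (x i))" if "i < n" for i x
    using mol_deriv[OF assms(1) that assms(2)] by (auto simp: real_differentiable_def)
  then show ?case using Suc continuous_on_mol[OF assms] by (simp add: pd_mol[OF assms(1) _ assms(2)])
qed (simp add: continuous_on_mol[OF assms])

lemma Ck_kern:
  assumes "mollifier \<epsilon> D"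
  shows "Ck n k A (\<lambda>x. kern n D \<alpha> x y)"
proof (induction k arbitrary: \<alpha>)
  case (Suc k)
  have "(\<lambda>t. kern n D \<alpha> (x(i := t)) y) differentiable (at (x i))" if "i < n" for i x
    using kern_deriv[OF assms(1) that] by (auto simp: real_differentiable_def)
  then show ?case using Suc continuous_on_kern[OF assms] by (simp add: pd_kern[OF assms])
qed (simp add: continuous_on_kern[OF assms])

lemma kern_0:
  assumes "mollifier \<epsilon> D" "x \<in> Rn n" "y \<notin> closed_box n x \<epsilon>" "y \<in> Rn n"
  shows "kern n D \<alpha> x y = 0" "kern n D \<alpha> y x = 0"
proof -
  obtain i where i: "i < n" "\<epsilon> < \<bar>y i - x i\<bar>" using assms by (auto simp: closed_box_def not_le)
  then have "D (\<alpha> i) (x i - y i) = 0" "D (\<alpha> i) (y i - x i) = 0"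
    using mollifier_0[OF assms(1), of "x i - y i"] mollifier_0[OF assms(1), of "y i - x i"] by auto
  then show "kern n D \<alpha> x y = 0" "kern n D \<alpha> y x = 0"
    unfolding kern_def using i by (auto intro!: prod_zero)
qed

lemma kern_sym: "mollifier \<epsilon> D \<Longrightarrow> kern n D (\<lambda>_. 0) x y = kern n D (\<lambda>_. 0) y x"
  unfolding kern_def using mollifier_even[of \<epsilon> D]
  by (intro prod.cong refl) (metis minus_diff_eq)

text \<open>The first derivative of an even kernel is odd. Exchanging the arguments thus turns a
  derivative in the point of evaluation into one in the variable of integration, up to the sign that
  integration by parts compensates.\<close>

lemma kern_antisym:
  assumes "mollifier \<epsilon> D" "i < n"
  shows "kern n D ((\<lambda>_. 0)(i := Suc 0)) x y = - kern n D ((\<lambda>_. 0)(i := Suc 0)) y x"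
proof -
  have "kern n D ((\<lambda>_. 0)(i := Suc 0)) x y = D (Suc 0) (x i - y i) * (\<Prod>j\<in>{..<n} - {i}. D 0 (x j - y j))" for x y
    using kern_split[OF assms(2), of D "\<lambda>_. 0" "Suc 0" x "x i" y] by simp
  moreover have "D (Suc 0) (x i - y i) = - D (Suc 0) (y i - x i)"
    using mollifier_odd[OF assms(1), of "y i - x i"] by simp
  moreover have "(\<Prod>j\<in>{..<n} - {i}. D 0 (x j - y j)) = (\<Prod>j\<in>{..<n} - {i}. D 0 (y j - x j))"
    using mollifier_even[OF assms(1)] by (intro prod.cong refl) (metis minus_diff_eq)
  ultimately show ?thesis by simp
qed

lemma kern_nonneg: "mollifier \<epsilon> D \<Longrightarrow> 0 \<le> kern n D (\<lambda>_. 0) x y"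
  unfolding kern_def by (intro prod_nonneg) (auto simp: mollifier_nonneg)

lemma kern_integral:
  assumes "mollifier \<epsilon> D"
  shows "integrable (leb n) (kern n D (\<lambda>_. 0) x)" "(LINT y|leb n. kern n D (\<lambda>_. 0) x y) = 1"
proof -
  note [measurable] = mollifier_measurable[OF assms]
  have int: "integrable lborel (D 0)" "(LINT x|lborel. D 0 x) = 1" using assms by (auto simp: mollifier_def)
  have i1: "integrable lborel (\<lambda>t. D 0 (c - t))" "(LINT t|lborel. D 0 (c - t)) = 1" for c
    using lborel_integrable_real_affine[OF int(1), of "-1" c] lborel_integral_real_affine[of "-1" "D 0" c] int(2)
    by auto
  have "(\<lambda>y. \<Prod>i<n. D 0 (x i - y i)) \<in> borel_measurable (Pi\<^sub>M {..<n} (\<lambda>_. lborel))"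
  proof (intro borel_measurable_prod measurable_compose[OF _ mollifier_measurable[OF assms]] borel_measurable_diff)
    fix i assume "i \<in> {..<n}"
    then show "(\<lambda>y. y i) \<in> borel_measurable (Pi\<^sub>M {..<n} (\<lambda>_. lborel))"
      using measurable_component_singleton[of i "{..<n}" "\<lambda>_. lborel"] by simp
  qed simp
  then show "integrable (leb n) (kern n D (\<lambda>_. 0) x)" "(LINT y|leb n. kern n D (\<lambda>_. 0) x y) = 1"
    unfolding leb_def kern_def
    using lborel_prod.product_integrable_prod[of "{..<n}" "\<lambda>i t. D 0 (x i - t)"]
      lborel_prod.product_integral_prod[of "{..<n}" "\<lambda>i t. D 0 (x i - t)"] i1
    by (simp_all add: integrable_completion integral_completion)
qed

text \<open>A mollified value is an average: the kernel is nonnegative, has integral 1 and vanishes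
  outside the cube, so the average deviates from c no more than f does on the cube.\<close>

lemma mol_approx:
  assumes m: "mollifier \<epsilon> D" and f: "integrable (leb n) f" and x: "x \<in> Rn n"
    and le: "\<And>y. y \<in> closed_box n x \<epsilon> \<Longrightarrow> \<bar>f y - c\<bar> \<le> e"
  shows "\<bar>mol n D (\<lambda>_. 0) f x - c\<bar> \<le> e"
proof -
  let ?k = "kern n D (\<lambda>_. 0) x"
  note int = integrable_mult_kern[OF m f, of "\<lambda>_. 0" x] kern_integral[OF m, of n x]
  have "mol n D (\<lambda>_. 0) f x - c = (LINT y|leb n. f y * ?k y - c * ?k y)"
    using int unfolding mol_def by simp
  also have "\<bar>\<dots>\<bar> \<le> (LINT y|leb n. e * ?k y)"
  proof (rule order.trans[OF integral_abs_bound integral_mono])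
    fix y assume y: "y \<in> space (leb n)"
    show "\<bar>f y * ?k y - c * ?k y\<bar> \<le> e * ?k y"
    proof (cases "y \<in> closed_box n x \<epsilon>")
      case True
      have "\<bar>f y * ?k y - c * ?k y\<bar> = \<bar>f y - c\<bar> * ?k y"
        using kern_nonneg[OF m, of n x y] by (simp add: left_diff_distrib[symmetric] abs_mult)
      also have "\<dots> \<le> e * ?k y" using le[OF True] kern_nonneg[OF m] by (intro mult_right_mono) auto
      finally show ?thesis .
    next
      case False
      then show ?thesis using kern_0[OF m x False, of "\<lambda>_. 0"] y by simp
    qed
  qed (use int in auto)
  also have "\<dots> = e" using int by simp
  finally show ?thesis .
qed

text \<open>The bounded kernel is dominated by a multiple of |F(x) G(y)|, which is integrable on the
  product space, and it is symmetric because D 0 is even. The exchange lets the mollifier act on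
  whichever factor is better behaved.\<close>

lemma mol_Fubini:
  assumes m: "mollifier \<epsilon> D" and F: "integrable (leb n) F" and G: "integrable (leb n) G"
  shows "(LINT x|leb n. F x * mol n D (\<lambda>_. 0) G x) = (LINT y|leb n. G y * mol n D (\<lambda>_. 0) F y)"
    "integrable (leb n) (\<lambda>x. F x * mol n D (\<lambda>_. 0) G x)"
    "integrable (leb n \<Otimes>\<^sub>M leb n) (\<lambda>(x, y). F x * G y * kern n D (\<lambda>_. 0) x y)"
proof -
  let ?k = "kern n D (\<lambda>_. 0)"
  obtain B where B: "0 < B" "\<And>x y. \<bar>?k x y\<bar> \<le> B" using kern_bounded[OF m] by metis
  have [measurable]: "F \<in> borel_measurable (leb n)" "G \<in> borel_measurable (leb n)" using F G by auto
  have [measurable]: "(\<lambda>z. ?k (fst z) (snd z)) \<in> borel_measurable (leb n \<Otimes>\<^sub>M leb n)"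
    by (rule kern_measurable[OF m measurable_compose[OF measurable_fst measurable_id_leb]
        measurable_compose[OF measurable_snd measurable_id_leb]])
  have FG: "integrable (leb n \<Otimes>\<^sub>M leb n) (\<lambda>(x, y). F x * G y)"
  proof (rule leb2.Fubini_integrable)
    show "integrable (leb n) (\<lambda>x. LINT y|leb n. norm (case (x, y) of (x, y) \<Rightarrow> F x * G y))"
      using F by (simp add: abs_mult)
  qed (use G in auto)
  show int: "integrable (leb n \<Otimes>\<^sub>M leb n) (\<lambda>(x, y). F x * G y * ?k x y)"
  proof (rule Bochner_Integration.integrable_bound)
    show "integrable (leb n \<Otimes>\<^sub>M leb n) (\<lambda>z. B * (case z of (x, y) \<Rightarrow> F x * G y))" using FG by simp
    show "(\<lambda>(x, y). F x * G y * ?k x y) \<in> borel_measurable (leb n \<Otimes>\<^sub>M leb n)"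
      unfolding case_prod_beta by measurable
    show "AE z in leb n \<Otimes>\<^sub>M leb n. norm (case z of (x, y) \<Rightarrow> F x * G y * ?k x y) \<le> norm (B * (case z of (x, y) \<Rightarrow> F x * G y))"
      using B by (intro AE_I2) (auto simp: abs_mult mult.commute[of B] intro!: mult_mono)
  qed
  have e: "(LINT y|leb n. F x * G y * ?k x y) = F x * mol n D (\<lambda>_. 0) G x" for x
    by (simp add: mol_def mult.assoc)
  have e': "(LINT x|leb n. F x * G y * ?k x y) = G y * mol n D (\<lambda>_. 0) F y" for y
  proof -
    have "(LINT x|leb n. F x * G y * ?k x y) = (LINT x|leb n. G y * (F x * ?k y x))"
      by (simp add: kern_sym[OF m, of n _ y] ac_simps)
    then show ?thesis by (simp add: mol_def)
  qed
  show "(LINT x|leb n. F x * mol n D (\<lambda>_. 0) G x) = (LINT y|leb n. G y * mol n D (\<lambda>_. 0) F y)"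
    using leb2.Fubini_integral[OF int] by (simp add: e e')
  show "integrable (leb n) (\<lambda>x. F x * mol n D (\<lambda>_. 0) G x)"
    using leb2.integrable_fst[OF int] by (simp add: e)
qed

section \<open>Density of continuous functions in L^1\<close>

lemma Urysohn_metric:
  fixes K U :: "'a::metric_space set"
  assumes "closed K" "open U" "K \<subseteq> U"
  obtains h :: "'a \<Rightarrow> real" where "continuous_on UNIV h" "\<And>x. 0 \<le> h x" "\<And>x. h x \<le> 1"
    "\<And>x. x \<in> K \<Longrightarrow> h x = 1" "\<And>x. x \<notin> U \<Longrightarrow> h x = 0"
proof -
  have "normal_space (euclidean :: 'a topology)"
    by (simp add: metrizable_imp_normal_space metrizable_space_euclidean)
  moreover have "disjnt (- U) K" using assms by (auto simp: disjnt_def)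
  ultimately obtain h where h: "continuous_map euclidean (top_of_set {0..1::real}) h" "h ` (- U) \<subseteq> {0}" "h ` K \<subseteq> {1}"
    using Urysohn_lemma[of euclidean "- U" K 0 "1::real"] assms by auto
  then have "continuous_on UNIV h" "\<And>x. h x \<in> {0..1}"
    by (auto simp: continuous_map_in_subtopology image_subset_iff)
  with h that show ?thesis by (auto simp: image_subset_iff)
qed

text \<open>Regularity of a finite Borel measure squeezes A between a compact K and an open U with
  \<open>measure M (U - K) < e\<close>; a Urysohn function for this pair differs from the indicator
  only on \<open>U - K\<close>.\<close>

lemma continuous_dense_indicator:
  fixes M :: "'a::{second_countable_topology, complete_space} measure"
  assumes M: "sets M = sets borel" "finite_measure M" and A: "A \<in> sets M" and e: "0 < e"
  obtains h :: "'a \<Rightarrow> real" where "continuous_on UNIV h" "integrable M h" "(LINT x|M. \<bar>indicator A x - h x\<bar>) < e"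
proof -
  interpret finite_measure M by fact
  have fin: "emeasure M (space M) \<noteq> \<infinity>" by simp
  have A': "A \<in> sets borel" using A M by simp
  have "emeasure M A < emeasure M A + ennreal (e / 2)"
    using e by (simp add: emeasure_eq_measure ennreal_lessI add_nonneg_pos flip: ennreal_plus)
  then obtain U where U: "A \<subseteq> U" "open U" "emeasure M U < emeasure M A + ennreal (e / 2)"
    using outer_regular[OF M(1) fin A'] by (auto simp: INF_less_iff)
  \<comment> \<open>Subtraction in \<open>ennreal\<close> truncates at 0, so a set of small measure
    is treated apart, with the empty set as K.\<close>
  have "\<exists>K. K \<subseteq> A \<and> compact K \<and> emeasure M A < emeasure M K + ennreal (e / 2)"
  proof (cases "measure M A < e / 2")
    case True
    then show ?thesis by (intro exI[of _ "{}"]) (simp add: emeasure_eq_measure ennreal_less_iff)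
  next
    case False
    then have "emeasure M A - ennreal (e / 2) < emeasure M A"
      using e by (simp add: emeasure_eq_measure ennreal_minus ennreal_less_iff)
    then obtain K where "K \<subseteq> A" "compact K" "emeasure M A - ennreal (e / 2) < emeasure M K"
      using inner_regular[OF M(1) fin A'] by (auto simp: less_SUP_iff)
    then show ?thesis using e False
      by (intro exI[of _ K]) (auto simp: emeasure_eq_measure ennreal_minus ennreal_less_iff simp flip: ennreal_plus)
  qed
  then obtain K where K: "K \<subseteq> A" "compact K" "emeasure M A < emeasure M K + ennreal (e / 2)" by blast
  have sets: "U \<in> sets M" "K \<in> sets M" using U K M by (auto intro: borel_compact)
  have "measure M U < measure M A + e / 2" "measure M A < measure M K + e / 2"
    using U(3) K(3) e by (auto simp: emeasure_eq_measure ennreal_less_iff simp flip: ennreal_plus)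
  then have UK: "measure M (U - K) < e"
    using finite_measure_Diff[OF sets] U K by auto
  obtain h :: "'a \<Rightarrow> real" where h: "continuous_on UNIV h" "\<And>x. 0 \<le> h x" "\<And>x. h x \<le> 1"
    "\<And>x. x \<in> K \<Longrightarrow> h x = 1" "\<And>x. x \<notin> U \<Longrightarrow> h x = 0"
    using Urysohn_metric[of K U] U K compact_imp_closed by (metis subset_trans)
  have meas: "h \<in> borel_measurable M"
    using borel_measurable_continuous_onI[OF h(1)] by (simp cong: measurable_cong_sets add: M(1))
  have int: "integrable M h"
    by (rule integrable_const_bound[where B = 1]) (use h meas in auto)
  have "(LINT x|M. \<bar>indicator A x - h x\<bar>) \<le> (LINT x|M. indicator (U - K) x)"
  proof (rule integral_mono)
    fix x
    show "\<bar>indicator A x - h x\<bar> \<le> (indicator (U - K) x :: real)"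
      using h(2,3)[of x] h(4,5)[of x] U(1) K(1) by (auto simp: indicator_def)
  qed (use int A sets in \<open>auto simp: emeasure_eq_measure\<close>)
  also have "\<dots> = measure M (U - K)" using sets by (simp add: M)
  finally show ?thesis using that[OF h(1) int] UK by linarith
qed

lemma continuous_dense_L1:
  fixes M :: "'a::{second_countable_topology, complete_space} measure" and f :: "'a \<Rightarrow> real"
  assumes M: "sets M = sets borel" "finite_measure M" and f: "integrable M f"
  shows "\<forall>e>0. \<exists>h. continuous_on UNIV h \<and> integrable M h \<and> (LINT x|M. \<bar>f x - h x\<bar>) < e"
  using f
proof (induction rule: integrable_induct)
  case (base A c)
  show ?case
  proof (intro allI impI)
    fix e :: real assume e: "0 < e"
    define e' where "e' = e / (\<bar>c\<bar> + 1)"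
    have "0 < e'" using e by (simp add: e'_def)
    then obtain h where h: "continuous_on UNIV h" "integrable M h" "(LINT x|M. \<bar>indicator A x - h x\<bar>) < e'"
      using continuous_dense_indicator[OF M base(1)] by blast
    have "(LINT x|M. \<bar>indicator A x *\<^sub>R c - h x * c\<bar>) = (LINT x|M. \<bar>indicator A x - h x\<bar>) * \<bar>c\<bar>"
      by (simp add: left_diff_distrib[symmetric] abs_mult del: integral_mult_left)
    also have "\<dots> \<le> e' * \<bar>c\<bar>" using h(3) by (intro mult_right_mono) auto
    also have "\<dots> < e' * (\<bar>c\<bar> + 1)" using \<open>0 < e'\<close> by simp
    also have "\<dots> = e" by (simp add: e'_def)
    finally show "\<exists>h. continuous_on UNIV h \<and> integrable M h \<and> (LINT x|M. \<bar>indicator A x *\<^sub>R c - h x\<bar>) < e"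
      using h by (intro exI[of _ "\<lambda>x. h x * c"]) (auto intro!: continuous_intros)
  qed
next
  case (add f g)
  show ?case
  proof (intro allI impI)
    fix e :: real assume e: "0 < e"
    then have "0 < e / 2" by simp
    with add.IH obtain h k where h: "continuous_on UNIV h" "integrable M h" "(LINT x|M. \<bar>f x - h x\<bar>) < e / 2"
      and k: "continuous_on UNIV k" "integrable M k" "(LINT x|M. \<bar>g x - k x\<bar>) < e / 2"
      by meson
    have "(LINT x|M. \<bar>f x + g x - (h x + k x)\<bar>) \<le> (LINT x|M. \<bar>f x - h x\<bar> + \<bar>g x - k x\<bar>)"
      using add.hyps h k by (intro integral_mono) auto
    also have "\<dots> = (LINT x|M. \<bar>f x - h x\<bar>) + (LINT x|M. \<bar>g x - k x\<bar>)"
      using add.hyps h k by (intro Bochner_Integration.integral_add) auto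
    finally show "\<exists>h. continuous_on UNIV h \<and> integrable M h \<and> (LINT x|M. \<bar>f x + g x - h x\<bar>) < e"
      using h k by (intro exI[of _ "\<lambda>x. h x + k x"]) (auto intro!: continuous_intros)
  qed
next
  case (lim f s)
  show ?case
  proof (intro allI impI)
    fix e :: real assume e: "0 < e"
    have "(\<lambda>i. LINT x|M. \<bar>f x - s i x\<bar>) \<longlonglongrightarrow> (LINT x|M. 0)"
    proof (rule integral_dominated_convergence[where w = "\<lambda>x. 3 * \<bar>f x\<bar>"])
      show "AE x in M. (\<lambda>i. \<bar>f x - s i x\<bar>) \<longlonglongrightarrow> 0"
        using lim.hyps(2) by (intro AE_I2 tendsto_rabs_zero) (auto intro!: tendsto_eq_intros)
      show "AE x in M. norm \<bar>f x - s i x\<bar> \<le> 3 * \<bar>f x\<bar>" for i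
        using lim.hyps(3)[of _ i] by (intro AE_I2) force
    qed (use lim.hyps in auto)
    then have "eventually (\<lambda>i. (LINT x|M. \<bar>f x - s i x\<bar>) < e / 2) sequentially"
      using e by (intro order_tendstoD) auto
    then obtain i where i: "(LINT x|M. \<bar>f x - s i x\<bar>) < e / 2"
      using eventually_happens'[OF sequentially_bot] by blast
    have "0 < e / 2" using e by simp
    then obtain h where h: "continuous_on UNIV h" "integrable M h" "(LINT x|M. \<bar>s i x - h x\<bar>) < e / 2"
      using lim.IH by meson
    have "(LINT x|M. \<bar>f x - h x\<bar>) \<le> (LINT x|M. \<bar>f x - s i x\<bar> + \<bar>s i x - h x\<bar>)"
      using lim.hyps h by (intro integral_mono) auto
    also have "\<dots> = (LINT x|M. \<bar>f x - s i x\<bar>) + (LINT x|M. \<bar>s i x - h x\<bar>)"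
      using lim.hyps h by (intro Bochner_Integration.integral_add) auto
    finally show "\<exists>h. continuous_on UNIV h \<and> integrable M h \<and> (LINT x|M. \<bar>f x - h x\<bar>) < e"
      using h i by (intro exI[of _ h]) auto
  qed
qed

lemma measurable_restrict_PiM:
  "(\<lambda>x. restrict x {..<n}) \<in> (borel :: (nat \<Rightarrow> real) measure) \<rightarrow>\<^sub>M Pi\<^sub>M {..<n} (\<lambda>_. lborel)"
proof (rule measurable_restrict)
  fix i assume "i \<in> {..<n}"
  show "(\<lambda>x. x i) \<in> (borel :: (nat \<Rightarrow> real) measure) \<rightarrow>\<^sub>M lborel"
    using borel_measurable_continuous_onI[OF continuous_on_product_coordinates[of i]] by simp
qed

text \<open>The density theorem asks for a finite Borel measure on a Polish space. So
  \<open>leb n\<close> is restricted to B and transported to \<open>nat \<Rightarrow> real\<close>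
  by the identity, and G, which is measurable only for the completion, is replaced by a Borel
  function equal to it almost everywhere.\<close>

lemma continuous_dense_box:
  fixes G :: "(nat \<Rightarrow> real) \<Rightarrow> real"
  assumes G: "integrable (leb n) G" and e: "0 < e" and B: "compact B" "B \<subseteq> Rn n"
  obtains h :: "(nat \<Rightarrow> real) \<Rightarrow> real" where "continuous_on UNIV h" "(LINT x:B|leb n. \<bar>G x - h x\<bar>) < e"
proof -
  have Bs: "B \<in> sets (leb n)" using compact_sets_leb B by blast
  have "G \<in> borel_measurable (leb n)" using G by auto
  then have "\<exists>g\<in>borel_measurable (Pi\<^sub>M {..<n} (\<lambda>_. lborel)). AE x in Pi\<^sub>M {..<n} (\<lambda>_. lborel). G x = g x"
    unfolding leb_def by (rule completion_ex_borel_measurable_real)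
  then obtain g where g: "g \<in> borel_measurable (Pi\<^sub>M {..<n} (\<lambda>_. lborel))"
    "AE x in Pi\<^sub>M {..<n} (\<lambda>_. lborel). G x = g x"
    by (elim bexE)
  define g' where "g' = (\<lambda>x. g (restrict x {..<n}))"
  have g': "g' \<in> borel_measurable borel"
    unfolding g'_def using measurable_compose[OF measurable_restrict_PiM g(1)] .
  have r: "restrict x {..<n} = x" if "x \<in> Rn n" for x
    using that by (simp add: Rn_def)
  have AE: "AE x in leb n. G x = g' x"
    using AE_completion[OF g(2)] AE_space[of "leb n"] unfolding leb_def[symmetric]
    by eventually_elim (simp add: g'_def r)
  define N where "N = density (leb n) (\<lambda>x. ennreal (indicator B x))"
  define M where "M = distr N borel (\<lambda>x. x)"
  have id: "(\<lambda>x. x) \<in> N \<rightarrow>\<^sub>M borel" unfolding N_def using measurable_id_leb by simp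
  have M: "sets M = sets borel" by (simp add: M_def)
  have Bm: "(\<lambda>x. indicator B x :: real) \<in> borel_measurable (leb n)" using Bs by simp
  have fin: "finite_measure M"
  proof
    have "emeasure M (space M) = emeasure N (space N)"
      unfolding M_def using id by (subst emeasure_distr) auto
    also have "\<dots> = emeasure (leb n) (B \<inter> Rn n)"
      unfolding N_def ennreal_indicator space_density space_leb
      by (rule emeasure_restricted[OF Bs]) (metis sets.top space_leb)
    also have "\<dots> = emeasure (leb n) B" using B by (simp add: Int_absorb2)
    finally show "emeasure M (space M) \<noteq> \<infinity>" using emeasure_compact_leb[OF B] by simp
  qed
  have int_eq: "integrable M k \<longleftrightarrow> integrable (leb n) (\<lambda>x. indicator B x *\<^sub>R k x)"
    "(LINT x|M. k x) = (LINT x:B|leb n. k x)" if k: "k \<in> borel_measurable borel" for k :: "_ \<Rightarrow> real"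
  proof -
    have k': "k \<in> borel_measurable (leb n)" using measurable_compose[OF measurable_id_leb k] .
    show "integrable M k \<longleftrightarrow> integrable (leb n) (\<lambda>x. indicator B x *\<^sub>R k x)"
    proof -
      have "integrable M k \<longleftrightarrow> integrable N k"
        unfolding M_def by (rule integrable_distr_eq[OF id k])
      also have "\<dots> \<longleftrightarrow> integrable (leb n) (\<lambda>x. indicator B x *\<^sub>R k x)"
        unfolding N_def using Bm k' by (intro integrable_density) auto
      finally show ?thesis .
    qed
    show "(LINT x|M. k x) = (LINT x:B|leb n. k x)"
    proof -
      have "(LINT x|M. k x) = (LINT x|N. k x)"
        unfolding M_def by (rule integral_distr[OF id k])
      also have "\<dots> = (LINT x:B|leb n. k x)"
        unfolding N_def set_lebesgue_integral_def using Bm k' by (intro integral_density) auto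
      finally show ?thesis .
    qed
  qed
  have "integrable (leb n) (\<lambda>x. indicator B x *\<^sub>R G x)"
    using G Bs by (intro integrable_mult_indicator)
  then have "integrable (leb n) (\<lambda>x. indicator B x *\<^sub>R g' x)"
    by (rule integrable_cong_AE_imp) (use AE Bm measurable_compose[OF measurable_id_leb g'] in auto)
  then have "integrable M g'" by (simp add: int_eq(1)[OF g'])
  then obtain h where h: "continuous_on UNIV h" "(LINT x|M. \<bar>g' x - h x\<bar>) < e"
    using continuous_dense_L1[OF M fin] e by meson
  have hm: "h \<in> borel_measurable borel" using h by (intro borel_measurable_continuous_onI)
  have "(LINT x|M. \<bar>g' x - h x\<bar>) = (LINT x:B|leb n. \<bar>g' x - h x\<bar>)"
    using g' hm by (intro int_eq) simp
  also have "\<dots> = (LINT x:B|leb n. \<bar>G x - h x\<bar>)"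
    unfolding set_lebesgue_integral_def
    using AE Bm G measurable_compose[OF measurable_id_leb g'] measurable_compose[OF measurable_id_leb hm]
    by (intro integral_cong_AE) auto
  finally show ?thesis using that h by simp
qed

section \<open>Convergence of pairings with mollified functions\<close>

lemma closed_box_trans:
  "x \<in> closed_box n c R \<Longrightarrow> y \<in> closed_box n x \<epsilon> \<Longrightarrow> R + \<epsilon> \<le> R' \<Longrightarrow> y \<in> closed_box n c R'"
  unfolding closed_box_def by (smt (verit, best) mem_Collect_eq)

lemma abs_mol_le:
  assumes m: "mollifier \<epsilon> D" and F: "integrable (leb n) F" "\<And>x. \<bar>F x\<bar> \<le> b" and x: "x \<in> Rn n"
  shows "\<bar>mol n D (\<lambda>_. 0) F x\<bar> \<le> b"
  using mol_approx[OF m F(1) x, of 0 b] F(2) by simp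

text \<open>G is split into a continuous part and a part J small in L^1. In the pairing with J the
  mollifier is moved to the bounded F, whose bound it preserves; the continuous part converges
  uniformly on the cube that carries F.\<close>

lemma mol_conv_bounded:
  assumes F: "integrable (leb n) F" "\<And>x. \<bar>F x\<bar> \<le> b" "\<And>x. x \<notin> closed_box n c R \<Longrightarrow> F x = 0"
    and G: "integrable (leb n) G" "\<And>x. x \<notin> closed_box n c R \<Longrightarrow> G x = 0"
    and e: "0 < e"
  shows "\<exists>\<epsilon>0>0. \<forall>\<epsilon> D. mollifier \<epsilon> D \<longrightarrow> \<epsilon> \<le> \<epsilon>0 \<longrightarrow>
     \<bar>(LINT x|leb n. F x * mol n D (\<lambda>_. 0) G x) - (LINT x|leb n. F x * G x)\<bar> \<le> e"
proof -
  have b: "0 \<le> b" using F(2)[of undefined] by linarith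
  \<comment> \<open>The margin 1 ensures that for \<open>\<epsilon>\<close> \<le> 1 the kernel cubes
    around points of the smaller cube stay where \<open>h1\<close> agrees with the continuous
    \<open>h\<close>.\<close>
  define B where "B = closed_box n c (R + 1)"
  have B: "compact B" "B \<subseteq> Rn n" "B \<in> sets (leb n)"
    by (auto simp: B_def compact_closed_box closed_box_subset_Rn compact_sets_leb)
  have sub: "closed_box n c R \<subseteq> B" by (force simp: B_def closed_box_def)
  define d where "d = e / (4 * (b + 1))"
  have d: "0 < d" "b * d \<le> e / 4" using e b by (auto simp: d_def field_simps)
  obtain h where h: "continuous_on UNIV h" "(LINT x:B|leb n. \<bar>G x - h x\<bar>) < d"
    using continuous_dense_box[OF G(1) d(1) B(1,2)] .
  define h1 where "h1 = (\<lambda>x. indicator B x * h x)"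
  have h1: "integrable (leb n) h1"
    using set_integrable_continuous[OF B(1,2), of h] h(1) continuous_on_subset
    unfolding set_integrable_def h1_def by auto
  have Gh: "(LINT x|leb n. \<bar>G x - h1 x\<bar>) < d"
  proof -
    have "\<bar>G x - h1 x\<bar> = indicator B x * \<bar>G x - h x\<bar>" for x
      using G(2)[of x] sub by (auto simp: h1_def indicator_def)
    then show ?thesis using h(2) by (simp add: set_lebesgue_integral_def)
  qed
  define IF where "IF = (LINT x|leb n. \<bar>F x\<bar>)"
  have IF: "0 \<le> IF" by (simp add: IF_def)
  define \<eta> where "\<eta> = e / (4 * (IF + 1))"
  have \<eta>: "0 < \<eta>" "\<eta> * IF \<le> e / 4" using e IF by (auto simp: \<eta>_def field_simps)
  obtain \<delta> where \<delta>: "0 < \<delta>" "\<And>x y. x \<in> closed_box n c R \<Longrightarrow> y \<in> closed_box n x \<delta> \<Longrightarrow> y \<in> Rn n \<and> \<bar>h y - h x\<bar> \<le> \<eta>"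
    using uniform_continuous_boxes[of n "Rn n" "closed_box n c R" h \<eta>] compact_closed_box closed_box_subset_Rn h(1) \<eta>(1)
      continuous_on_subset by (metis openin_subtopology_self subset_UNIV)
  have main: "\<bar>(LINT x|leb n. F x * mol n D (\<lambda>_. 0) G x) - (LINT x|leb n. F x * G x)\<bar> \<le> e"
    if m: "mollifier \<epsilon> D" and small: "\<epsilon> \<le> min \<delta> 1" for \<epsilon> D
  proof -
    let ?m = "mol n D (\<lambda>_. 0)"
    have bFG: "integrable (leb n) (\<lambda>x. F x * g x)" if "integrable (leb n) g" for g
    proof (rule Bochner_Integration.integrable_bound[where f = "\<lambda>x. b * g x"])
      show "AE x in leb n. norm (F x * g x) \<le> norm (b * g x)"
        using F(2) b by (intro AE_I2) (auto simp: abs_mult intro!: mult_right_mono)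
    qed (use that F in auto)
    define J where "J = (\<lambda>x. G x - h1 x)"
    have J: "integrable (leb n) J" using G h1 by (simp add: J_def)
    have 0: "?m G x = ?m J x + ?m h1 x" for x
      unfolding mol_def J_def using integrable_mult_kern[OF m G(1)] integrable_mult_kern[OF m h1]
      by (subst Bochner_Integration.integral_add[symmetric]) (auto simp: algebra_simps)
    have 1: "(LINT x|leb n. F x * ?m G x) = (LINT x|leb n. F x * ?m J x) + (LINT x|leb n. F x * ?m h1 x)"
      unfolding 0 distrib_left by (rule Bochner_Integration.integral_add[OF mol_Fubini(2)[OF m F(1) J] mol_Fubini(2)[OF m F(1) h1]])
    have 2: "(LINT x|leb n. F x * G x) = (LINT x|leb n. F x * J x) + (LINT x|leb n. F x * h1 x)"
      using bFG[OF J] bFG[OF h1]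
      by (subst Bochner_Integration.integral_add[symmetric]) (auto simp: J_def algebra_simps)
    have J1: "(LINT x|leb n. b * \<bar>J x\<bar>) \<le> e / 4"
      using Gh d b mult_left_mono[of "LINT x|leb n. \<bar>J x\<bar>" d b] by (simp add: J_def)
    have 3: "\<bar>LINT x|leb n. F x * ?m J x\<bar> \<le> e / 4"
    proof -
      have "\<bar>LINT x|leb n. J x * ?m F x\<bar> \<le> (LINT x|leb n. b * \<bar>J x\<bar>)"
      proof (rule order.trans[OF integral_abs_bound integral_mono])
        fix x assume "x \<in> space (leb n)"
        then show "\<bar>J x * ?m F x\<bar> \<le> b * \<bar>J x\<bar>"
          using abs_mol_le[OF m F(1,2)] by (auto simp: abs_mult mult.commute[of b] intro!: mult_left_mono)
      qed (use mol_Fubini(2)[OF m J F(1)] J in auto)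
      then show ?thesis using J1 mol_Fubini(1)[OF m F(1) J] by simp
    qed
    have 4: "\<bar>LINT x|leb n. F x * J x\<bar> \<le> e / 4"
    proof -
      have "\<bar>LINT x|leb n. F x * J x\<bar> \<le> (LINT x|leb n. b * \<bar>J x\<bar>)"
      proof (rule order.trans[OF integral_abs_bound integral_mono])
        show "\<bar>F x * J x\<bar> \<le> b * \<bar>J x\<bar>" for x
          using F(2)[of x] by (auto simp: abs_mult intro!: mult_right_mono)
      qed (use bFG[OF J] J in auto)
      then show ?thesis using J1 by simp
    qed
    have 5: "\<bar>(LINT x|leb n. F x * ?m h1 x) - (LINT x|leb n. F x * h1 x)\<bar> \<le> e / 4"
    proof -
      have "(LINT x|leb n. F x * ?m h1 x) - (LINT x|leb n. F x * h1 x) = (LINT x|leb n. F x * ?m h1 x - F x * h1 x)"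
        using mol_Fubini(2)[OF m F(1) h1] bFG[OF h1] by simp
      moreover have "\<bar>LINT x|leb n. F x * ?m h1 x - F x * h1 x\<bar> \<le> (LINT x|leb n. \<eta> * \<bar>F x\<bar>)"
      proof (rule order.trans[OF integral_abs_bound integral_mono])
        fix x
        show "\<bar>F x * ?m h1 x - F x * h1 x\<bar> \<le> \<eta> * \<bar>F x\<bar>"
        proof (cases "x \<in> closed_box n c R")
          case True
          have xB: "x \<in> B" "x \<in> Rn n" using True sub B by auto
          have "\<bar>h1 y - h1 x\<bar> \<le> \<eta>" if y: "y \<in> closed_box n x \<epsilon>" for y
          proof -
            have "y \<in> B" using closed_box_trans[OF True y] small by (simp add: B_def)
            moreover have "y \<in> closed_box n x \<delta>" using y small by (force simp: closed_box_def)
            ultimately show ?thesis using \<delta>(2)[OF True] xB by (simp add: h1_def)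
          qed
          then have "\<bar>?m h1 x - h1 x\<bar> \<le> \<eta>" by (rule mol_approx[OF m h1 xB(2)])
          then show ?thesis
            by (simp add: right_diff_distrib[symmetric] abs_mult mult.commute[of \<eta>] mult_left_mono)
        qed (use F(3) in simp)
      qed (use mol_Fubini(2)[OF m F(1) h1] bFG[OF h1] F in auto)
      moreover have "(LINT x|leb n. \<eta> * \<bar>F x\<bar>) = \<eta> * IF" by (simp add: IF_def)
      ultimately show ?thesis using \<eta>(2) by linarith
    qed
    show ?thesis using 3 4 5 e unfolding 1 2 by linarith
  qed
  show ?thesis by (rule exI[of _ "min \<delta> 1"]) (use \<delta>(1) main in \<open>auto simp del: min.bounded_iff\<close>)
qed

text \<open>Where |G| \<le> 1 it is dominated by the indicator of B, which has finite measure, and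
  elsewhere by |G|^p.\<close>

lemma integrable_if_powr_integrable:
  fixes G :: "(nat \<Rightarrow> real) \<Rightarrow> real"
  assumes G: "G \<in> borel_measurable (leb n)" "integrable (leb n) (\<lambda>x. \<bar>G x\<bar> powr p)"
    and B: "compact B" "B \<subseteq> Rn n" "\<And>x. x \<notin> B \<Longrightarrow> G x = 0" and p: "1 \<le> p"
  shows "integrable (leb n) G"
proof (rule Bochner_Integration.integrable_bound)
  have "integrable (leb n) (\<lambda>x. indicator B x :: real)"
    using set_integrable_continuous[OF B(1,2), of "\<lambda>_. 1"] by (simp add: set_integrable_def)
  then show "integrable (leb n) (\<lambda>x. indicator B x + \<bar>G x\<bar> powr p)" using G by simp
  have "\<bar>G x\<bar> \<le> indicator B x + \<bar>G x\<bar> powr p" for x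
  proof (cases "x \<in> B")
    case True
    show ?thesis
    proof (cases "\<bar>G x\<bar> \<le> 1")
      case False
      then have "\<bar>G x\<bar> powr 1 \<le> \<bar>G x\<bar> powr p" using p by (intro powr_mono) auto
      then show ?thesis using False True by simp
    qed (use True in \<open>simp add: add_increasing2\<close>)
  qed (use B(3) in simp)
  then show "AE x in leb n. norm (G x) \<le> norm (indicator B x + \<bar>G x\<bar> powr p)"
    by (intro AE_I2) (metis abs_ge_self order.trans real_norm_def)
qed (fact G)

text \<open>The factors 1/q and 1/p of Young's inequality are dropped. The parameter l shifts weight
  between the terms, so that the contribution of a fixed y can be made as small as desired.\<close>

lemma scaled_Young:
  fixes x y :: real
  assumes "1 < p" "1 < q" "1 / p + 1 / q = 1" "0 < l"
  shows "\<bar>x * y\<bar> \<le> l powr q * \<bar>x\<bar> powr q + l powr (- p) * \<bar>y\<bar> powr p"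
proof -
  have d: "z / r \<le> z" if "0 \<le> z" "1 < r" for z r :: real
    using that mult_right_mono[of 1 r z] by (simp add: pos_divide_le_eq mult.commute)
  have "\<bar>x * y\<bar> = (l * \<bar>x\<bar>) * (\<bar>y\<bar> / l)" using assms by (simp add: abs_mult)
  also have "\<dots> \<le> (l * \<bar>x\<bar>) powr q / q + (\<bar>y\<bar> / l) powr p / p"
    using assms by (intro Youngs_inequality) auto
  also have "\<dots> \<le> (l * \<bar>x\<bar>) powr q + (\<bar>y\<bar> / l) powr p"
    using assms by (intro add_mono d) auto
  also have "\<dots> = l powr q * \<bar>x\<bar> powr q + l powr (- p) * \<bar>y\<bar> powr p"
    using assms by (simp add: powr_mult powr_divide powr_minus field_simps)
  finally show ?thesis .
qed

text \<open>The product inequality is applied under the kernel. The mollified |G|^p that remains is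
  moved by symmetry onto an indicator, whose mollification is at most 1, so the bound has the same
  form as without mollification.\<close>

lemma mol_Young:
  assumes m: "mollifier \<epsilon> D"
    and F: "integrable (leb n) F" "integrable (leb n) (\<lambda>x. \<bar>F x\<bar> powr q)"
    and G: "integrable (leb n) G" "integrable (leb n) (\<lambda>x. \<bar>G x\<bar> powr p)"
    and F0: "\<And>x. x \<notin> closed_box n c R \<Longrightarrow> F x = 0"
    and ab: "0 \<le> a" "0 \<le> b" "\<And>x y :: real. \<bar>x * y\<bar> \<le> a * \<bar>x\<bar> powr q + b * \<bar>y\<bar> powr p"
  shows "\<bar>LINT x|leb n. F x * mol n D (\<lambda>_. 0) G x\<bar> \<le>
      a * (LINT x|leb n. \<bar>F x\<bar> powr q) + b * (LINT x|leb n. \<bar>G x\<bar> powr p)"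
proof -
  let ?m = "mol n D (\<lambda>_. 0)"
  \<comment> \<open>The cube outside which F vanishes. The cut-off makes the bound integrable, since
    \<open>mol_Fubini\<close> provides integrability of a mollified function only in a product with
    an integrable one.\<close>
  let ?I = "\<lambda>x. indicator (closed_box n c R) x :: real"
  let ?g = "\<lambda>x. \<bar>G x\<bar> powr p"
  have I: "integrable (leb n) ?I"
    using set_integrable_continuous[OF compact_closed_box[of n c R] closed_box_subset_Rn, of "\<lambda>_. 1"] by (simp add: set_integrable_def)
  have pw: "\<bar>F x * ?m G x\<bar> \<le> a * \<bar>F x\<bar> powr q + b * (?I x * ?m ?g x)" if x: "x \<in> Rn n" for x
  proof (cases "x \<in> closed_box n c R")
    case True
    let ?k = "kern n D (\<lambda>_. 0) x"
    note int = integrable_mult_kern[OF m G(1), of "\<lambda>_. 0" x] integrable_mult_kern[OF m G(2), of "\<lambda>_. 0" x]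
      kern_integral[OF m, of n x]
    have "F x * ?m G x = (LINT y|leb n. F x * (G y * ?k y))"
      unfolding mol_def by simp
    moreover have "\<bar>LINT y|leb n. F x * (G y * ?k y)\<bar> \<le> (LINT y|leb n. a * \<bar>F x\<bar> powr q * ?k y + b * (?g y * ?k y))"
    proof (rule order.trans[OF integral_abs_bound integral_mono])
      fix y
      have "\<bar>F x * (G y * ?k y)\<bar> = \<bar>F x * G y\<bar> * ?k y"
        using kern_nonneg[OF m, of n x y] by (simp add: abs_mult)
      also have "\<dots> \<le> (a * \<bar>F x\<bar> powr q + b * ?g y) * ?k y"
        using ab(3) kern_nonneg[OF m] by (intro mult_right_mono) auto
      finally show "\<bar>F x * (G y * ?k y)\<bar> \<le> a * \<bar>F x\<bar> powr q * ?k y + b * (?g y * ?k y)"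
        by (simp add: algebra_simps)
    qed (use int in auto)
    moreover have "(LINT y|leb n. a * \<bar>F x\<bar> powr q * ?k y + b * (?g y * ?k y)) = a * \<bar>F x\<bar> powr q + b * ?m ?g x"
      using int by (simp add: mol_def)
    ultimately have "\<bar>F x * ?m G x\<bar> \<le> a * \<bar>F x\<bar> powr q + b * ?m ?g x" by linarith
    then show ?thesis using True by simp
  qed (use ab(1) F0 in simp)
  note int = mol_Fubini(2)[OF m I G(2)]
  have "\<bar>LINT x|leb n. F x * ?m G x\<bar> \<le> (LINT x|leb n. a * \<bar>F x\<bar> powr q + b * (?I x * ?m ?g x))"
    by (rule order.trans[OF integral_abs_bound integral_mono])
      (use pw mol_Fubini(2)[OF m F(1) G(1)] int F in auto)
  also have "\<dots> = a * (LINT x|leb n. \<bar>F x\<bar> powr q) + b * (LINT x|leb n. ?I x * ?m ?g x)"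
    using int F by simp
  also have "(LINT x|leb n. ?I x * ?m ?g x) = (LINT x|leb n. ?g x * ?m ?I x)"
    by (rule mol_Fubini(1)[OF m I G(2)])
  also have "\<dots> \<le> (LINT x|leb n. ?g x)"
  proof (rule integral_mono)
    fix x assume "x \<in> space (leb n)"
    then have "\<bar>?m ?I x\<bar> \<le> 1" by (intro abs_mol_le[OF m I]) (auto simp: indicator_def)
    then show "?g x * ?m ?I x \<le> ?g x" by (intro mult_left_le) auto
  qed (use mol_Fubini(2)[OF m G(2) I] G in auto)
  finally show ?thesis using ab(2) by (simp add: mult_left_mono)
qed

text \<open>F is truncated at height k: the bounded part \<open>T k\<close> falls under
  \<open>mol_conv_bounded\<close>, and the excess \<open>S k\<close>, small in L^q, is controlled
  with and without mollifier by the same Young bound.\<close>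

lemma mol_conv_Lp:
  assumes pq: "1 < p" "1 < q" "1 / p + 1 / q = 1"
    and F: "F \<in> borel_measurable (leb n)" "integrable (leb n) (\<lambda>x. \<bar>F x\<bar> powr q)" "\<And>x. x \<notin> closed_box n c R \<Longrightarrow> F x = 0"
    and G: "G \<in> borel_measurable (leb n)" "integrable (leb n) (\<lambda>x. \<bar>G x\<bar> powr p)" "\<And>x. x \<notin> closed_box n c R \<Longrightarrow> G x = 0"
    and e: "0 < e"
  shows "\<exists>\<epsilon>0>0. \<forall>\<epsilon> D. mollifier \<epsilon> D \<longrightarrow> \<epsilon> \<le> \<epsilon>0 \<longrightarrow>
     \<bar>(LINT x|leb n. F x * mol n D (\<lambda>_. 0) G x) - (LINT x|leb n. F x * G x)\<bar> \<le> e"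
proof -
  have Fi: "integrable (leb n) F"
    by (rule integrable_if_powr_integrable[OF F(1,2) compact_closed_box closed_box_subset_Rn F(3)]) (use pq in auto)
  have Gi: "integrable (leb n) G"
    by (rule integrable_if_powr_integrable[OF G(1,2) compact_closed_box closed_box_subset_Rn G(3)]) (use pq in auto)
  define IG where "IG = (LINT x|leb n. \<bar>G x\<bar> powr p)"
  have IG: "0 \<le> IG" by (simp add: IG_def)
  \<comment> \<open>The order of choices matters: l makes the term of G small, and only then k, for
    this l, makes the term of the truncation error small. Each pairing with \<open>S k\<close> is
    then at most e / 4, which leaves e / 2 for \<open>T k\<close>.\<close>
  have "((\<lambda>l. l powr (- p) * IG) \<longlongrightarrow> 0 * IG) at_top"
    using pq by (intro tendsto_mult tendsto_const tendsto_neg_powr) (auto simp: filterlim_ident)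
  then have "eventually (\<lambda>l. l powr (- p) * IG < e / 8) at_top"
    using e by (intro order_tendstoD) auto
  then have "eventually (\<lambda>l. l powr (- p) * IG < e / 8 \<and> 0 < l) at_top"
    using eventually_gt_at_top[of 0] by eventually_elim auto
  then obtain l where l: "l powr (- p) * IG < e / 8" "0 < l"
    using eventually_happens'[OF trivial_limit_at_top_linorder] by blast
  define T where "T = (\<lambda>k x. if \<bar>F x\<bar> \<le> real k then F x else 0)"
  have Tm: "T k \<in> borel_measurable (leb n)" for k
    unfolding T_def using F(1) by measurable
  define S where "S = (\<lambda>k x. F x - T k x)"
  have Sm: "S k \<in> borel_measurable (leb n)" for k
    unfolding S_def using F(1) Tm by measurable
  have Sle: "\<bar>S k x\<bar> powr q \<le> \<bar>F x\<bar> powr q" for k x by (auto simp: S_def T_def)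
  have Si: "integrable (leb n) (\<lambda>x. \<bar>S k x\<bar> powr q)" for k
    by (rule Bochner_Integration.integrable_bound[OF F(2)]) (use Sm Sle in auto)
  have "(\<lambda>k. LINT x|leb n. \<bar>S k x\<bar> powr q) \<longlonglongrightarrow> (LINT x|leb n. 0)"
  proof (rule integral_dominated_convergence[where w = "\<lambda>x. \<bar>F x\<bar> powr q"])
    show "AE x in leb n. (\<lambda>k. \<bar>S k x\<bar> powr q) \<longlonglongrightarrow> 0"
    proof (intro AE_I2 tendsto_eventually)
      fix x
      obtain k0 where k0: "\<bar>F x\<bar> \<le> real k0" using real_arch_simple by blast
      have "eventually (\<lambda>k. k0 \<le> k) sequentially" by (rule eventually_ge_at_top)
      then show "eventually (\<lambda>k. \<bar>S k x\<bar> powr q = 0) sequentially"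
        by eventually_elim (use k0 in \<open>auto simp: S_def T_def\<close>)
    qed
  qed (use Sm Sle F in auto)
  then have "(\<lambda>k. l powr q * (LINT x|leb n. \<bar>S k x\<bar> powr q)) \<longlonglongrightarrow> l powr q * 0"
    by (intro tendsto_mult tendsto_const) simp
  then have "eventually (\<lambda>k. l powr q * (LINT x|leb n. \<bar>S k x\<bar> powr q) < e / 8) sequentially"
    using e by (intro order_tendstoD) auto
  then obtain k where k: "l powr q * (LINT x|leb n. \<bar>S k x\<bar> powr q) < e / 8"
    using eventually_happens'[OF sequentially_bot] by blast
  have Tb: "\<bar>T k x\<bar> \<le> real k" for x by (auto simp: T_def)
  have T0: "T k x = 0" "S k x = 0" if "x \<notin> closed_box n c R" for x using F(3)[OF that] by (auto simp: T_def S_def)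
  have Ti: "integrable (leb n) (T k)"
    by (rule Bochner_Integration.integrable_bound[OF Fi]) (use Tm in \<open>auto simp: T_def\<close>)
  have Si': "integrable (leb n) (S k)" using Fi Ti by (simp add: S_def)
  have "0 < e / 2" using e by simp
  from mol_conv_bounded[OF Ti Tb T0(1) Gi G(3) this]
  obtain \<epsilon>0 where \<epsilon>0: "0 < \<epsilon>0" "\<forall>\<epsilon> D. mollifier \<epsilon> D \<longrightarrow> \<epsilon> \<le> \<epsilon>0 \<longrightarrow>
     \<bar>(LINT x|leb n. T k x * mol n D (\<lambda>_. 0) G x) - (LINT x|leb n. T k x * G x)\<bar> \<le> e / 2"
    by blast
  note Y = scaled_Young[OF pq l(2)]
  have SG: "integrable (leb n) (\<lambda>x. S k x * G x)" "\<bar>LINT x|leb n. S k x * G x\<bar> \<le> e / 4"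
  proof -
    have b: "integrable (leb n) (\<lambda>x. l powr q * \<bar>S k x\<bar> powr q + l powr (- p) * \<bar>G x\<bar> powr p)"
      using Si G by simp
    show i: "integrable (leb n) (\<lambda>x. S k x * G x)"
    proof (rule Bochner_Integration.integrable_bound[OF b])
      show "AE x in leb n. norm (S k x * G x) \<le> norm (l powr q * \<bar>S k x\<bar> powr q + l powr (- p) * \<bar>G x\<bar> powr p)"
        by (intro AE_I2) (metis Y abs_ge_self order.trans real_norm_def)
    qed (use Sm G in auto)
    have "\<bar>LINT x|leb n. S k x * G x\<bar> \<le> (LINT x|leb n. l powr q * \<bar>S k x\<bar> powr q + l powr (- p) * \<bar>G x\<bar> powr p)"
      by (rule order.trans[OF integral_abs_bound integral_mono]) (use i b Y in auto)
    also have "\<dots> = l powr q * (LINT x|leb n. \<bar>S k x\<bar> powr q) + l powr (- p) * IG"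
      using Si G by (simp add: IG_def)
    finally show "\<bar>LINT x|leb n. S k x * G x\<bar> \<le> e / 4" using k l by linarith
  qed
  have TG: "integrable (leb n) (\<lambda>x. T k x * G x)"
  proof (rule Bochner_Integration.integrable_bound[where f = "\<lambda>x. real k * G x"])
    show "AE x in leb n. norm (T k x * G x) \<le> norm (real k * G x)"
      using Tb by (intro AE_I2) (auto simp: abs_mult intro!: mult_right_mono)
  qed (use Gi Tm in auto)
  have "\<bar>(LINT x|leb n. F x * mol n D (\<lambda>_. 0) G x) - (LINT x|leb n. F x * G x)\<bar> \<le> e"
    if m: "mollifier \<epsilon> D" and small: "\<epsilon> \<le> \<epsilon>0" for \<epsilon> D
  proof -
    let ?m = "mol n D (\<lambda>_. 0)"
    have F_eq: "F x = T k x + S k x" for x by (simp add: S_def)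
    have 1: "(LINT x|leb n. F x * ?m G x) = (LINT x|leb n. T k x * ?m G x) + (LINT x|leb n. S k x * ?m G x)"
      unfolding F_eq distrib_right
      by (rule Bochner_Integration.integral_add[OF mol_Fubini(2)[OF m Ti Gi] mol_Fubini(2)[OF m Si' Gi]])
    have 2: "(LINT x|leb n. F x * G x) = (LINT x|leb n. T k x * G x) + (LINT x|leb n. S k x * G x)"
      unfolding F_eq distrib_right by (rule Bochner_Integration.integral_add[OF TG SG(1)])
    have "\<bar>LINT x|leb n. S k x * ?m G x\<bar> \<le> l powr q * (LINT x|leb n. \<bar>S k x\<bar> powr q) + l powr (- p) * IG"
      unfolding IG_def by (rule mol_Young[OF m Si' Si Gi G(2) T0(2) _ _ Y]) auto
    then have "\<bar>LINT x|leb n. S k x * ?m G x\<bar> \<le> e / 4" using k l by linarith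
    then show ?thesis using \<epsilon>0(2)[rule_format, OF m small] SG(2) e unfolding 1 2 by linarith
  qed
  with \<epsilon>0(1) show ?thesis by blast
qed

section \<open>Weak gradients\<close>

text \<open>Makes \<open>pd\<close> local: U is only relatively open, but changing a coordinate
  below n stays inside the carrier, so values outside U do not affect derivatives at points of
  U.\<close>

lemma eventually_upd_mem:
  assumes "openin (top_of_set (Rn n)) U" "x \<in> U" "i < n"
  shows "eventually (\<lambda>t. x(i := t) \<in> U) (nhds (x i))"
proof -
  obtain r where r: "0 < r" "closed_box n x r \<subseteq> U" using openin_Rn_closed_box[OF assms(1,2)] .
  have x: "x \<in> Rn n" using assms openin_Rn_subset by blast
  have "x(i := t) \<in> U" if "dist t (x i) < r" for t
    using that r x assms(3) by (intro subsetD[OF r(2)]) (auto simp: closed_box_def Rn_iff dist_real_def)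
  then show ?thesis unfolding eventually_nhds_metric using r(1) by blast
qed

lemma
  assumes "openin (top_of_set (Rn n)) U" "x \<in> U" "i < n" "\<And>y. y \<in> U \<Longrightarrow> f y = g y"
  shows pd_cong: "pd i f x = pd i g x"
    and upd_differentiable_cong: "(\<lambda>t. f (x(i := t))) differentiable (at (x i)) \<longleftrightarrow> (\<lambda>t. g (x(i := t))) differentiable (at (x i))"
proof -
  have ev: "eventually (\<lambda>t. f (x(i := t)) = g (x(i := t))) (nhds (x i))"
    using eventually_upd_mem[OF assms(1-3)] by eventually_elim (rule assms(4))
  show "pd i f x = pd i g x"
    unfolding pd_def using ev by (intro deriv_cong_ev) auto
  have "((\<lambda>t. f (x(i := t))) has_real_derivative D) (at (x i)) \<longleftrightarrow> ((\<lambda>t. g (x(i := t))) has_real_derivative D) (at (x i))" for D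
    using ev by (intro DERIV_cong_ev) auto
  then show "(\<lambda>t. f (x(i := t))) differentiable (at (x i)) \<longleftrightarrow> (\<lambda>t. g (x(i := t))) differentiable (at (x i))"
    unfolding real_differentiable_def by simp
qed

lemma Ck_cong:
  assumes "openin (top_of_set (Rn n)) U" "\<And>y. y \<in> U \<Longrightarrow> f y = g y"
  shows "Ck n k U f \<longleftrightarrow> Ck n k U g"
  using assms(2)
proof (induction k arbitrary: f g)
  case 0
  then show ?case by (auto cong: continuous_on_cong)
next
  case (Suc k)
  have "continuous_on U f \<longleftrightarrow> continuous_on U g"
    using Suc.prems by (auto cong: continuous_on_cong)
  moreover have "Ck n k U (pd i f) \<longleftrightarrow> Ck n k U (pd i g)" if i: "i < n" for i
  proof (rule Suc.IH)
    show "pd i f y = pd i g y" if "y \<in> U" for y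
      by (rule pd_cong[OF assms(1) that i Suc.prems])
  qed
  moreover have "(\<lambda>t. f (x(i := t))) differentiable (at (x i)) \<longleftrightarrow> (\<lambda>t. g (x(i := t))) differentiable (at (x i))"
    if "i < n" "x \<in> U" for i x
    by (rule upd_differentiable_cong[OF assms(1) that(2,1) Suc.prems])
  ultimately show ?case by simp
qed

lemma Ck_Suc_imp: "Ck n (Suc k) U f \<Longrightarrow> Ck n k U f"
  by (induction k arbitrary: f) auto

lemma pd_DERIV:
  "(\<lambda>t. f (x(i := t))) differentiable (at (x i)) \<Longrightarrow>
    ((\<lambda>t. f (x(i := t))) has_real_derivative pd i f x) (at (x i))"
  unfolding pd_def by (simp add: DERIV_deriv_iff_real_differentiable)

lemma pd_add:
  assumes "(\<lambda>t. f (x(i := t))) differentiable (at (x i))" "(\<lambda>t. g (x(i := t))) differentiable (at (x i))"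
  shows "pd i (\<lambda>x. f x + g x) x = pd i f x + pd i g x"
  using DERIV_imp_deriv[OF DERIV_add[OF pd_DERIV[of f, OF assms(1)] pd_DERIV[of g, OF assms(2)]]]
  by (simp add: pd_def)

lemma pd_mult:
  assumes "(\<lambda>t. f (x(i := t))) differentiable (at (x i))" "(\<lambda>t. g (x(i := t))) differentiable (at (x i))"
  shows "pd i (\<lambda>x. f x * g x) x = f x * pd i g x + pd i f x * g x"
  using DERIV_imp_deriv[OF DERIV_mult'[OF pd_DERIV[of f, OF assms(1)] pd_DERIV[of g, OF assms(2)]]]
  unfolding fun_upd_triv by (simp add: pd_def)

lemma Ck_add:
  assumes U: "openin (top_of_set (Rn n)) U"
  shows "Ck n k U f \<Longrightarrow> Ck n k U g \<Longrightarrow> Ck n k U (\<lambda>x. f x + g x)"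
proof (induction k arbitrary: f g)
  case (Suc k)
  have "Ck n k U (pd i (\<lambda>x. f x + g x))" if i: "i < n" for i
  proof -
    have "Ck n k U (\<lambda>x. pd i f x + pd i g x)" using Suc i by simp
    moreover have "pd i (\<lambda>x. f x + g x) x = pd i f x + pd i g x" if "x \<in> U" for x
      using Suc.prems i that by (intro pd_add) auto
    ultimately show ?thesis using Ck_cong[OF U, of "pd i (\<lambda>x. f x + g x)" "\<lambda>x. pd i f x + pd i g x"] by simp
  qed
  then show ?case using Suc.prems by (auto intro!: continuous_on_add differentiable_add)
qed (auto intro!: continuous_on_add)

text \<open>The product rule is available at points of U only; \<open>Ck_cong\<close> replaces the
  derivative of the product by the Leibniz expression, to which the induction hypothesis
  applies.\<close>

lemma Ck_mult:
  assumes U: "openin (top_of_set (Rn n)) U"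
  shows "Ck n k U f \<Longrightarrow> Ck n k U g \<Longrightarrow> Ck n k U (\<lambda>x. f x * g x)"
proof (induction k arbitrary: f g)
  case (Suc k)
  have "Ck n k U (pd i (\<lambda>x. f x * g x))" if i: "i < n" for i
  proof -
    have "Ck n k U (\<lambda>x. f x * pd i g x + pd i f x * g x)"
      using Suc.prems i by (intro Ck_add[OF U] Suc.IH Ck_Suc_imp[of n k U f] Ck_Suc_imp[of n k U g]) auto
    moreover have "pd i (\<lambda>x. f x * g x) x = f x * pd i g x + pd i f x * g x" if "x \<in> U" for x
      using Suc.prems i that by (intro pd_mult) auto
    ultimately show ?thesis
      using Ck_cong[OF U, of "pd i (\<lambda>x. f x * g x)" "\<lambda>x. f x * pd i g x + pd i f x * g x"] by simp
  qed
  then show ?case using Suc.prems by (auto intro!: continuous_on_mult differentiable_mult)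
qed (auto intro!: continuous_on_mult)

lemma compact_supportI:
  assumes "compact K" "K \<subseteq> U" "\<And>x. x \<in> U \<Longrightarrow> x \<notin> K \<Longrightarrow> f x = 0"
  shows "compact_support U f"
proof -
  have "{x \<in> U. f x \<noteq> 0} \<subseteq> K" using assms by blast
  then have "closure {x \<in> U. f x \<noteq> 0} \<subseteq> K" using assms(1) by (simp add: closure_minimal compact_imp_closed)
  moreover from this have "compact (closure {x \<in> U. f x \<noteq> 0})"
    using compact_Int_closed[OF assms(1) closed_closure[of "{x \<in> U. f x \<noteq> 0}"]] by (simp add: Int_absorb1)
  ultimately show ?thesis using assms(2) by (auto simp: compact_support_def)
qed

lemma compact_supportE:
  assumes "compact_support U f"
  obtains K where "compact K" "K \<subseteq> U" "\<And>x. x \<in> U \<Longrightarrow> x \<notin> K \<Longrightarrow> f x = 0"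
proof (rule that[of "closure {x \<in> U. f x \<noteq> 0}"])
  fix x assume "x \<in> U" "x \<notin> closure {x \<in> U. f x \<noteq> 0}"
  then show "f x = 0" using closure_subset[of "{x \<in> U. f x \<noteq> 0}"] by blast
qed (use assms in \<open>auto simp: compact_support_def\<close>)

lemma test_kern:
  assumes "mollifier \<epsilon> D" "x \<in> Rn n" "closed_box n x \<epsilon> \<subseteq> U" "U \<subseteq> Rn n"
  shows "Cc_infinity n U (\<lambda>z. kern n D (\<lambda>_. 0) z x)"
  unfolding Cc_infinity_def
proof
  show "compact_support U (\<lambda>z. kern n D (\<lambda>_. 0) z x)"
    by (rule compact_supportI[OF compact_closed_box assms(3)]) (use kern_0(2)[OF assms(1,2)] assms(4) in blast)
qed (use Ck_kern[OF assms(1)] in blast)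

section \<open>Compact exhaustion, the fundamental lemma and the product rule\<close>

lemma openin_sigma_compact:
  assumes U: "openin (top_of_set (Rn n)) U"
  obtains \<C> where "countable \<C>" "\<And>K. K \<in> \<C> \<Longrightarrow> compact K \<and> K \<subseteq> U" "U = \<Union> \<C>"
proof -
  have "\<forall>x\<in>U. \<exists>r>0. closed_box n x r \<subseteq> U" using openin_Rn_closed_box[OF U] by blast
  from bchoice[OF this] obtain r where r: "\<forall>x\<in>U. 0 < r x \<and> closed_box n x (r x) \<subseteq> U" by blast
  have "\<forall>x\<in>U. \<exists>T. open T \<and> open_box n x (r x) = Rn n \<inter> T"
    using openin_open_box by (simp add: openin_open)
  from bchoice[OF this] obtain T where T: "\<forall>x\<in>U. open (T x) \<and> open_box n x (r x) = Rn n \<inter> T x" by blast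
  have URn: "U \<subseteq> Rn n" using openin_Rn_subset[OF U] .
  obtain \<F> where F: "\<F> \<subseteq> T ` U" "countable \<F>" "\<Union> \<F> = \<Union> (T ` U)"
    using Lindelof[of "T ` U"] T by blast
  then obtain S where S: "S \<subseteq> U" "countable S" "\<F> = T ` S"
    using countable_subset_image[of \<F> T U] by blast
  show ?thesis
  proof (rule that[of "(\<lambda>x. closed_box n x (r x)) ` S"])
    show "countable ((\<lambda>x. closed_box n x (r x)) ` S)" using S by simp
    show "compact K \<and> K \<subseteq> U" if "K \<in> (\<lambda>x. closed_box n x (r x)) ` S" for K
      using that S r compact_closed_box by blast
    show "U = \<Union> ((\<lambda>x. closed_box n x (r x)) ` S)"
    proof
      show "\<Union> ((\<lambda>x. closed_box n x (r x)) ` S) \<subseteq> U" using S r by blast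
      show "U \<subseteq> \<Union> ((\<lambda>x. closed_box n x (r x)) ` S)"
      proof
        fix x assume x: "x \<in> U"
        then have "x \<in> open_box n x (r x)" using mem_open_box URn r by blast
        then have "x \<in> T x" using T x by blast
        then have "x \<in> \<Union> \<F>" using F(3) x by blast
        then obtain z where z: "z \<in> S" "x \<in> T z" using S by blast
        then have "x \<in> open_box n z (r z)" using T S URn x by blast
        then show "x \<in> \<Union> ((\<lambda>x. closed_box n x (r x)) ` S)" using open_box_subset_closed_box z by blast
      qed
    qed
  qed
qed

lemma AE_openin_compact:
  assumes U: "openin (top_of_set (Rn n)) U" and "\<And>K. compact K \<Longrightarrow> K \<subseteq> U \<Longrightarrow> AE x in leb n. x \<in> K \<longrightarrow> P x"
  shows "AE x in leb n. x \<in> U \<longrightarrow> P x"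
proof -
  obtain \<C> where C: "countable \<C>" "\<And>K. K \<in> \<C> \<Longrightarrow> compact K \<and> K \<subseteq> U" "U = \<Union> \<C>"
    by (rule openin_sigma_compact[OF U]) blast
  have "AE x in leb n. \<forall>K\<in>\<C>. x \<in> K \<longrightarrow> P x"
    unfolding AE_ball_countable[OF C(1)] using assms(2) C(2) by blast
  then show ?thesis by eventually_elim (use C(3) in blast)
qed

lemma integrable_indicator_L1loc:
  "L1loc n U g \<Longrightarrow> compact K \<Longrightarrow> K \<subseteq> U \<Longrightarrow> integrable (leb n) (\<lambda>x. indicator K x * g x)"
  by (simp add: L1loc_def set_integrable_def)

lemma set_integral_kern:
  assumes m: "mollifier \<epsilon> D" and x: "x \<in> Rn n" "closed_box n x \<epsilon> \<subseteq> K" "K \<subseteq> U" "U \<subseteq> Rn n"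
  shows "(LINT y:U|leb n. g y * kern n D \<alpha> x y) = mol n D \<alpha> (\<lambda>y. indicator K y * g y) x"
    "(LINT y:U|leb n. g y * kern n D \<alpha> y x) = (LINT y|leb n. indicator K y * g y * kern n D \<alpha> y x)"
proof -
  have *: "indicator U y * (g y * k y) = indicator K y * g y * k y"
    if "\<And>y. y \<in> Rn n \<Longrightarrow> y \<notin> closed_box n x \<epsilon> \<Longrightarrow> k y = (0::real)" for y k
    using that[of y] x by (auto simp: indicator_def)
  show "(LINT y:U|leb n. g y * kern n D \<alpha> x y) = mol n D \<alpha> (\<lambda>y. indicator K y * g y) x"
    unfolding set_lebesgue_integral_def mol_def real_scaleR_def
    by (intro Bochner_Integration.integral_cong refl *) (use kern_0(1)[OF m x(1)] in blast)
  show "(LINT y:U|leb n. g y * kern n D \<alpha> y x) = (LINT y|leb n. indicator K y * g y * kern n D \<alpha> y x)"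
    unfolding set_lebesgue_integral_def real_scaleR_def
    by (intro Bochner_Integration.integral_cong refl *) (use kern_0(2)[OF m x(1)] in blast)
qed

text \<open>The fundamental lemma of the calculus of variations, tested with mollifying kernels only.\<close>

lemma AE_zero_if_kern_orthogonal:
  assumes U: "openin (top_of_set (Rn n)) U" and g: "L1loc n U g"
    and z: "\<And>\<epsilon> D x. mollifier \<epsilon> D \<Longrightarrow> x \<in> U \<Longrightarrow> closed_box n x \<epsilon> \<subseteq> U \<Longrightarrow>
       (LINT y:U|leb n. g y * kern n D (\<lambda>_. 0) y x) = 0"
  shows "AE x in leb n. x \<in> U \<longrightarrow> g x = 0"
proof (rule AE_openin_compact[OF U])
  fix K assume K: "compact K" "K \<subseteq> U"
  have URn: "U \<subseteq> Rn n" using openin_Rn_subset[OF U] .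
  obtain \<epsilon>1 K' where K': "0 < \<epsilon>1" "compact K'" "K' \<subseteq> U" "K \<subseteq> K'" "\<And>x. x \<in> K \<Longrightarrow> closed_box n x \<epsilon>1 \<subseteq> K'"
    using compact_nbhd[OF U K] by blast
  obtain R where R: "0 < R" "K' \<subseteq> closed_box n (\<lambda>_. 0) R" using compact_subset_closed_box[OF K'(2)] K'(3) URn by blast
  define G where "G = (\<lambda>x. indicator K' x * g x)"
  \<comment> \<open>The sign of g on K: pairing F with G gives the integral of |g| over K, while its
    pairing with the mollified G vanishes by hypothesis.\<close>
  define F where "F = (\<lambda>x. indicator K x * sgn (G x))"
  have G: "integrable (leb n) G" unfolding G_def by (rule integrable_indicator_L1loc[OF g K'(2,3)])
  have Ks: "K \<in> sets (leb n)" using compact_sets_leb K URn by blast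
  have Fm: "F \<in> borel_measurable (leb n)"
    unfolding F_def using Ks G by (intro borel_measurable_times borel_measurable_sgn) auto
  have Fb: "\<bar>F x\<bar> \<le> 1" for x by (auto simp: F_def indicator_def sgn_if)
  have F: "integrable (leb n) F"
  proof (rule Bochner_Integration.integrable_bound[where f = "\<lambda>x. indicator K x"])
    show "integrable (leb n) (\<lambda>x. indicator K x :: real)"
      using set_integrable_continuous[of K n "\<lambda>_. 1"] K URn by (simp add: set_integrable_def)
    show "AE x in leb n. norm (F x) \<le> norm (indicator K x :: real)"
      by (intro AE_I2) (auto simp: F_def indicator_def sgn_if)
  qed (fact Fm)
  have F0: "F x = 0" and G0: "G x = 0" if "x \<notin> closed_box n (\<lambda>_. 0) R" for x
  proof -
    have "x \<notin> K'" "x \<notin> K" using that R(2) K'(4) by blast+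
    then show "F x = 0" "G x = 0" by (simp_all add: F_def G_def)
  qed
  have FG: "F x * G x = indicator K x * \<bar>g x\<bar>" for x
    using K' by (auto simp: F_def G_def indicator_def abs_sgn_eq sgn_if)
  have int: "integrable (leb n) (\<lambda>x. indicator K x * \<bar>g x\<bar>)"
    using integrable_abs[OF integrable_indicator_L1loc[OF g K]] by (simp add: abs_mult)
  have "(LINT x|leb n. indicator K x * \<bar>g x\<bar>) \<le> e" if e: "0 < e" for e
  proof -
    from mol_conv_bounded[OF F Fb F0 G G0 e]
    obtain \<epsilon>0 where e0: "0 < \<epsilon>0" "\<forall>\<epsilon> D. mollifier \<epsilon> D \<longrightarrow> \<epsilon> \<le> \<epsilon>0 \<longrightarrow>
       \<bar>(LINT x|leb n. F x * mol n D (\<lambda>_. 0) G x) - (LINT x|leb n. F x * G x)\<bar> \<le> e"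
      by blast
    define \<epsilon> where "\<epsilon> = min \<epsilon>0 \<epsilon>1"
    have "0 < \<epsilon>" using e0 K' by (simp add: \<epsilon>_def)
    then obtain D where m: "mollifier \<epsilon> D" using mollifier_exists by blast
    have "F x * mol n D (\<lambda>_. 0) G x = 0" for x
    proof (cases "x \<in> K")
      case True
      have "closed_box n x \<epsilon> \<subseteq> closed_box n x \<epsilon>1" by (auto simp: closed_box_def \<epsilon>_def)
      then have c: "closed_box n x \<epsilon> \<subseteq> K'" using K'(5)[OF True] by blast
      have x: "x \<in> U" "x \<in> Rn n" using True K URn by auto
      have "(LINT y:U|leb n. g y * kern n D (\<lambda>_. 0) y x) = 0"
        using z[OF m x(1)] c K'(3) by blast
      then have "(LINT y:U|leb n. g y * kern n D (\<lambda>_. 0) x y) = 0"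
        by (simp add: kern_sym[OF m, of n x])
      then have "mol n D (\<lambda>_. 0) G x = 0"
        unfolding G_def using set_integral_kern(1)[OF m x(2) c K'(3) URn] by simp
      then show ?thesis by simp
    qed (simp add: F_def)
    then have "(\<lambda>x. F x * mol n D (\<lambda>_. 0) G x) = (\<lambda>_. 0)" by blast
    then have "(LINT x|leb n. F x * mol n D (\<lambda>_. 0) G x) = 0" by (simp only: integral_zero)
    then have "\<bar>LINT x|leb n. F x * G x\<bar> \<le> e" using e0(2)[rule_format, OF m] by (simp add: \<epsilon>_def)
    then show ?thesis unfolding FG by linarith
  qed
  then have "(LINT x|leb n. indicator K x * \<bar>g x\<bar>) \<le> 0"
    using dense_ge[of 0 "LINT x|leb n. indicator K x * \<bar>g x\<bar>"] by blast
  moreover have "0 \<le> (LINT x|leb n. indicator K x * \<bar>g x\<bar>)" by (intro integral_nonneg_AE) auto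
  ultimately have "(LINT x|leb n. indicator K x * \<bar>g x\<bar>) = 0" by linarith
  then have "AE x in leb n. indicator K x * \<bar>g x\<bar> = 0"
    using int by (subst (asm) integral_nonneg_eq_0_iff_AE) auto
  then show "AE x in leb n. x \<in> K \<longrightarrow> g x = 0" by eventually_elim (auto simp: indicator_def)
qed

lemma openin_Diff_compact:
  assumes "openin (top_of_set (Rn n)) U" "compact K" "K \<subseteq> U"
  shows "openin (top_of_set (Rn n)) (U - K)"
proof -
  have "K \<subseteq> Rn n" using assms openin_Rn_subset by blast
  then have "closedin (top_of_set (Rn n)) K" using assms(2) by (intro closed_subset compact_imp_closed)
  then show ?thesis using assms(1) by (rule openin_diff[rotated])
qed

lemma pd_zero:
  assumes "openin (top_of_set (Rn n)) U" "x \<in> U" "i < n" "\<And>y. y \<in> U \<Longrightarrow> f y = 0"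
  shows "pd i f x = 0"
proof -
  have "pd i f x = pd i (\<lambda>_. 0) x" by (rule pd_cong[OF assms])
  then show ?thesis by (simp add: pd_def)
qed

lemma Cc_infinityE:
  assumes U: "openin (top_of_set (Rn n)) U" and \<phi>: "Cc_infinity n U \<phi>"
  obtains K where "compact K" "K \<subseteq> U" "\<And>x. x \<in> U - K \<Longrightarrow> \<phi> x = 0" "continuous_on U \<phi>"
    "\<And>i x. i < n \<Longrightarrow> x \<in> U - K \<Longrightarrow> pd i \<phi> x = 0" "\<And>i. i < n \<Longrightarrow> continuous_on U (pd i \<phi>)"
    "\<And>i x. i < n \<Longrightarrow> x \<in> U \<Longrightarrow> (\<lambda>t. \<phi> (x(i := t))) differentiable (at (x i))"
proof -
  have "compact_support U \<phi>" using \<phi> by (simp add: Cc_infinity_def)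
  then obtain K where K: "compact K" "K \<subseteq> U" "\<And>x. x \<in> U \<Longrightarrow> x \<notin> K \<Longrightarrow> \<phi> x = 0"
    by (rule compact_supportE) blast
  have "Ck n (Suc 0) U \<phi>" using \<phi> unfolding Cc_infinity_def by blast
  then have C1: "continuous_on U \<phi>" "\<And>i. i < n \<Longrightarrow> continuous_on U (pd i \<phi>)"
    "\<And>i x. i < n \<Longrightarrow> x \<in> U \<Longrightarrow> (\<lambda>t. \<phi> (x(i := t))) differentiable (at (x i))"
    by auto
  have "pd i \<phi> x = 0" if "i < n" "x \<in> U - K" for i x
    by (rule pd_zero[OF openin_Diff_compact[OF U K(1,2)] that(2,1)]) (use K(3) in blast)
  then show ?thesis by (intro that[OF K(1,2)]) (use K C1 in auto)
qed

lemma L1loc_continuous: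
  "continuous_on U f \<Longrightarrow> U \<subseteq> Rn n \<Longrightarrow> L1loc n U f"
  unfolding L1loc_def using set_integrable_continuous continuous_on_subset subset_trans by metis

lemma integrable_mult_bounded:
  fixes F G :: "(nat \<Rightarrow> real) \<Rightarrow> real"
  assumes "F \<in> borel_measurable (leb n)" "\<And>x. \<bar>F x\<bar> \<le> b" "integrable (leb n) G"
  shows "integrable (leb n) (\<lambda>x. F x * G x)"
proof (rule Bochner_Integration.integrable_bound[where f = "\<lambda>x. b * G x"])
  show "AE x in leb n. norm (F x * G x) \<le> norm (b * G x)"
  proof (intro AE_I2)
    fix x
    have "\<bar>F x\<bar> * \<bar>G x\<bar> \<le> \<bar>b\<bar> * \<bar>G x\<bar>"
      using assms(2)[of x] by (intro mult_right_mono) auto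
    then show "norm (F x * G x) \<le> norm (b * G x)" by (simp add: abs_mult)
  qed
qed (use assms in auto)

lemma indicator_continuous:
  fixes f :: "(nat \<Rightarrow> real) \<Rightarrow> real"
  assumes "compact K" "K \<subseteq> U" "continuous_on U f" "U \<subseteq> Rn n"
  obtains b where "integrable (leb n) (\<lambda>x. indicator K x * f x)" "\<And>x. \<bar>indicator K x * f x\<bar> \<le> b" "0 < b"
proof -
  have c: "continuous_on K f" using assms continuous_on_subset by blast
  obtain b where b: "0 < b" "\<And>x. x \<in> K \<Longrightarrow> \<bar>f x\<bar> \<le> b" using continuous_on_compact_bounded[OF assms(1) c] by blast
  show ?thesis
  proof
    show "integrable (leb n) (\<lambda>x. indicator K x * f x)"
      using set_integrable_continuous[OF assms(1) _ c, of n] assms by (simp add: set_integrable_def)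
    show "\<bar>indicator K x * f x\<bar> \<le> b" for x using b by (auto simp: indicator_def)
  qed (fact b)
qed

lemma L1loc_mult_continuous:
  assumes "continuous_on U f" "L1loc n U g" "U \<subseteq> Rn n"
  shows "L1loc n U (\<lambda>x. f x * g x)"
  unfolding L1loc_def
proof (intro allI impI)
  fix K assume K: "compact K \<and> K \<subseteq> U"
  obtain b where b: "integrable (leb n) (\<lambda>x. indicator K x * f x)" "\<And>x. \<bar>indicator K x * f x\<bar> \<le> b"
    by (rule indicator_continuous[OF _ _ assms(1,3), of K]) (use K in blast)+
  have g: "integrable (leb n) (\<lambda>x. indicator K x * g x)"
    using integrable_indicator_L1loc[OF assms(2)] K by blast
  have "integrable (leb n) (\<lambda>x. indicator K x * f x * (indicator K x * g x))"
    by (rule integrable_mult_bounded[OF _ b(2) g]) (use b in auto)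
  moreover have "indicator K x * f x * (indicator K x * g x) = indicator K x * (f x * g x)" for x
    by (auto simp: indicator_def)
  ultimately show "set_integrable (leb n) K (\<lambda>x. f x * g x)" by (simp add: set_integrable_def)
qed

lemma L1loc_add: "L1loc n U f \<Longrightarrow> L1loc n U g \<Longrightarrow> L1loc n U (\<lambda>x. f x + g x)"
  unfolding L1loc_def by (auto intro: set_integral_add)

lemma L1loc_cmult: "L1loc n U f \<Longrightarrow> L1loc n U (\<lambda>x. c * f x)"
  unfolding L1loc_def by (auto intro: set_integrable_mult_right)

lemma set_integral_support:
  fixes F G :: "(nat \<Rightarrow> real) \<Rightarrow> real"
  assumes "\<And>x. x \<in> U \<Longrightarrow> F x = G x" "\<And>x. x \<notin> U \<Longrightarrow> G x = 0"
  shows "(LINT x:U|leb n. F x) = (LINT x|leb n. G x)"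
  unfolding set_lebesgue_integral_def
  by (intro Bochner_Integration.integral_cong) (use assms in \<open>auto simp: indicator_def\<close>)

lemma is_weak_gradD:
  assumes "is_weak_grad n U f g"
  shows "L1loc n U f" "i < n \<Longrightarrow> L1loc n U (\<lambda>x. g x i)"
    "i < n \<Longrightarrow> Cc_infinity n U \<phi> \<Longrightarrow> (LINT x:U|leb n. f x * pd i \<phi> x) = - (LINT x:U|leb n. g x i * \<phi> x)"
  using assms by (auto simp: is_weak_grad_def)

text \<open>Mollification commutes with the weak derivative while the kernel cube stays in K: the
  derivative falls on the kernel, antisymmetry makes it a derivative of the test function
  \<open>\<lambda>z. kern n D (\<lambda>_. 0) z x\<close>, and the definition of the weak gradient
  applies.\<close>

lemma pd_mol_weak:
  assumes U: "openin (top_of_set (Rn n)) U" and w: "is_weak_grad n U h k" and m: "mollifier \<epsilon> D" and i: "i < n"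
    and x: "x \<in> Rn n" "closed_box n x \<epsilon> \<subseteq> K" and K: "compact K" "K \<subseteq> U"
  shows "pd i (mol n D (\<lambda>_. 0) (\<lambda>y. indicator K y * h y)) x = mol n D (\<lambda>_. 0) (\<lambda>y. indicator K y * k y i) x"
proof -
  have URn: "U \<subseteq> Rn n" using openin_Rn_subset[OF U] .
  have int: "integrable (leb n) (\<lambda>y. indicator K y * h y)"
    by (rule integrable_indicator_L1loc[OF is_weak_gradD(1)[OF w] K])
  have t: "Cc_infinity n U (\<lambda>z. kern n D (\<lambda>_. 0) z x)"
    using test_kern[OF m x(1) _ URn] x(2) K(2) by blast
  have "pd i (mol n D (\<lambda>_. 0) (\<lambda>y. indicator K y * h y)) x
     = mol n D ((\<lambda>_. 0)(i := Suc 0)) (\<lambda>y. indicator K y * h y) x"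
    by (simp add: pd_mol[OF m i int])
  also have "\<dots> = (LINT y:U|leb n. h y * kern n D ((\<lambda>_. 0)(i := Suc 0)) x y)"
    by (rule set_integral_kern(1)[OF m x K(2) URn, symmetric])
  also have "\<dots> = - (LINT y:U|leb n. h y * pd i (\<lambda>z. kern n D (\<lambda>_. 0) z x) y)"
    by (simp add: kern_antisym[OF m i, of x] pd_kern[OF m i] set_lebesgue_integral_def)
  also have "\<dots> = (LINT y:U|leb n. k y i * kern n D (\<lambda>_. 0) y x)"
    by (simp add: is_weak_gradD(3)[OF w i t])
  also have "\<dots> = (LINT y:U|leb n. k y i * kern n D (\<lambda>_. 0) x y)"
    by (simp add: kern_sym[OF m, of n x])
  also have "\<dots> = mol n D (\<lambda>_. 0) (\<lambda>y. indicator K y * k y i) x"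
    by (rule set_integral_kern(1)[OF m x K(2) URn])
  finally show ?thesis .
qed

text \<open>Only one factor has to be mollified: \<open>h\<^sub>\<epsilon> \<phi>\<close> is an admissible test function for the weak gradient of \<open>f\<close>.\<close>

lemma weak_grad_mult:
  assumes U: "openin (top_of_set (Rn n)) U" and wf: "is_weak_grad n U f g" and wh: "is_weak_grad n U h k"
    and cf: "continuous_on U f" and ch: "continuous_on U h"
  shows "is_weak_grad n U (\<lambda>x. f x * h x) (\<lambda>x i. f x * k x i + h x * g x i)"
  unfolding is_weak_grad_def
proof (intro conjI allI impI)
  have URn: "U \<subseteq> Rn n" using openin_Rn_subset[OF U] .
  show "L1loc n U (\<lambda>x. f x * h x)"
    by (intro L1loc_continuous[OF _ URn] continuous_on_mult cf ch)
  fix i assume i: "i < n"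
  show "L1loc n U (\<lambda>x. f x * k x i + h x * g x i)"
    by (intro L1loc_add L1loc_mult_continuous[OF _ _ URn] cf ch is_weak_gradD(2)[OF wf i] is_weak_gradD(2)[OF wh i])
  fix \<phi> assume \<phi>: "Cc_infinity n U \<phi>"
  obtain K where K: "compact K" "K \<subseteq> U" "\<And>x. x \<in> U - K \<Longrightarrow> \<phi> x = 0" and c\<phi>: "continuous_on U \<phi>"
    and pd0: "\<And>i x. i < n \<Longrightarrow> x \<in> U - K \<Longrightarrow> pd i \<phi> x = 0" and cpd: "\<And>i. i < n \<Longrightarrow> continuous_on U (pd i \<phi>)"
    and d\<phi>: "\<And>i x. i < n \<Longrightarrow> x \<in> U \<Longrightarrow> (\<lambda>t. \<phi> (x(i := t))) differentiable (at (x i))"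
    by (rule Cc_infinityE[OF U \<phi>]) blast
  obtain \<epsilon>1 K' where K': "0 < \<epsilon>1" "compact K'" "K' \<subseteq> U" "K \<subseteq> K'" "\<And>x. x \<in> K \<Longrightarrow> closed_box n x \<epsilon>1 \<subseteq> K'"
    using compact_nbhd[OF U K(1,2)] by blast
  obtain R where R: "0 < R" "K' \<subseteq> closed_box n (\<lambda>_. 0) R" using compact_subset_closed_box[OF K'(2)] K'(3) URn by blast
  \<comment> \<open>\<open>A\<close>, \<open>B\<close> and \<open>G\<close> are cut off to the
    support K of the test function, \<open>H\<close> and \<open>L\<close> to the larger K', so that
    mollifications at points of K read the true values of h and of its gradient.\<close>
  define A where "A = (\<lambda>x. indicator K x * (f x * pd i \<phi> x))"
  define B where "B = (\<lambda>x. indicator K x * (f x * \<phi> x))"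
  define H where "H = (\<lambda>x. indicator K' x * h x)"
  define L where "L = (\<lambda>x. indicator K' x * k x i)"
  define G where "G = (\<lambda>x. indicator K x * (\<phi> x * g x i))"
  have KU: "x \<in> U" if "x \<in> K" for x using that K by blast
  obtain a where A: "integrable (leb n) A" "\<And>x. \<bar>A x\<bar> \<le> a"
    unfolding A_def by (rule indicator_continuous[OF K(1,2) continuous_on_mult[OF cf cpd[OF i]] URn]) blast
  obtain b where B: "integrable (leb n) B" "\<And>x. \<bar>B x\<bar> \<le> b"
    unfolding B_def by (rule indicator_continuous[OF K(1,2) continuous_on_mult[OF cf c\<phi>] URn]) blast
  obtain c where H: "integrable (leb n) H" "\<And>x. \<bar>H x\<bar> \<le> c"
    unfolding H_def by (rule indicator_continuous[OF K'(2,3) ch URn]) blast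
  have L: "integrable (leb n) L" unfolding L_def
    by (rule integrable_indicator_L1loc[OF is_weak_gradD(2)[OF wh i] K'(2,3)])
  have G: "integrable (leb n) G" unfolding G_def
    by (rule integrable_indicator_L1loc[OF L1loc_mult_continuous[OF c\<phi> is_weak_gradD(2)[OF wf i] URn] K(1,2)])
  have z: "A x = 0" "B x = 0" "H x = 0" "L x = 0" "G x = 0" if "x \<notin> closed_box n (\<lambda>_. 0) R" for x
  proof -
    have "x \<notin> K'" "x \<notin> K" using that R(2) K'(4) by blast+
    then show "A x = 0" "B x = 0" "H x = 0" "L x = 0" "G x = 0" by (simp_all add: A_def B_def H_def L_def G_def)
  qed
  let ?I = "\<lambda>F G. LINT x|leb n. F x * G x"
  have id: "?I A (mol n D (\<lambda>_. 0) H) + ?I B (mol n D (\<lambda>_. 0) L) + ?I H (mol n D (\<lambda>_. 0) G) = 0"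
    if m: "mollifier \<epsilon> D" and small: "\<epsilon> \<le> \<epsilon>1" for \<epsilon> D
  proof -
    let ?m = "mol n D (\<lambda>_. 0)"
    have pdH: "pd i (?m H) x = ?m L x" if x: "x \<in> K" for x
    proof -
      have "closed_box n x \<epsilon> \<subseteq> closed_box n x \<epsilon>1" using small by (auto simp: closed_box_def)
      then have "closed_box n x \<epsilon> \<subseteq> K'" using K'(5)[OF x] by blast
      then show ?thesis unfolding H_def L_def
        using pd_mol_weak[OF U wh m i _ _ K'(2,3), of x] KU[OF x] URn by blast
    qed
    have CkH: "Ck n k U (?m H)" for k by (rule Ck_mol[OF m H(1)])
    have test: "Cc_infinity n U (\<lambda>x. ?m H x * \<phi> x)"
      unfolding Cc_infinity_def
    proof
      show "\<forall>k. Ck n k U (\<lambda>x. ?m H x * \<phi> x)"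
        using \<phi> CkH Ck_mult[OF U] unfolding Cc_infinity_def by blast
      show "compact_support U (\<lambda>x. ?m H x * \<phi> x)"
        by (rule compact_supportI[OF K(1,2)]) (use K(3) in auto)
    qed
    have dH: "(\<lambda>t. ?m H (x(i := t))) differentiable (at (x i))" for x
      using mol_deriv[OF m i H(1)] by (auto simp: real_differentiable_def)
    have pdm: "pd i (\<lambda>x. ?m H x * \<phi> x) x = ?m H x * pd i \<phi> x + pd i (?m H) x * \<phi> x" if "x \<in> U" for x
      by (rule pd_mult[OF dH d\<phi>[OF i that]])
    have "(LINT x:U|leb n. f x * pd i (\<lambda>x. ?m H x * \<phi> x) x) = (LINT x|leb n. A x * ?m H x + B x * ?m L x)"
    proof (rule set_integral_support)
      fix x
      show "f x * pd i (\<lambda>x. ?m H x * \<phi> x) x = A x * ?m H x + B x * ?m L x" if "x \<in> U"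
        unfolding pdm[OF that] using that K(3)[of x] pd0[OF i, of x] pdH[of x]
        by (cases "x \<in> K") (simp_all add: A_def B_def algebra_simps)
      show "A x * ?m H x + B x * ?m L x = 0" if "x \<notin> U"
      proof -
        have "x \<notin> K" using that KU by blast
        then show ?thesis by (simp add: A_def B_def)
      qed
    qed
    also have "\<dots> = ?I A (?m H) + ?I B (?m L)"
      by (rule Bochner_Integration.integral_add[OF mol_Fubini(2)[OF m A(1) H(1)] mol_Fubini(2)[OF m B(1) L]])
    finally have 1: "(LINT x:U|leb n. f x * pd i (\<lambda>x. ?m H x * \<phi> x) x) = ?I A (?m H) + ?I B (?m L)" .
    have "(LINT x:U|leb n. g x i * (?m H x * \<phi> x)) = ?I G (?m H)"
    proof (rule set_integral_support)
      fix x
      show "g x i * (?m H x * \<phi> x) = G x * ?m H x" if "x \<in> U"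
        using that K(3)[of x] by (cases "x \<in> K") (simp_all add: G_def)
      show "G x * ?m H x = 0" if "x \<notin> U"
      proof -
        have "x \<notin> K" using that KU by blast
        then show ?thesis by (simp add: G_def)
      qed
    qed
    \<comment> \<open>Exchanged because the limit theorem asks for the bounded function in first
      place, and \<open>G\<close> is only integrable.\<close>
    also have "\<dots> = ?I H (?m G)" by (rule mol_Fubini(1)[OF m G H(1)])
    finally show ?thesis using 1 is_weak_gradD(3)[OF wf i test] by linarith
  qed
  have "\<bar>?I A H + ?I B L + ?I H G\<bar> \<le> e" if e: "0 < e" for e
  proof -
    have e3: "0 < e / 3" using e by simp
    let ?P = "\<lambda>F G e0. \<forall>\<epsilon> D. mollifier \<epsilon> D \<longrightarrow> \<epsilon> \<le> e0 \<longrightarrow> \<bar>?I F (mol n D (\<lambda>_. 0) G) - ?I F G\<bar> \<le> e / 3"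
    have "\<exists>e0>0. ?P A H e0" by (rule mol_conv_bounded[OF A z(1) H(1) z(3) e3])
    then obtain e1 where e1: "0 < e1" "?P A H e1" by blast
    have "\<exists>e0>0. ?P B L e0" by (rule mol_conv_bounded[OF B z(2) L z(4) e3])
    then obtain e2 where e2: "0 < e2" "?P B L e2" by blast
    have "\<exists>e0>0. ?P H G e0" by (rule mol_conv_bounded[OF H z(3) G z(5) e3])
    then obtain e4 where e4: "0 < e4" "?P H G e4" by blast
    define \<epsilon> where "\<epsilon> = min (min e1 e2) (min e4 \<epsilon>1)"
    have "0 < \<epsilon>" using e1(1) e2(1) e4(1) K'(1) by (simp add: \<epsilon>_def)
    then obtain D where m: "mollifier \<epsilon> D" using mollifier_exists by blast
    have "\<epsilon> \<le> e1" "\<epsilon> \<le> e2" "\<epsilon> \<le> e4" "\<epsilon> \<le> \<epsilon>1" by (auto simp: \<epsilon>_def)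
    from e1(2)[rule_format, OF m this(1)] e2(2)[rule_format, OF m this(2)] e4(2)[rule_format, OF m this(3)]
      id[OF m this(4)]
    show ?thesis by linarith
  qed
  then have "\<bar>?I A H + ?I B L + ?I H G\<bar> \<le> 0" using dense_ge[of 0 "\<bar>?I A H + ?I B L + ?I H G\<bar>"] by blast
  then have sum0: "?I A H + ?I B L + ?I H G = 0" by linarith
  have 1: "(LINT x:U|leb n. f x * h x * pd i \<phi> x) = ?I A H"
  proof (rule set_integral_support)
    fix x
    show "f x * h x * pd i \<phi> x = A x * H x" if "x \<in> U"
      using that pd0[OF i, of x] K'(4) by (cases "x \<in> K") (auto simp: A_def H_def)
    show "A x * H x = 0" if "x \<notin> U" using that KU[of x] by (auto simp: A_def indicator_def)
  qed
  have "(LINT x:U|leb n. (f x * k x i + h x * g x i) * \<phi> x) = (LINT x|leb n. B x * L x + H x * G x)"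
  proof (rule set_integral_support)
    fix x
    show "(f x * k x i + h x * g x i) * \<phi> x = B x * L x + H x * G x" if "x \<in> U"
    proof (cases "x \<in> K")
      case True
      then have "x \<in> K'" using K'(4) by blast
      then show ?thesis using True by (simp add: B_def L_def H_def G_def algebra_simps)
    qed (use that K(3)[of x] in \<open>simp add: B_def G_def\<close>)
    show "B x * L x + H x * G x = 0" if "x \<notin> U" using that KU[of x] by (auto simp: B_def G_def indicator_def)
  qed
  also have "\<dots> = ?I B L + ?I H G"
    by (rule Bochner_Integration.integral_add[OF integrable_mult_bounded[OF _ B(2) L] integrable_mult_bounded[OF _ H(2) G]])
      (use B H in auto)
  finally show "(LINT x:U|leb n. f x * h x * pd i \<phi> x) = - (LINT x:U|leb n. (f x * k x i + h x * g x i) * \<phi> x)"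
    using 1 sum0 by linarith
qed

lemma set_integrable_test:
  assumes "L1loc n U g" "continuous_on U \<phi>" "compact K" "K \<subseteq> U" "\<And>x. x \<in> U - K \<Longrightarrow> \<phi> x = 0" "U \<subseteq> Rn n"
  shows "set_integrable (leb n) U (\<lambda>x. g x * \<phi> x)"
proof -
  have "integrable (leb n) (\<lambda>x. indicator K x * (\<phi> x * g x))"
    by (rule integrable_indicator_L1loc[OF L1loc_mult_continuous[OF assms(2,1,6)] assms(3,4)])
  moreover have "indicator U x *\<^sub>R (g x * \<phi> x) = indicator K x * (\<phi> x * g x)" for x
    using assms(4,5) by (cases "x \<in> U"; cases "x \<in> K") auto
  ultimately show ?thesis unfolding set_integrable_def by (simp only:)
qed

lemma weak_grad_lin:
  assumes U: "openin (top_of_set (Rn n)) U" and wf: "is_weak_grad n U f g" and wh: "is_weak_grad n U h k"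
  shows "is_weak_grad n U (\<lambda>x. a * f x + b * h x) (\<lambda>x i. a * g x i + b * k x i)"
  unfolding is_weak_grad_def
proof (intro conjI allI impI)
  have URn: "U \<subseteq> Rn n" using openin_Rn_subset[OF U] .
  note wf' = is_weak_gradD[OF wf] and wh' = is_weak_gradD[OF wh]
  show "L1loc n U (\<lambda>x. a * f x + b * h x)" by (intro L1loc_add L1loc_cmult wf' wh')
  fix i assume i: "i < n"
  show "L1loc n U (\<lambda>x. a * g x i + b * k x i)" by (intro L1loc_add L1loc_cmult wf' wh' i)
  fix \<phi> assume \<phi>: "Cc_infinity n U \<phi>"
  obtain K where K: "compact K" "K \<subseteq> U" "\<And>x. x \<in> U - K \<Longrightarrow> \<phi> x = 0" and c\<phi>: "continuous_on U \<phi>"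
    and pd0: "\<And>i x. i < n \<Longrightarrow> x \<in> U - K \<Longrightarrow> pd i \<phi> x = 0" and cpd: "\<And>i. i < n \<Longrightarrow> continuous_on U (pd i \<phi>)"
    by (rule Cc_infinityE[OF U \<phi>]) blast
  have i1: "set_integrable (leb n) U (\<lambda>x. f x * pd i \<phi> x)" "set_integrable (leb n) U (\<lambda>x. h x * pd i \<phi> x)"
    by (intro set_integrable_test[OF _ cpd[OF i] K(1,2) pd0[OF i] URn] wf'(1) wh'(1); simp)+
  have i2: "set_integrable (leb n) U (\<lambda>x. g x i * \<phi> x)" "set_integrable (leb n) U (\<lambda>x. k x i * \<phi> x)"
    by (intro set_integrable_test[OF _ c\<phi> K(1,2) K(3) URn] wf'(2)[OF i] wh'(2)[OF i]; simp)+
  have "(LINT x:U|leb n. (a * f x + b * h x) * pd i \<phi> x) =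
     (LINT x:U|leb n. a * (f x * pd i \<phi> x) + b * (h x * pd i \<phi> x))" by (simp add: distrib_right mult.assoc)
  also have "\<dots> = a * (LINT x:U|leb n. f x * pd i \<phi> x) + b * (LINT x:U|leb n. h x * pd i \<phi> x)"
    using i1 by (simp add: set_integral_add)
  also have "\<dots> = - (a * (LINT x:U|leb n. g x i * \<phi> x) + b * (LINT x:U|leb n. k x i * \<phi> x))"
    using wf'(3)[OF i \<phi>] wh'(3)[OF i \<phi>] by simp
  also have "a * (LINT x:U|leb n. g x i * \<phi> x) + b * (LINT x:U|leb n. k x i * \<phi> x) =
     (LINT x:U|leb n. a * (g x i * \<phi> x) + b * (k x i * \<phi> x))"
    using i2 by (simp add: set_integral_add)
  also have "\<dots> = (LINT x:U|leb n. (a * g x i + b * k x i) * \<phi> x)" by (simp add: distrib_right mult.assoc)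
  finally show "(LINT x:U|leb n. (a * f x + b * h x) * pd i \<phi> x) = - (LINT x:U|leb n. (a * g x i + b * k x i) * \<phi> x)" .
qed

lemma L1loc_subset: "L1loc n U f \<Longrightarrow> V \<subseteq> U \<Longrightarrow> L1loc n V f"
  unfolding L1loc_def by blast

text \<open>Kernels supported in V are test functions on U whose derivatives live in V, where f
  vanishes, so g is orthogonal to all of them. Uniqueness of weak gradients and their vanishing off
  a support both follow from this.\<close>

lemma weak_grad_zero:
  assumes U: "openin (top_of_set (Rn n)) U" and w: "is_weak_grad n U f g"
    and V: "openin (top_of_set (Rn n)) V" "V \<subseteq> U" and f: "\<And>x. x \<in> V \<Longrightarrow> f x = 0" and i: "i < n"
  shows "AE x in leb n. x \<in> V \<longrightarrow> g x i = 0"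
proof (rule AE_zero_if_kern_orthogonal[OF V(1) L1loc_subset[OF is_weak_gradD(2)[OF w i] V(2)]])
  fix \<epsilon> D x assume m: "mollifier \<epsilon> D" and xV: "x \<in> V" and c: "closed_box n x \<epsilon> \<subseteq> V"
  have URn: "U \<subseteq> Rn n" "V \<subseteq> Rn n" using openin_Rn_subset U V(1) by auto
  have x: "x \<in> Rn n" using xV URn by blast
  have cU: "closed_box n x \<epsilon> \<subseteq> U" using c V(2) by blast
  have t: "Cc_infinity n U (\<lambda>z. kern n D (\<lambda>_. 0) z x)" by (rule test_kern[OF m x cU URn(1)])
  have "(LINT y:V|leb n. g y i * kern n D (\<lambda>_. 0) y x) = (LINT y:U|leb n. g y i * kern n D (\<lambda>_. 0) y x)"
    using set_integral_kern(2)[OF m x order.refl c URn(2), of "\<lambda>y. g y i" "\<lambda>_. 0"]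
      set_integral_kern(2)[OF m x order.refl cU URn(1), of "\<lambda>y. g y i" "\<lambda>_. 0"] by simp
  also have "\<dots> = - (LINT y:U|leb n. f y * pd i (\<lambda>z. kern n D (\<lambda>_. 0) z x) y)"
    by (simp add: is_weak_gradD(3)[OF w i t])
  also have "(LINT y:U|leb n. f y * pd i (\<lambda>z. kern n D (\<lambda>_. 0) z x) y) = (LINT y|leb n. 0)"
  proof (rule set_integral_support)
    fix y assume y: "y \<in> U"
    show "f y * pd i (\<lambda>z. kern n D (\<lambda>_. 0) z x) y = 0"
    proof (cases "y \<in> closed_box n x \<epsilon>")
      case True
      then have "f y = 0" using c f by blast
      then show ?thesis by simp
    next
      case False
      have "y \<in> Rn n" using y URn by blast
      then show ?thesis by (simp add: pd_kern[OF m i] kern_0(2)[OF m x False])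
    qed
  qed simp
  finally show "(LINT y:V|leb n. g y i * kern n D (\<lambda>_. 0) y x) = 0" by simp
qed

lemma weak_grad_unique:
  assumes U: "openin (top_of_set (Rn n)) U" and w: "is_weak_grad n U f g" "is_weak_grad n U f g'" and i: "i < n"
  shows "AE x in leb n. x \<in> U \<longrightarrow> g x i = g' x i"
proof -
  have "is_weak_grad n U (\<lambda>x. 1 * f x + (- 1) * f x) (\<lambda>x i. 1 * g x i + (- 1) * g' x i)"
    by (rule weak_grad_lin[OF U w])
  from weak_grad_zero[OF U this U _ _ i] show ?thesis by simp
qed

lemma weak_grad_wgrad: "is_weak_grad n U f g \<Longrightarrow> is_weak_grad n U f (wgrad n U f)"
  unfolding wgrad_def by (rule someI[of "is_weak_grad n U f"])

section \<open>The chain rule for real powers\<close>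

lemma weak_grad_power:
  assumes U: "openin (top_of_set (Rn n)) U" and wf: "is_weak_grad n U f g" and cf: "continuous_on U f"
  shows "is_weak_grad n U (\<lambda>x. f x ^ Suc k) (\<lambda>x i. real (Suc k) * f x ^ k * g x i)"
proof (induction k)
  case 0
  then show ?case using wf by simp
next
  case (Suc k)
  have "is_weak_grad n U (\<lambda>x. f x * f x ^ Suc k) (\<lambda>x i. f x * (real (Suc k) * f x ^ k * g x i) + f x ^ Suc k * g x i)"
    by (rule weak_grad_mult[OF U wf Suc.IH cf]) (intro continuous_intros cf)
  moreover have "f x * (real (Suc k) * f x ^ k * g x i) + f x ^ Suc k * g x i = real (Suc (Suc k)) * f x ^ Suc k * g x i" for x i
    by (simp add: algebra_simps)
  ultimately show ?case by simp
qed

text \<open>Indexed by the coefficients of the derivative: the composed polynomial is its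
  antiderivative without constant term, which is what approximating the derivative first
  provides.\<close>

lemma weak_grad_poly:
  assumes U: "openin (top_of_set (Rn n)) U" and wf: "is_weak_grad n U f g" and cf: "continuous_on U f"
  shows "is_weak_grad n U (\<lambda>x. \<Sum>j\<le>d. c j / real (Suc j) * f x ^ Suc j) (\<lambda>x i. (\<Sum>j\<le>d. c j * f x ^ j) * g x i)"
proof (induction d)
  case 0
  have "is_weak_grad n U (\<lambda>x. c 0 * f x + 0 * f x) (\<lambda>x i. c 0 * g x i + 0 * g x i)"
    by (rule weak_grad_lin[OF U wf wf])
  then show ?case by simp
next
  case (Suc d)
  have "is_weak_grad n U (\<lambda>x. 1 * (\<Sum>j\<le>d. c j / real (Suc j) * f x ^ Suc j) + c (Suc d) / real (Suc (Suc d)) * f x ^ Suc (Suc d))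
     (\<lambda>x i. 1 * ((\<Sum>j\<le>d. c j * f x ^ j) * g x i) + c (Suc d) / real (Suc (Suc d)) * (real (Suc (Suc d)) * f x ^ Suc d * g x i))"
    by (rule weak_grad_lin[OF U Suc.IH weak_grad_power[OF U wf cf]])
  moreover have "1 * ((\<Sum>j\<le>d. c j * f x ^ j) * g x i) + c (Suc d) / real (Suc (Suc d)) * (real (Suc (Suc d)) * f x ^ Suc d * g x i)
     = (\<Sum>j\<le>Suc d. c j * f x ^ j) * g x i" for x i
    by (simp add: distrib_right del: of_nat_Suc)
  moreover have "1 * (\<Sum>j\<le>d. c j / real (Suc j) * f x ^ Suc j) + c (Suc d) / real (Suc (Suc d)) * f x ^ Suc (Suc d)
     = (\<Sum>j\<le>Suc d. c j / real (Suc j) * f x ^ Suc j)" for x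
    by (simp only: sum.atMost_Suc mult_1)
  ultimately show ?case by (simp only:)
qed

lemma set_integral_diff_bound:
  fixes F G \<psi> :: "(nat \<Rightarrow> real) \<Rightarrow> real"
  assumes "set_integrable (leb n) U (\<lambda>x. F x * \<psi> x)" "set_integrable (leb n) U (\<lambda>x. G x * \<psi> x)" "set_integrable (leb n) U \<psi>"
    and "\<And>x. x \<in> U \<Longrightarrow> \<psi> x \<noteq> 0 \<Longrightarrow> \<bar>F x - G x\<bar> \<le> e"
  shows "\<bar>(LINT x:U|leb n. F x * \<psi> x) - (LINT x:U|leb n. G x * \<psi> x)\<bar> \<le> e * (LINT x:U|leb n. \<bar>\<psi> x\<bar>)"
proof -
  have "(LINT x:U|leb n. F x * \<psi> x) - (LINT x:U|leb n. G x * \<psi> x) = (LINT x|leb n. indicator U x * (F x * \<psi> x) - indicator U x * (G x * \<psi> x))"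
    using assms(1,2) unfolding set_lebesgue_integral_def set_integrable_def by simp
  moreover have "\<bar>LINT x|leb n. indicator U x * (F x * \<psi> x) - indicator U x * (G x * \<psi> x)\<bar> \<le> (LINT x|leb n. e * \<bar>indicator U x * \<psi> x\<bar>)"
  proof (rule order.trans[OF integral_abs_bound integral_mono])
    fix x
    show "\<bar>indicator U x * (F x * \<psi> x) - indicator U x * (G x * \<psi> x)\<bar> \<le> e * \<bar>indicator U x * \<psi> x\<bar>"
    proof (cases "x \<in> U \<and> \<psi> x \<noteq> 0")
      case True
      have "F x * \<psi> x - G x * \<psi> x = (F x - G x) * \<psi> x" by (simp add: algebra_simps)
      then show ?thesis using True assms(4)[of x] by (simp add: abs_mult mult_right_mono)
    qed auto
  qed (use assms(1-3) in \<open>auto simp: set_integrable_def\<close>)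
  moreover have "(LINT x|leb n. e * \<bar>indicator U x * \<psi> x\<bar>) = e * (LINT x:U|leb n. \<bar>\<psi> x\<bar>)"
    by (simp add: set_lebesgue_integral_def abs_mult)
  ultimately show ?thesis by linarith
qed

text \<open>Weierstrass is applied to the derivative, continuous on [0, b] because p > 1. By the
  mean value theorem the antiderivative vanishing at 0 then approximates the power itself. Only
  interior points are differentiated, which avoids the endpoint 0.\<close>

lemma powr_poly_approx:
  fixes p b e :: real
  assumes "1 < p" "0 < b" "0 < e"
  obtains c d where "\<And>t. 0 \<le> t \<Longrightarrow> t \<le> b \<Longrightarrow> \<bar>p * t powr (p - 1) - (\<Sum>j\<le>d. c j * t ^ j)\<bar> \<le> e"
    "\<And>t. 0 \<le> t \<Longrightarrow> t \<le> b \<Longrightarrow> \<bar>t powr p - (\<Sum>j\<le>d. c j / real (Suc j) * t ^ Suc j)\<bar> \<le> e * b"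
proof -
  have "continuous_on {0..b} (\<lambda>t. p * t powr (p - 1))"
    using assms by (intro continuous_intros continuous_on_powr') auto
  then obtain q where q: "real_polynomial_function q" "\<And>t. t \<in> {0..b} \<Longrightarrow> \<bar>p * t powr (p - 1) - q t\<bar> < e"
    using Stone_Weierstrass_real_polynomial_function[of "{0..b}" "\<lambda>t. p * t powr (p - 1)" e] assms by auto
  then obtain c d where cd: "q = (\<lambda>t. \<Sum>j\<le>d. c j * t ^ j)"
    using real_polynomial_function_iff_sum by blast
  have 1: "\<bar>p * t powr (p - 1) - (\<Sum>j\<le>d. c j * t ^ j)\<bar> \<le> e" if "0 \<le> t" "t \<le> b" for t
    using q(2)[of t] that by (simp add: cd)
  define P where "P = (\<lambda>t. t powr p - (\<Sum>j\<le>d. c j / real (Suc j) * t ^ Suc j))"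
  have "\<bar>P t\<bar> \<le> e * b" if t: "0 \<le> t" "t \<le> b" for t
  proof (cases "t = 0")
    case False
    have dP: "(P has_real_derivative (p * z powr (p - 1) - (\<Sum>j\<le>d. c j * z ^ j))) (at z)" if "0 < z" for z
    proof -
      have "((\<lambda>t. c j / real (Suc j) * t ^ Suc j) has_real_derivative c j * z ^ j) (at z)" for j
        by (auto intro!: derivative_eq_intros simp del: of_nat_Suc power_Suc)
      then show ?thesis unfolding P_def using that
        by (intro DERIV_diff DERIV_sum) (auto intro!: derivative_eq_intros)
    qed
    have "continuous_on {0..t} P"
      unfolding P_def using assms by (intro continuous_intros continuous_on_powr') auto
    moreover have "P differentiable (at z)" if "0 < z" for z
      using dP[OF that] real_differentiable_def by blast
    ultimately obtain l z where z: "0 < z" "z < t" "DERIV P z :> l" "P t - P 0 = (t - 0) * l"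
      using MVT[of 0 t P] t False by auto
    have "l = p * z powr (p - 1) - (\<Sum>j\<le>d. c j * z ^ j)" using DERIV_unique[OF z(3) dP[OF z(1)]] .
    then have "\<bar>l\<bar> \<le> e" using 1[of z] z t by simp
    then have "\<bar>t * l\<bar> \<le> b * e" unfolding abs_mult using t assms by (intro mult_mono) auto
    moreover have "P 0 = 0" by (simp add: P_def)
    ultimately show ?thesis using z(4) by (simp add: mult.commute)
  qed (use assms in \<open>simp add: P_def\<close>)
  then show ?thesis using 1 that unfolding P_def by blast
qed

text \<open>Polynomial approximation together with the derivative, on the range of f over the
  support of the test function, carries the polynomial chain rule over to the power. Zeros of f are
  allowed because the derivative of t^p extends continuously to 0.\<close>

lemma weak_grad_powr:
  assumes U: "openin (top_of_set (Rn n)) U" and wf: "is_weak_grad n U f g" and cf: "continuous_on U f"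
    and nn: "\<And>x. x \<in> U \<Longrightarrow> 0 \<le> f x" and p: "1 < p"
  shows "is_weak_grad n U (\<lambda>x. f x powr p) (\<lambda>x i. p * f x powr (p - 1) * g x i)"
  unfolding is_weak_grad_def
proof (intro conjI allI impI)
  have URn: "U \<subseteq> Rn n" using openin_Rn_subset[OF U] .
  have cF: "continuous_on U (\<lambda>x. f x powr p)"
    using nn p by (intro continuous_on_powr' cf continuous_on_const) auto
  have cF': "continuous_on U (\<lambda>x. p * f x powr (p - 1))"
    using nn p by (intro continuous_on_mult continuous_on_powr' cf continuous_on_const) auto
  show "L1loc n U (\<lambda>x. f x powr p)" by (rule L1loc_continuous[OF cF URn])
  fix i assume i: "i < n"
  show L: "L1loc n U (\<lambda>x. p * f x powr (p - 1) * g x i)"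
    by (rule L1loc_mult_continuous[OF cF' is_weak_gradD(2)[OF wf i] URn])
  fix \<phi> assume \<phi>: "Cc_infinity n U \<phi>"
  obtain K where K: "compact K" "K \<subseteq> U" "\<And>x. x \<in> U - K \<Longrightarrow> \<phi> x = 0" and c\<phi>: "continuous_on U \<phi>"
    and pd0: "\<And>i x. i < n \<Longrightarrow> x \<in> U - K \<Longrightarrow> pd i \<phi> x = 0" and cpd: "\<And>i. i < n \<Longrightarrow> continuous_on U (pd i \<phi>)"
    by (rule Cc_infinityE[OF U \<phi>]) blast
  obtain b where b: "0 < b" "\<And>x. x \<in> K \<Longrightarrow> \<bar>f x\<bar> \<le> b"
    using continuous_on_compact_bounded[OF K(1) continuous_on_subset[OF cf K(2)]] by blast
  have fK: "0 \<le> f x" "f x \<le> b" if "x \<in> K" for x using that b(2)[OF that] nn K(2) by auto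
  define A1 where "A1 = (LINT x:U|leb n. \<bar>pd i \<phi> x\<bar>)"
  define A2 where "A2 = (LINT x:U|leb n. \<bar>g x i * \<phi> x\<bar>)"
  let ?X = "LINT x:U|leb n. f x powr p * pd i \<phi> x"
  let ?Y = "LINT x:U|leb n. p * f x powr (p - 1) * g x i * \<phi> x"
  have test1: "set_integrable (leb n) U (\<lambda>x. F x * pd i \<phi> x)" if "continuous_on U F" for F
    by (rule set_integrable_test[OF L1loc_continuous[OF that URn] cpd[OF i] K(1,2) pd0[OF i] URn])
  have test2: "set_integrable (leb n) U (\<lambda>x. F x * (g x i * \<phi> x))" if "continuous_on U F" for F
    using set_integrable_test[OF L1loc_mult_continuous[OF that is_weak_gradD(2)[OF wf i] URn] c\<phi> K(1,2,3) URn]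
    by (simp add: mult.assoc)
  have "\<bar>?X + ?Y\<bar> \<le> r" if r: "0 < r" for r
  proof -
    \<comment> \<open>Makes the total error, at most e (b |A1| + |A2|), no larger than r; the
      summand 1 keeps the denominator positive.\<close>
    define e where "e = r / (b * \<bar>A1\<bar> + \<bar>A2\<bar> + 1)"
    have den: "0 < b * \<bar>A1\<bar> + \<bar>A2\<bar> + 1" using b(1) by (intro add_nonneg_pos) auto
    have e: "0 < e" using r den by (simp add: e_def)
    obtain c d where cd: "\<And>t. 0 \<le> t \<Longrightarrow> t \<le> b \<Longrightarrow> \<bar>p * t powr (p - 1) - (\<Sum>j\<le>d. c j * t ^ j)\<bar> \<le> e"
      "\<And>t. 0 \<le> t \<Longrightarrow> t \<le> b \<Longrightarrow> \<bar>t powr p - (\<Sum>j\<le>d. c j / real (Suc j) * t ^ Suc j)\<bar> \<le> e * b"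
      by (rule powr_poly_approx[OF p b(1) e]) blast
    define q where "q = (\<lambda>x. \<Sum>j\<le>d. c j * f x ^ j)"
    define P where "P = (\<lambda>x. \<Sum>j\<le>d. c j / real (Suc j) * f x ^ Suc j)"
    have cq: "continuous_on U q" "continuous_on U P"
      unfolding q_def P_def by (intro continuous_on_sum continuous_on_mult continuous_on_const continuous_on_power cf)+
    have w: "is_weak_grad n U P (\<lambda>x i. q x * g x i)"
      unfolding P_def q_def by (rule weak_grad_poly[OF U wf cf])
    have eq: "(LINT x:U|leb n. P x * pd i \<phi> x) = - (LINT x:U|leb n. q x * (g x i * \<phi> x))"
      using is_weak_gradD(3)[OF w i \<phi>] by (simp add: mult.assoc)
    have 1: "\<bar>?X - (LINT x:U|leb n. P x * pd i \<phi> x)\<bar> \<le> e * b * A1"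
      unfolding A1_def
    proof (rule set_integral_diff_bound[OF test1[OF cF] test1[OF cq(2)]])
      show "set_integrable (leb n) U (pd i \<phi>)" using test1[of "\<lambda>_. 1"] by simp
      fix x assume "x \<in> U" "pd i \<phi> x \<noteq> 0"
      then have "x \<in> K" using pd0[OF i, of x] by blast
      then show "\<bar>f x powr p - P x\<bar> \<le> e * b" using cd(2)[of "f x"] fK by (simp add: P_def)
    qed
    have "?Y = (LINT x:U|leb n. p * f x powr (p - 1) * (g x i * \<phi> x))" by (simp add: mult.assoc)
    moreover have "\<bar>(LINT x:U|leb n. p * f x powr (p - 1) * (g x i * \<phi> x)) - (LINT x:U|leb n. q x * (g x i * \<phi> x))\<bar> \<le> e * A2"
      unfolding A2_def
    proof (rule set_integral_diff_bound[OF test2[OF cF'] test2[OF cq(1)]])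
      show "set_integrable (leb n) U (\<lambda>x. g x i * \<phi> x)" using test2[of "\<lambda>_. 1"] by simp
      fix x assume "x \<in> U" "g x i * \<phi> x \<noteq> 0"
      then have "x \<in> K" using K(3)[of x] by auto
      then show "\<bar>p * f x powr (p - 1) - q x\<bar> \<le> e" using cd(1)[of "f x"] fK by (simp add: q_def)
    qed
    ultimately have "\<bar>?X + ?Y\<bar> \<le> e * b * A1 + e * A2" using 1 eq by linarith
    also have "\<dots> \<le> e * (b * \<bar>A1\<bar> + \<bar>A2\<bar> + 1)"
    proof -
      have "e * b * A1 \<le> e * b * \<bar>A1\<bar>" "e * A2 \<le> e * \<bar>A2\<bar>"
        using e b(1) by (intro mult_left_mono; simp)+
      moreover have "e * (b * \<bar>A1\<bar> + \<bar>A2\<bar> + 1) = e * b * \<bar>A1\<bar> + e * \<bar>A2\<bar> + e"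
        by (simp add: distrib_left mult.assoc)
      ultimately show ?thesis using e by linarith
    qed
    also have "\<dots> = r" using den by (simp add: e_def)
    finally show ?thesis .
  qed
  then have "\<bar>?X + ?Y\<bar> \<le> 0" using dense_ge[of 0 "\<bar>?X + ?Y\<bar>"] by blast
  then show "?X = - ?Y" by linarith
qed

section \<open>Extending the weak equation to Sobolev test functions\<close>

lemma mollifier_tendsto:
  fixes X :: "(nat \<Rightarrow> real \<Rightarrow> real) \<Rightarrow> real"
  assumes "\<And>e. 0 < e \<Longrightarrow> \<exists>e0>0. \<forall>\<epsilon> D. mollifier \<epsilon> D \<longrightarrow> \<epsilon> \<le> e0 \<longrightarrow> \<bar>X D - x\<bar> \<le> e"
    and "\<And>j. mollifier (1 / real (Suc j)) (D j)"
  shows "(\<lambda>j. X (D j)) \<longlonglongrightarrow> x"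
proof (rule LIMSEQ_I)
  fix r :: real assume r: "0 < r"
  then have "0 < r / 2" by simp
  from assms(1)[OF this] obtain e0 where e0: "0 < e0" "\<forall>\<epsilon> D. mollifier \<epsilon> D \<longrightarrow> \<epsilon> \<le> e0 \<longrightarrow> \<bar>X D - x\<bar> \<le> r / 2"
    by blast
  obtain N where N: "1 / real (Suc N) < e0" using nat_approx_posE[OF e0(1)] .
  show "\<exists>N. \<forall>j\<ge>N. norm (X (D j) - x) < r"
  proof (intro exI allI impI)
    fix j assume "N \<le> j"
    then have "1 / real (Suc j) \<le> 1 / real (Suc N)" by (intro divide_left_mono) auto
    then have "\<bar>X (D j) - x\<bar> \<le> r / 2" using e0(2) assms(2)[of j] N by fastforce
    then show "norm (X (D j) - x) < r" using r by simp
  qed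
qed

lemma mol_support:
  assumes m: "mollifier \<epsilon> D" and K: "\<And>y. y \<in> K \<Longrightarrow> closed_box n y \<epsilon> \<subseteq> K'" "K \<subseteq> Rn n" and x: "x \<in> Rn n" "x \<notin> K'"
  shows "mol n D \<alpha> (\<lambda>y. indicator K y * f y) x = 0"
proof -
  have "indicator K y * f y * kern n D \<alpha> x y = 0" for y
  proof (cases "y \<in> K")
    case True
    then have "x \<notin> closed_box n y \<epsilon>" using K(1) x(2) by blast
    then show ?thesis using kern_0(2)[OF m _ _ x(1), of y \<alpha>] True K(2) by auto
  qed simp
  then show ?thesis unfolding mol_def by (simp only: integral_zero)
qed

text \<open>The mollified \<open>\<Phi>\<close> is a test function supported in a fixed compact set.\<close>

lemma weak_solution_extend:
  assumes U: "openin (top_of_set (Rn n)) U" and pq: "1 < p" "1 < q" "1 / p + 1 / q = 1"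
    and W: "\<And>i K. i < n \<Longrightarrow> compact K \<Longrightarrow> K \<subseteq> U \<Longrightarrow> (\<lambda>x. indicator K x * W i x) \<in> borel_measurable (leb n)"
      "\<And>i K. i < n \<Longrightarrow> compact K \<Longrightarrow> K \<subseteq> U \<Longrightarrow> integrable (leb n) (\<lambda>x. \<bar>indicator K x * W i x\<bar> powr q)"
    and b: "L1loc n U b"
    and sol: "\<And>\<phi>. Cc_infinity n U \<phi> \<Longrightarrow>
       (LINT x:U|leb n. \<Sum>i<n. W i x * pd i \<phi> x) + (LINT x:U|leb n. b x * \<phi> x) = 0"
    and \<Phi>: "continuous_on U \<Phi>" "is_weak_grad n U \<Phi> G"
    and K: "compact K" "K \<subseteq> U" "\<And>x. x \<in> U - K \<Longrightarrow> \<Phi> x = 0" "\<And>i x. i < n \<Longrightarrow> x \<in> U - K \<Longrightarrow> G x i = 0"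
    and G: "\<And>i. i < n \<Longrightarrow> integrable (leb n) (\<lambda>x. \<bar>indicator K x * G x i\<bar> powr p)"
  shows "(LINT x:U|leb n. \<Sum>i<n. W i x * G x i) + (LINT x:U|leb n. b x * \<Phi> x) = 0"
    "\<And>i. i < n \<Longrightarrow> set_integrable (leb n) U (\<lambda>x. W i x * G x i)"
proof -
  have URn: "U \<subseteq> Rn n" using openin_Rn_subset[OF U] .
  obtain \<epsilon>1 K1 where K1: "0 < \<epsilon>1" "compact K1" "K1 \<subseteq> U" "K \<subseteq> K1" "\<And>x. x \<in> K \<Longrightarrow> closed_box n x \<epsilon>1 \<subseteq> K1"
    using compact_nbhd[OF U K(1,2)] by blast
  \<comment> \<open>K1 contains the support of the mollified \<open>\<Phi>\<close>. A second
    enlargement is needed because the gradient of the mollified function has to be identified at all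
    points of K1, with kernel cubes reaching into K2.\<close>
  obtain \<epsilon>2 K2 where K2: "0 < \<epsilon>2" "compact K2" "K2 \<subseteq> U" "K1 \<subseteq> K2" "\<And>x. x \<in> K1 \<Longrightarrow> closed_box n x \<epsilon>2 \<subseteq> K2"
    using compact_nbhd[OF U K1(2,3)] by blast
  obtain R where R: "0 < R" "K1 \<subseteq> closed_box n (\<lambda>_. 0) R" using compact_subset_closed_box[OF K1(2)] K1(3) URn by blast
  define P where "P = (\<lambda>x. indicator K x * \<Phi> x)"
  define g where "g = (\<lambda>i x. indicator K x * G x i)"
  define w where "w = (\<lambda>i x. indicator K1 x * W i x)"
  define B where "B = (\<lambda>x. indicator K1 x * b x)"
  obtain c where P: "integrable (leb n) P" "\<And>x. \<bar>P x\<bar> \<le> c"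
    unfolding P_def by (rule indicator_continuous[OF K(1,2) \<Phi>(1) URn]) blast
  have Gint: "integrable (leb n) (g i)" if "i < n" for i unfolding g_def
    by (rule integrable_indicator_L1loc[OF is_weak_gradD(2)[OF \<Phi>(2) that] K(1,2)])
  have gp: "integrable (leb n) (\<lambda>x. \<bar>g i x\<bar> powr p)" if "i < n" for i
    unfolding g_def using G[OF that] .
  have gm: "g i \<in> borel_measurable (leb n)" if "i < n" for i using Gint[OF that] by auto
  have wm: "w i \<in> borel_measurable (leb n)" "integrable (leb n) (\<lambda>x. \<bar>w i x\<bar> powr q)" if "i < n" for i
    unfolding w_def using W[OF that K1(2,3)] by auto
  have Bint: "integrable (leb n) B" unfolding B_def by (rule integrable_indicator_L1loc[OF b K1(2,3)])
  have z: "P x = 0" "g i x = 0" "w i x = 0" "B x = 0" if "x \<notin> closed_box n (\<lambda>_. 0) R" for x i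
  proof -
    have "x \<notin> K1" "x \<notin> K" using that R(2) K1(4) by blast+
    then show "P x = 0" "g i x = 0" "w i x = 0" "B x = 0" by (simp_all add: P_def g_def w_def B_def)
  qed
  have Wint: "integrable (leb n) (w i)" if "i < n" for i
    by (rule integrable_if_powr_integrable[OF wm[OF that] compact_closed_box closed_box_subset_Rn z(3)]) (use pq in auto)
  have KK1: "x \<in> K1" "x \<in> U" if "x \<in> K" for x using that K1(4) K(2) by auto
  have wg: "integrable (leb n) (\<lambda>x. w i x * g i x)" if i: "i < n" for i
  proof (rule Bochner_Integration.integrable_bound)
    show "integrable (leb n) (\<lambda>x. 1 powr q * \<bar>w i x\<bar> powr q + 1 powr (- p) * \<bar>g i x\<bar> powr p)"
      using wm[OF i] gp[OF i] by simp
    show "AE x in leb n. norm (w i x * g i x) \<le> norm (1 powr q * \<bar>w i x\<bar> powr q + 1 powr (- p) * \<bar>g i x\<bar> powr p)"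
    proof (rule AE_I2)
      fix x
      show "norm (w i x * g i x) \<le> norm (1 powr q * \<bar>w i x\<bar> powr q + 1 powr (- p) * \<bar>g i x\<bar> powr p)"
        using scaled_Young[OF pq zero_less_one, of "w i x" "g i x"] by (metis abs_ge_self order.trans real_norm_def)
    qed
  qed (use wm[OF i] gm[OF i] in measurable)
  have wgU: "indicator U x *\<^sub>R (W i x * G x i) = w i x * g i x" if "i < n" for i x
  proof (cases "x \<in> K")
    case True
    then show ?thesis using KK1[OF True] by (simp add: w_def g_def)
  next
    case False
    then show ?thesis using K(4)[OF that, of x] by (cases "x \<in> U") (auto simp: g_def)
  qed
  show "set_integrable (leb n) U (\<lambda>x. W i x * G x i)" if "i < n" for i
    unfolding set_integrable_def wgU[OF that] by (rule wg[OF that])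
  have "\<forall>j. \<exists>D. mollifier (1 / real (Suc j)) D"
    using mollifier_exists by simp
  from choice[OF this] obtain D where D: "\<And>j. mollifier (1 / real (Suc j)) (D j)" by blast
  let ?I = "\<lambda>F G. LINT x|leb n. F x * G x"
  \<comment> \<open>In the gradient terms both factors lie only in dual Lebesgue spaces, so their
    limits need \<open>mol_conv_Lp\<close>; in the last term P is bounded and B merely integrable. P
    stands first there to match \<open>mol_conv_bounded\<close>.\<close>
  define X where "X = (\<lambda>j. (\<Sum>i<n. ?I (w i) (mol n (D j) (\<lambda>_. 0) (g i))) + ?I P (mol n (D j) (\<lambda>_. 0) B))"
  have "X \<longlonglongrightarrow> (\<Sum>i<n. ?I (w i) (g i)) + ?I P B"
    unfolding X_def
  proof (intro tendsto_add tendsto_sum)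
    show "(\<lambda>j. ?I (w i) (mol n (D j) (\<lambda>_. 0) (g i))) \<longlonglongrightarrow> ?I (w i) (g i)" if "i \<in> {..<n}" for i
    proof -
      have i: "i < n" using that by simp
      show ?thesis
        by (rule mollifier_tendsto[OF mol_conv_Lp[OF pq wm[OF i] z(3) gm[OF i] gp[OF i] z(2)] D])
    qed
    show "(\<lambda>j. ?I P (mol n (D j) (\<lambda>_. 0) B)) \<longlonglongrightarrow> ?I P B"
      by (rule mollifier_tendsto[OF mol_conv_bounded[OF P z(1) Bint z(4)] D])
  qed
  moreover have "eventually (\<lambda>j. X j = 0) sequentially"
  proof -
    have "0 < min \<epsilon>1 \<epsilon>2" using K1 K2 by simp
    then obtain N where N: "1 / real (Suc N) < min \<epsilon>1 \<epsilon>2" using nat_approx_posE by blast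
    show ?thesis
    proof (rule eventually_sequentiallyI[of N])
      fix j assume "N \<le> j"
      then have "1 / real (Suc j) \<le> 1 / real (Suc N)" by (intro divide_left_mono) auto
      then have small: "1 / real (Suc j) \<le> \<epsilon>1" "1 / real (Suc j) \<le> \<epsilon>2" using N by auto
      define \<epsilon> where "\<epsilon> = 1 / real (Suc j)"
      have m: "mollifier \<epsilon> (D j)" using D by (simp add: \<epsilon>_def)
      let ?m = "mol n (D j) (\<lambda>_. 0)"
      have c1: "closed_box n x \<epsilon> \<subseteq> K1" if "x \<in> K" for x
      proof -
        have "closed_box n x \<epsilon> \<subseteq> closed_box n x \<epsilon>1" using small by (auto simp: closed_box_def \<epsilon>_def)
        then show ?thesis using K1(5)[OF that] by blast
      qed
      have c2: "closed_box n x \<epsilon> \<subseteq> K2" if "x \<in> K1" for x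
      proof -
        have "closed_box n x \<epsilon> \<subseteq> closed_box n x \<epsilon>2" using small by (auto simp: closed_box_def \<epsilon>_def)
        then show ?thesis using K2(5)[OF that] by blast
      qed
      have KRn: "K \<subseteq> Rn n" using K(2) URn by blast
      have mP0: "?m P x = 0" if "x \<in> U - K1" for x
        unfolding P_def by (rule mol_support[OF m c1 KRn]) (use that URn in auto)
      \<comment> \<open>\<open>\<Phi>\<close> and its gradient vanish on \<open>U - K\<close>, so
        cutting off to K or to K2 is the same; \<open>pd_mol_weak\<close> asks for the larger
        set.\<close>
      have P2: "P = (\<lambda>x. indicator K2 x * \<Phi> x)" and g2: "g i = (\<lambda>x. indicator K2 x * G x i)" if "i < n" for i
      proof -
        have e: "indicator K x * f x = indicator K2 x * f x" if "\<And>x. x \<in> U - K \<Longrightarrow> f x = (0::real)" for f x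
          using that[of x] K1(4) K2(3,4) by (auto simp: indicator_def)
        show "P = (\<lambda>x. indicator K2 x * \<Phi> x)" unfolding P_def using e[of \<Phi>] K(3) by (intro ext) blast
        show "g i = (\<lambda>x. indicator K2 x * G x i)"
          unfolding g_def using e[of "\<lambda>x. G x i"] K(4)[OF that] by (intro ext) blast
      qed
      have pdm: "pd i (?m P) x = ?m (g i) x" if i: "i < n" and x: "x \<in> K1" for i x
        unfolding P2[OF i] g2[OF i]
        by (rule pd_mol_weak[OF U \<Phi>(2) m i _ c2[OF x] K2(2,3)]) (use x K1(3) URn in blast)
      have pd0: "pd i (?m P) x = 0" if i: "i < n" and x: "x \<in> U - K1" for i x
        by (rule pd_zero[OF openin_Diff_compact[OF U K1(2,3)] x i mP0])
      have test: "Cc_infinity n U (?m P)"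
        unfolding Cc_infinity_def
      proof
        show "\<forall>k. Ck n k U (?m P)" using Ck_mol[OF m P(1)] by blast
        show "compact_support U (?m P)" by (rule compact_supportI[OF K1(2,3)]) (use mP0 in blast)
      qed
      have "(LINT x:U|leb n. \<Sum>i<n. W i x * pd i (?m P) x) = (LINT x|leb n. (\<Sum>i<n. w i x * ?m (g i) x))"
      proof (rule set_integral_support)
        fix x
        show "(\<Sum>i<n. W i x * pd i (?m P) x) = (\<Sum>i<n. w i x * ?m (g i) x)" if "x \<in> U"
          by (rule sum.cong[OF refl]) (use that pdm pd0 in \<open>cases "x \<in> K1"; auto simp: w_def\<close>)
        show "(\<Sum>i<n. w i x * ?m (g i) x) = 0" if "x \<notin> U"
          using that K1(3) by (intro sum.neutral) (auto simp: w_def indicator_def)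
      qed
      also have "\<dots> = (\<Sum>i<n. ?I (w i) (?m (g i)))"
        by (rule Bochner_Integration.integral_sum) (use mol_Fubini(2)[OF m Wint Gint] in simp)
      finally have 1: "(LINT x:U|leb n. \<Sum>i<n. W i x * pd i (?m P) x) = (\<Sum>i<n. ?I (w i) (?m (g i)))" .
      have "(LINT x:U|leb n. b x * ?m P x) = ?I B (?m P)"
      proof (rule set_integral_support)
        fix x
        show "b x * ?m P x = B x * ?m P x" if "x \<in> U"
          using that mP0[of x] by (cases "x \<in> K1") (auto simp: B_def)
        show "B x * ?m P x = 0" if "x \<notin> U" using that K1(3) by (auto simp: B_def indicator_def)
      qed
      also have "\<dots> = ?I P (?m B)" by (rule mol_Fubini(1)[OF m Bint P(1)])
      finally show "X j = 0" using 1 sol[OF test] by (simp add: X_def)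
    qed
  qed
  ultimately have "(\<Sum>i<n. ?I (w i) (g i)) + ?I P B = 0"
    using tendsto_eventually LIMSEQ_unique by blast
  moreover have "(LINT x:U|leb n. \<Sum>i<n. W i x * G x i) = (\<Sum>i<n. ?I (w i) (g i))"
  proof -
    have "(LINT x:U|leb n. \<Sum>i<n. W i x * G x i) = (LINT x|leb n. (\<Sum>i<n. w i x * g i x))"
      unfolding set_lebesgue_integral_def scaleR_sum_right
      by (intro Bochner_Integration.integral_cong sum.cong refl wgU) simp
    also have "\<dots> = (\<Sum>i<n. ?I (w i) (g i))"
      by (rule Bochner_Integration.integral_sum) (use wg in simp)
    finally show ?thesis .
  qed
  moreover have "(LINT x:U|leb n. b x * \<Phi> x) = ?I P B"
  proof (rule set_integral_support)
    fix x
    show "b x * \<Phi> x = P x * B x" if "x \<in> U"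
      using that K(3)[of x] KK1[of x] by (cases "x \<in> K") (auto simp: B_def P_def)
    show "P x * B x = 0" if "x \<notin> U" using that K1(3) by (auto simp: B_def indicator_def)
  qed
  ultimately show "(LINT x:U|leb n. \<Sum>i<n. W i x * G x i) + (LINT x:U|leb n. b x * \<Phi> x) = 0" by linarith
qed

section \<open>The energy identity\<close>

text \<open>The hypotheses on weights and potential speak of domains compactly contained in U, while
  compact sets are what the integrals use. Small cubes mediate between them: finitely many cover K,
  and the property passes to unions and descends to K.\<close>

lemma compact_local_property:
  assumes U: "openin (top_of_set (Rn n)) U" and K: "compact K" "K \<subseteq> U"
    and local: "\<And>x r. x \<in> U \<Longrightarrow> 0 < r \<Longrightarrow> closed_box n x r \<subseteq> U \<Longrightarrow> \<exists>r>0. P (closed_box n x r)"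
    and empty: "P {}" and union: "\<And>S T. P S \<Longrightarrow> P T \<Longrightarrow> P (S \<union> T)"
    and mono: "\<And>T. P T \<Longrightarrow> K \<subseteq> T \<Longrightarrow> P K"
  shows "P K"
proof -
  have KRn: "K \<subseteq> Rn n" using K openin_Rn_subset[OF U] by blast
  have "\<forall>x\<in>K. \<exists>r>0. P (closed_box n x r)"
  proof
    fix x assume "x \<in> K"
    then have x: "x \<in> U" using K by blast
    obtain r where "0 < r" "closed_box n x r \<subseteq> U" using openin_Rn_closed_box[OF U x] .
    then show "\<exists>r>0. P (closed_box n x r)" using local x by blast
  qed
  from bchoice[OF this] obtain r where r: "\<forall>x\<in>K. 0 < r x \<and> P (closed_box n x (r x))" by blast
  then have r0: "\<And>x. x \<in> K \<Longrightarrow> 0 < r x" by blast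
  obtain F where F: "finite F" "F \<subseteq> K" "\<And>x. x \<in> K \<Longrightarrow> \<exists>z\<in>F. x \<in> open_box n z (r z)"
    by (rule compact_box_cover[of K n r]) (use K(1) KRn r0 in blast)+
  have "P (\<Union>z\<in>F. closed_box n z (r z))"
    using F(1,2) r by (induction F rule: finite_induct) (auto simp: empty union)
  moreover have "K \<subseteq> (\<Union>z\<in>F. closed_box n z (r z))"
  proof
    fix x assume "x \<in> K"
    then obtain z where "z \<in> F" "x \<in> open_box n z (r z)" using F(3) by blast
    then show "x \<in> (\<Union>z\<in>F. closed_box n z (r z))" using open_box_subset_closed_box by blast
  qed
  ultimately show ?thesis by (rule mono)
qed

text \<open>Open cubes are admissible domains; the closed cube of half the size is the compact set
  to which what holds on them is restricted.\<close>

lemma open_box_domain: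
  assumes "x \<in> Rn n" "0 < r" "closed_box n x r \<subseteq> U"
  shows "is_domain n (open_box n x r)" "compactly_in (open_box n x r) U" "closed_box n x (r / 2) \<subseteq> open_box n x r"
proof -
  show "is_domain n (open_box n x r)"
    unfolding is_domain_def using openin_open_box connected_open_box mem_open_box[OF assms(1,2)] by blast
  have "closure (open_box n x r) \<subseteq> closed_box n x r"
    by (rule closure_minimal[OF open_box_subset_closed_box compact_imp_closed[OF compact_closed_box]])
  moreover from this have "compact (closure (open_box n x r))"
    using compact_Int_closed[OF compact_closed_box[of n x r] closed_closure[of "open_box n x r"]] by (simp add: Int_absorb1)
  ultimately show "compactly_in (open_box n x r) U" using assms(3) by (auto simp: compactly_in_def)
  show "closed_box n x (r / 2) \<subseteq> open_box n x r"
  proof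
    fix y assume y: "y \<in> closed_box n x (r / 2)"
    have "\<bar>y i - x i\<bar> < r" if "i < n" for i
    proof -
      have "\<bar>y i - x i\<bar> \<le> r / 2" using y that by (simp add: closed_box_def)
      then show ?thesis using assms(2) by linarith
    qed
    then show "y \<in> open_box n x r" using y by (simp add: closed_box_def open_box_def)
  qed
qed

lemma weight_bounded_on_compact:
  assumes U: "openin (top_of_set (Rn n)) U" and w: "weight n U a" and K: "compact K" "K \<subseteq> U"
  obtains C where "0 < C" "\<And>i. i < n \<Longrightarrow> AE x in leb n. x \<in> K \<longrightarrow> a i x \<le> C"
proof -
  let ?P = "\<lambda>S. \<exists>C>0. \<forall>i<n. AE x in leb n. x \<in> S \<longrightarrow> a i x \<le> C"
  have URn: "U \<subseteq> Rn n" using openin_Rn_subset[OF U] .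
  have "?P K"
  proof (rule compact_local_property[OF U K, where P = ?P])
    fix x r assume x: "x \<in> U" and r: "0 < r" "closed_box n x r \<subseteq> U"
    note d = open_box_domain[OF subsetD[OF URn x] r]
    obtain c C where C: "0 < c" "c \<le> C" "\<forall>i<n. AE x' in leb n. x' \<in> open_box n x r \<longrightarrow> c \<le> a i x' \<and> a i x' \<le> C"
      using w d(1,2) unfolding weight_def by blast
    have "AE x' in leb n. x' \<in> closed_box n x (r / 2) \<longrightarrow> a i x' \<le> C" if "i < n" for i
      using C(3)[rule_format, OF that] by eventually_elim (use d(3) in blast)
    then have "?P (closed_box n x (r / 2))" using C by (intro exI[of _ C]) auto
    then show "\<exists>r>0. ?P (closed_box n x r)" using r by (intro exI[of _ "r / 2"]) simp
  next
    show "?P {}" by (intro exI[of _ 1]) simp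
  next
    fix S T assume "?P S" "?P T"
    then obtain C1 C2 where C: "0 < C1" "\<forall>i<n. AE x in leb n. x \<in> S \<longrightarrow> a i x \<le> C1"
      "0 < C2" "\<forall>i<n. AE x in leb n. x \<in> T \<longrightarrow> a i x \<le> C2" by blast
    have "AE x in leb n. x \<in> S \<union> T \<longrightarrow> a i x \<le> max C1 C2" if "i < n" for i
      using C(2)[rule_format, OF that] C(4)[rule_format, OF that] by eventually_elim auto
    then show "?P (S \<union> T)" using C by (intro exI[of _ "max C1 C2"]) auto
  next
    fix T assume "?P T" "K \<subseteq> T"
    then obtain C where C: "0 < C" "\<forall>i<n. AE x in leb n. x \<in> T \<longrightarrow> a i x \<le> C" by blast
    have "AE x in leb n. x \<in> K \<longrightarrow> a i x \<le> C" if "i < n" for i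
      using C(2)[rule_format, OF that] by eventually_elim (use \<open>K \<subseteq> T\<close> in blast)
    then show "?P K" using C(1) by blast
  qed
  then show ?thesis using that by blast
qed

text \<open>For p \<le> n the Morrey condition on an open cube includes local integrability there,
  and the closed cube of half the size is compact in it; for p > n it is integrability on the whole
  cube.\<close>

lemma morrey_loc_L1loc:
  assumes U: "openin (top_of_set (Rn n)) U" and V: "morrey_loc n p q U V"
  shows "L1loc n U V"
  unfolding L1loc_def
proof (intro allI impI)
  fix K assume K: "compact K \<and> K \<subseteq> U"
  have URn: "U \<subseteq> Rn n" using openin_Rn_subset[OF U] .
  let ?P = "\<lambda>S. S \<in> sets (leb n) \<and> set_integrable (leb n) S V"
  have "?P K"
  proof (rule compact_local_property[OF U _ _, where P = ?P])
    fix x r assume x: "x \<in> U" and r: "0 < r" "closed_box n x r \<subseteq> U"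
    note d = open_box_domain[OF subsetD[OF URn x] r]
    have m: "morrey n p q (open_box n x r) V" using V d(1,2) unfolding morrey_loc_def by blast
    have s: "closed_box n x (r / 2) \<in> sets (leb n)" by (rule compact_sets_leb[OF compact_closed_box closed_box_subset_Rn])
    have "set_integrable (leb n) (closed_box n x (r / 2)) V"
    proof (cases "p \<le> real n")
      case True
      then have "L1loc n (open_box n x r) V" using m by (simp add: morrey_def)
      then show ?thesis unfolding L1loc_def using d(3) compact_closed_box by blast
    next
      case False
      then have "set_integrable (leb n) (open_box n x r) V" using m by (simp add: morrey_def)
      then show ?thesis by (rule set_integrable_subset[OF _ s d(3)])
    qed
    then show "\<exists>r>0. ?P (closed_box n x r)" using s r by (intro exI[of _ "r / 2"]) simp
  next
    fix T assume "?P T" "K \<subseteq> T"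
    moreover have "K \<in> sets (leb n)" using compact_sets_leb K URn by blast
    ultimately show "?P K" using set_integrable_subset by blast
  next
    show "?P (S \<union> T)" if "?P S" "?P T" for S T
      using that set_integrable_Un[of "leb n" S V T] by blast
  qed (use K in \<open>auto simp: set_integrable_def\<close>)
  then show "set_integrable (leb n) K V" by blast
qed

text \<open>U is exhausted by finite unions of compact sets, and the cut-offs to these converge
  pointwise to the cut-off to U.\<close>

lemma L1loc_measurable:
  assumes U: "openin (top_of_set (Rn n)) U" and f: "L1loc n U f"
  shows "(\<lambda>x. indicator U x * f x) \<in> borel_measurable (leb n)"
proof -
  obtain \<C> where C: "countable \<C>" "\<And>K. K \<in> \<C> \<Longrightarrow> compact K \<and> K \<subseteq> U" "U = \<Union> \<C>"
    by (rule openin_sigma_compact[OF U]) blast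
  show ?thesis
  proof (cases "\<C> = {}")
    case False
    define S where "S = (\<lambda>m. \<Union>j\<le>m. from_nat_into \<C> j)"
    have S: "compact (S m)" "S m \<subseteq> U" for m
      unfolding S_def using C(2) from_nat_into[OF False] by (auto intro!: compact_UN)
    show ?thesis
    proof (rule borel_measurable_LIMSEQ_real)
      show "(\<lambda>x. indicator (S m) x * f x) \<in> borel_measurable (leb n)" for m
        using integrable_indicator_L1loc[OF f S] by auto
      fix x
      show "(\<lambda>m. indicator (S m) x * f x) \<longlonglongrightarrow> indicator U x * f x"
      proof (cases "x \<in> U")
        case True
        then obtain K where "K \<in> \<C>" "x \<in> K" using C(3) by blast
        then obtain j where "x \<in> from_nat_into \<C> j" using from_nat_into_surj[OF C(1)] by blast
        then have "x \<in> S m" if "j \<le> m" for m using that by (auto simp: S_def)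
        then have "eventually (\<lambda>m. indicator (S m) x * f x = indicator U x * f x) sequentially"
          using True by (intro eventually_sequentiallyI[of j]) simp
        then show ?thesis by (rule tendsto_eventually)
      next
        case False
        then have "x \<notin> S m" for m using S(2) by blast
        then show ?thesis using False by simp
      qed
    qed
  qed (use C(3) in simp)
qed

section \<open>Absorbing the weights, and bounds for the flux\<close>

lemma anorm_lnorm:
  assumes "0 < s" "\<And>i. i < n \<Longrightarrow> 0 < w i"
  shows "anorm n s w \<xi> = lnorm {..<n} s (\<lambda>i. w i powr (1 / s) * \<xi> i)"
  unfolding anorm_def lnorm_def
  using assms by (intro arg_cong[where f = "\<lambda>t. t powr (1 / s)"] sum.cong) (auto simp: abs_mult powr_mult powr_powr abs_of_pos)

lemma R1_lnorm:
  assumes "0 < s" "\<And>i. i < n \<Longrightarrow> 0 < w i"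
  shows "R1 n p s w \<xi> \<eta> l = lnorm {..<n} s (\<lambda>i. w i powr (1 / s) * \<eta> i) powr l *
     (lnorm {..<n} s (\<lambda>i. w i powr (1 / s) * \<eta> i) + lnorm {..<n} s (\<lambda>i. w i powr (1 / s) * \<xi> i)) powr (p - l)"
  by (simp add: R1_def anorm_lnorm[of s n w, OF assms])

lemma R2_lnorm:
  assumes "0 < s" "\<And>i. i < n \<Longrightarrow> 0 < w i"
  shows "R2 n p s w \<xi> \<eta> = lnorm {..<n} s (\<lambda>i. w i powr (1 / s) * \<xi> i) powr (p - s) *
     second_var {..<n} s (\<lambda>i. w i powr (1 / s) * \<xi> i) (\<lambda>i. w i powr (1 / s) * \<eta> i)"
  by (simp add: R2_def anorm_lnorm[of s n w, OF assms] second_var_def)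

text \<open>The exponents (s - 2)/s, 1/s and 1/s of the weight add up to 1, so exactly one factor
  \<open>w i\<close> is left.\<close>

lemma first_var_weighted:
  assumes "0 < s" "\<And>i. i < n \<Longrightarrow> 0 < w i"
  shows "first_var {..<n} s (\<lambda>i. w i powr (1 / s) * \<xi> i) (\<lambda>i. w i powr (1 / s) * \<eta> i)
     = (\<Sum>i<n. w i * \<bar>\<xi> i\<bar> powr (s - 2) * \<xi> i * \<eta> i)"
  unfolding first_var_def
proof (rule sum.cong[OF refl])
  fix i assume "i \<in> {..<n}"
  then have w: "0 < w i" using assms by simp
  have "(w i powr (1 / s)) powr (s - 2) * w i powr (1 / s) * w i powr (1 / s) = w i powr ((s - 2) / s + 1 / s + 1 / s)"
    by (simp only: powr_powr powr_add times_divide_eq_left mult_1)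
  also have "(s - 2) / s + 1 / s + 1 / s = 1" using assms(1) by (simp add: field_simps)
  finally have e: "(w i powr (1 / s)) powr (s - 2) * w i powr (1 / s) * w i powr (1 / s) = w i" using w by simp
  have "\<bar>w i powr (1 / s) * \<xi> i\<bar> powr (s - 2) * (w i powr (1 / s) * \<xi> i) * (w i powr (1 / s) * \<eta> i) =
     ((w i powr (1 / s)) powr (s - 2) * w i powr (1 / s) * w i powr (1 / s)) * (\<bar>\<xi> i\<bar> powr (s - 2) * \<xi> i * \<eta> i)"
    by (simp add: abs_mult powr_mult)
  then show "\<bar>w i powr (1 / s) * \<xi> i\<bar> powr (s - 2) * (w i powr (1 / s) * \<xi> i) * (w i powr (1 / s) * \<eta> i) =
     w i * \<bar>\<xi> i\<bar> powr (s - 2) * \<xi> i * \<eta> i"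
    unfolding e by simp
qed

text \<open>With \<open>\<Phi> = u \<psi>\<^sup>p\<close> and \<open>\<xi> = \<psi> \<nabla>u\<close>, \<open>\<eta> = u \<nabla>\<psi>\<close>, the flux of \<open>u\<close> paired with \<open>\<nabla>\<Phi>\<close> is the
  first order Taylor polynomial of \<open>\<bar>\<xi> + \<eta>\<bar>\<^sup>p\<close> at \<open>\<xi>\<close>.\<close>

lemma Picone_identity:
  assumes s: "1 < s" and p: "s < p" and w: "\<And>i. i < n \<Longrightarrow> 0 < w i" and \<psi>: "0 \<le> \<psi>"
  shows "(\<Sum>i<n. (anorm n s w g powr (p - s) * (w i * \<bar>g i\<bar> powr (s - 2) * g i)) * (u * (p * \<psi> powr (p - 1) * h i) + \<psi> powr p * g i))
     = anorm n s w (\<lambda>i. \<psi> * g i) powr p + p * anorm n s w (\<lambda>i. \<psi> * g i) powr (p - s) *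
        (\<Sum>i<n. w i * \<bar>\<psi> * g i\<bar> powr (s - 2) * (\<psi> * g i) * (u * h i))"
proof (cases "\<psi> = 0")
  case True
  then show ?thesis using s p by (simp add: anorm_def)
next
  case False
  then have \<psi>: "0 < \<psi>" using assms by simp
  define N where "N = anorm n s w g"
  define S where "S = (\<Sum>i<n. w i * \<bar>g i\<bar> powr s)"
  have S: "0 \<le> S" unfolding S_def using w by (intro sum_nonneg) (simp add: less_imp_le)
  have N: "N = S powr (1 / s)" by (simp add: N_def S_def anorm_def)
  have "(\<Sum>i<n. w i * \<bar>\<psi> * g i\<bar> powr s) = \<psi> powr s * S"
    unfolding S_def sum_distrib_left using \<psi> by (intro sum.cong) (auto simp: abs_mult powr_mult)
  then have N\<psi>: "anorm n s w (\<lambda>i. \<psi> * g i) = \<psi> * N"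
    unfolding anorm_def N using \<psi> s by (simp add: powr_mult powr_powr)
  \<comment> \<open>Paired with the gradient itself, the flux returns the p-th power of the norm;
    this is the zeroth order term of the identity.\<close>
  have NS: "N powr (p - s) * S = N powr p"
  proof (cases "S = 0")
    case False
    then have "S powr ((p - s) / s) * S powr 1 = S powr (p / s)"
      using s by (subst powr_add[symmetric]) (simp add: field_simps)
    then show ?thesis using S False s by (simp add: N powr_powr)
  qed (simp add: N)
  have g2: "\<bar>t\<bar> powr (s - 2) * t * t = \<bar>t\<bar> powr s" for t :: real
    by (cases "t = 0") (auto simp: powr_diff power2_eq_square)
  have "(\<Sum>i<n. (N powr (p - s) * (w i * \<bar>g i\<bar> powr (s - 2) * g i)) * (u * (p * \<psi> powr (p - 1) * h i) + \<psi> powr p * g i))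
     = (\<Sum>i<n. \<psi> powr p * N powr (p - s) * (w i * \<bar>g i\<bar> powr s)) +
       (\<Sum>i<n. p * \<psi> powr (p - 1) * N powr (p - s) * (w i * \<bar>g i\<bar> powr (s - 2) * g i * (u * h i)))"
    unfolding sum.distrib[symmetric] g2[symmetric] by (intro sum.cong) (auto simp: algebra_simps)
  also have "(\<Sum>i<n. \<psi> powr p * N powr (p - s) * (w i * \<bar>g i\<bar> powr s)) = \<psi> powr p * N powr p"
    unfolding sum_distrib_left[symmetric] S_def[symmetric] by (simp add: NS mult.assoc)
  also have "\<psi> powr p * N powr p = (\<psi> * N) powr p" using \<psi> by (simp add: powr_mult)
  also have "(\<Sum>i<n. p * \<psi> powr (p - 1) * N powr (p - s) * (w i * \<bar>g i\<bar> powr (s - 2) * g i * (u * h i)))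
    = p * (\<psi> * N) powr (p - s) * (\<Sum>i<n. w i * \<bar>\<psi> * g i\<bar> powr (s - 2) * (\<psi> * g i) * (u * h i))"
  proof -
    have "\<psi> powr (p - 1) = \<psi> powr (p - s) * (\<psi> powr (s - 2) * \<psi>)"
      using \<psi> by (simp add: powr_diff power2_eq_square)
    then show ?thesis unfolding sum_distrib_left
      using \<psi> by (intro sum.cong) (auto simp: powr_mult abs_mult)
  qed
  finally show ?thesis unfolding N\<psi> by (simp add: N_def)
qed

lemma anorm_nonneg [simp]: "0 \<le> anorm n s w g"
  by (simp add: anorm_def)

text \<open>Serves integrability only, so the constant may depend on n and on the bound of the
  weights.\<close>

lemma anorm_powr_le:
  assumes s: "0 < s" "s < p" and w: "\<And>i. i < n \<Longrightarrow> 0 < w i" "\<And>i. i < n \<Longrightarrow> w i \<le> C" and C: "0 < C"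
  shows "anorm n s w g powr p \<le> (C * real n) powr (p / s) * (\<Sum>i<n. \<bar>g i\<bar> powr p)"
proof -
  define T where "T = (\<Sum>i<n. \<bar>g i\<bar> powr p)"
  have T: "0 \<le> T" by (simp add: T_def sum_nonneg)
  have g: "\<bar>g i\<bar> powr s \<le> T powr (s / p)" if "i < n" for i
  proof -
    have "\<bar>g i\<bar> powr p \<le> T" unfolding T_def using that by (intro member_le_sum) auto
    then have "(\<bar>g i\<bar> powr p) powr (s / p) \<le> T powr (s / p)" using s by (intro powr_mono2) auto
    then show ?thesis using s by (simp add: powr_powr)
  qed
  have "(\<Sum>i<n. w i * \<bar>g i\<bar> powr s) \<le> (\<Sum>i<n. C * T powr (s / p))"
    using g w C by (intro sum_mono mult_mono) auto
  also have "\<dots> = (C * real n) * T powr (s / p)" by simp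
  finally have "(\<Sum>i<n. w i * \<bar>g i\<bar> powr s) powr (p / s) \<le> ((C * real n) * T powr (s / p)) powr (p / s)"
    using s w by (intro powr_mono2 sum_nonneg) (auto simp: less_imp_le)
  also have "\<dots> = (C * real n) powr (p / s) * T" using C s T by (simp add: powr_mult powr_powr)
  finally show ?thesis using s by (simp add: anorm_def powr_powr T_def)
qed

text \<open>The flux grows like |g|^(p - 1) and q is conjugate to p, so its q-th power is controlled
  by |g|^p. A component of the weighted vector is at most the norm, which leaves one factor
  \<open>w i powr (1 / s)\<close>, bounded by the corresponding power of C.\<close>

lemma flux_powr_le:
  assumes s: "1 < s" "s < p" and q: "q = p / (p - 1)"
    and w: "\<And>i. i < n \<Longrightarrow> 0 < w i" "\<And>i. i < n \<Longrightarrow> w i \<le> C" and C: "0 < C" and i: "i < n"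
  shows "\<bar>anorm n s w g powr (p - s) * (w i * \<bar>g i\<bar> powr (s - 2) * g i)\<bar> powr q
     \<le> C powr (q / s) * ((C * real n) powr (p / s) * (\<Sum>i<n. \<bar>g i\<bar> powr p))"
proof -
  define N where "N = anorm n s w g"
  have N: "0 \<le> N" by (simp add: N_def)
  have q0: "0 < q" "(p - 1) * q = p" using s by (auto simp: q)
  have w0: "0 < w i" using w i by blast
  have Ns: "N powr s = (\<Sum>i<n. w i * \<bar>g i\<bar> powr s)"
  proof -
    have "0 \<le> (\<Sum>i<n. w i * \<bar>g i\<bar> powr s)" using w(1) by (intro sum_nonneg) (simp add: less_imp_le)
    then show ?thesis using s by (simp add: N_def anorm_def powr_powr)
  qed
  have "w i * \<bar>g i\<bar> powr s \<le> N powr s" unfolding Ns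
    using i w by (intro member_le_sum[where f = "\<lambda>i. w i * \<bar>g i\<bar> powr s"]) (auto simp: less_imp_le)
  then have "(w i * \<bar>g i\<bar> powr s) powr (1 / s) \<le> (N powr s) powr (1 / s)"
    using s w0 by (intro powr_mono2) auto
  then have gN: "w i powr (1 / s) * \<bar>g i\<bar> \<le> N" using s w0 N by (simp add: powr_mult powr_powr)
  have "\<bar>w i * \<bar>g i\<bar> powr (s - 2) * g i\<bar> = w i * \<bar>g i\<bar> powr (s - 1)"
    using w0 by (cases "g i = 0") (auto simp: abs_mult powr_diff power2_eq_square)
  also have "\<dots> = w i powr (1 / s) * (w i powr (1 / s) * \<bar>g i\<bar>) powr (s - 1)"
  proof -
    have "w i powr (1 / s) * (w i powr (1 / s)) powr (s - 1) = w i powr (1 / s + 1 / s * (s - 1))"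
      by (simp only: powr_powr powr_add)
    also have "1 / s + 1 / s * (s - 1) = 1" using s by (simp add: field_simps)
    finally show ?thesis using w0 by (simp add: powr_mult flip: mult.assoc)
  qed
  also have "\<dots> \<le> C powr (1 / s) * N powr (s - 1)"
    using gN s w0 w(2)[OF i] N by (intro mult_mono powr_mono2) auto
  finally have "N powr (p - s) * \<bar>w i * \<bar>g i\<bar> powr (s - 2) * g i\<bar> \<le> N powr (p - s) * (C powr (1 / s) * N powr (s - 1))"
    by (intro mult_left_mono) auto
  also have "\<dots> = C powr (1 / s) * N powr (p - 1)"
    using powr_add[of N "p - s" "s - 1"] by simp
  finally have "\<bar>N powr (p - s) * (w i * \<bar>g i\<bar> powr (s - 2) * g i)\<bar> \<le> C powr (1 / s) * N powr (p - 1)"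
    by (simp add: abs_mult)
  then have "\<bar>N powr (p - s) * (w i * \<bar>g i\<bar> powr (s - 2) * g i)\<bar> powr q \<le> (C powr (1 / s) * N powr (p - 1)) powr q"
    using q0 by (intro powr_mono2) auto
  also have "\<dots> = C powr (q / s) * N powr p" using q0 by (simp add: powr_mult powr_powr)
  also have "\<dots> \<le> C powr (q / s) * ((C * real n) powr (p / s) * (\<Sum>i<n. \<bar>g i\<bar> powr p))"
    unfolding N_def using s by (intro mult_left_mono anorm_powr_le w C) auto
  finally show ?thesis unfolding N_def .
qed

lemma integrable_abs_bound:
  fixes f g :: "'a \<Rightarrow> real"
  assumes "integrable M g" "f \<in> borel_measurable M" "AE x in M. \<bar>f x\<bar> \<le> g x"
  shows "integrable M f"
proof (rule Bochner_Integration.integrable_bound[OF assms(1,2)])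
  show "AE x in M. norm (f x) \<le> norm (g x)" using assms(3) by eventually_elim simp
qed

text \<open>Membership in a Sobolev space provides some gradient \<open>g0\<close> with p-integrable
  components, while \<open>wgrad\<close> makes an arbitrary choice; uniqueness almost everywhere
  transfers the integrability.\<close>

lemma weak_grad_powr_integrable:
  assumes w: "is_weak_grad n U f g0" "is_weak_grad n U f g" and U: "openin (top_of_set (Rn n)) U"
    and K: "compact K" "K \<subseteq> U" and i: "i < n" and L: "set_integrable (leb n) K (\<lambda>x. \<bar>g0 x i\<bar> powr p)"
  shows "integrable (leb n) (\<lambda>x. \<bar>indicator K x * g x i\<bar> powr p)"
proof (rule integrable_cong_AE_imp)
  have "indicator K x *\<^sub>R \<bar>g0 x i\<bar> powr p = \<bar>indicator K x * g0 x i\<bar> powr p" for x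
    by (auto simp: indicator_def)
  then show "integrable (leb n) (\<lambda>x. \<bar>indicator K x * g0 x i\<bar> powr p)"
    using L by (simp add: set_integrable_def)
  have "(\<lambda>x. indicator K x * g x i) \<in> borel_measurable (leb n)"
    using integrable_indicator_L1loc[OF is_weak_gradD(2)[OF w(2) i] K] by auto
  then show "(\<lambda>x. \<bar>indicator K x * g x i\<bar> powr p) \<in> borel_measurable (leb n)" by measurable
  show "AE x in leb n. \<bar>indicator K x * g0 x i\<bar> powr p = \<bar>indicator K x * g x i\<bar> powr p"
    using weak_grad_unique[OF U w i] by eventually_elim (use K in \<open>auto simp: indicator_def\<close>)
qed

lemma powr_integrable_lincomb:
  fixes f1 f2 g1 g2 :: "(nat \<Rightarrow> real) \<Rightarrow> real"
  assumes U: "U \<subseteq> Rn n" and K: "compact K" "K \<subseteq> U" and f: "continuous_on U f1" "continuous_on U f2"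
    and m: "(\<lambda>x. indicator K x * g1 x) \<in> borel_measurable (leb n)" "(\<lambda>x. indicator K x * g2 x) \<in> borel_measurable (leb n)"
    and g: "integrable (leb n) (\<lambda>x. \<bar>indicator K x * g1 x\<bar> powr p)" "integrable (leb n) (\<lambda>x. \<bar>indicator K x * g2 x\<bar> powr p)"
    and p: "0 < p"
  shows "integrable (leb n) (\<lambda>x. \<bar>indicator K x * (f1 x * g1 x + f2 x * g2 x)\<bar> powr p)"
proof -
  obtain b1 where b1: "integrable (leb n) (\<lambda>x. indicator K x * f1 x)" "\<And>x. \<bar>indicator K x * f1 x\<bar> \<le> b1" "0 < b1"
    by (rule indicator_continuous[OF K f(1) U]) blast
  obtain b2 where b2: "integrable (leb n) (\<lambda>x. indicator K x * f2 x)" "\<And>x. \<bar>indicator K x * f2 x\<bar> \<le> b2" "0 < b2"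
    by (rule indicator_continuous[OF K f(2) U]) blast
  have eq: "indicator K x * (f1 x * g1 x + f2 x * g2 x) =
    (indicator K x * f1 x) * (indicator K x * g1 x) + (indicator K x * f2 x) * (indicator K x * g2 x)" for x
    by (auto simp: indicator_def)
  have pw: "\<bar>indicator K x * (f1 x * g1 x + f2 x * g2 x)\<bar> powr p \<le>
     2 powr p * (b1 powr p * \<bar>indicator K x * g1 x\<bar> powr p + b2 powr p * \<bar>indicator K x * g2 x\<bar> powr p)" for x
  proof -
    have "\<bar>(indicator K x * f1 x) * (indicator K x * g1 x)\<bar> powr p \<le> (b1 * \<bar>indicator K x * g1 x\<bar>) powr p"
      unfolding abs_mult[of "indicator K x * f1 x"] using b1 p by (intro powr_mono2 mult_right_mono) auto
    moreover have "\<bar>(indicator K x * f2 x) * (indicator K x * g2 x)\<bar> powr p \<le> (b2 * \<bar>indicator K x * g2 x\<bar>) powr p"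
      unfolding abs_mult[of "indicator K x * f2 x"] using b2 p by (intro powr_mono2 mult_right_mono) auto
    ultimately have "\<bar>(indicator K x * f1 x) * (indicator K x * g1 x)\<bar> powr p + \<bar>(indicator K x * f2 x) * (indicator K x * g2 x)\<bar> powr p
      \<le> b1 powr p * \<bar>indicator K x * g1 x\<bar> powr p + b2 powr p * \<bar>indicator K x * g2 x\<bar> powr p"
      using b1(3) b2(3) by (simp add: powr_mult)
    then have "2 powr p * (\<bar>(indicator K x * f1 x) * (indicator K x * g1 x)\<bar> powr p + \<bar>(indicator K x * f2 x) * (indicator K x * g2 x)\<bar> powr p)
      \<le> 2 powr p * (b1 powr p * \<bar>indicator K x * g1 x\<bar> powr p + b2 powr p * \<bar>indicator K x * g2 x\<bar> powr p)"
      by (rule mult_left_mono) simp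
    then show ?thesis unfolding eq using abs_add_powr_le[OF less_imp_le[OF p]] order.trans by blast
  qed
  have ms: "(\<lambda>x. indicator K x * (f1 x * g1 x + f2 x * g2 x)) \<in> borel_measurable (leb n)"
    unfolding eq
    by (rule borel_measurable_add[OF borel_measurable_times[OF borel_measurable_integrable[OF b1(1)] m(1)]
      borel_measurable_times[OF borel_measurable_integrable[OF b2(1)] m(2)]])
  show ?thesis
  proof (rule integrable_abs_bound)
    show "integrable (leb n) (\<lambda>x. 2 powr p * (b1 powr p * \<bar>indicator K x * g1 x\<bar> powr p + b2 powr p * \<bar>indicator K x * g2 x\<bar> powr p))"
      using g by simp
    show "(\<lambda>x. \<bar>indicator K x * (f1 x * g1 x + f2 x * g2 x)\<bar> powr p) \<in> borel_measurable (leb n)"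
      using ms by measurable
  qed (use pw in \<open>simp add: abs_of_nonneg[OF powr_ge_zero]\<close>)
qed

section \<open>The energy identity for a fixed solution and a fixed \<psi>\<close>

locale energy =
  fixes n :: nat and p s :: real and \<Omega> :: "(nat \<Rightarrow> real) set" and a :: "nat \<Rightarrow> (nat \<Rightarrow> real) \<Rightarrow> real"
    and V u \<psi> :: "(nat \<Rightarrow> real) \<Rightarrow> real"
  assumes s: "1 < s" and p: "s < p" and dom: "openin (top_of_set (Rn n)) \<Omega>" and wt: "weight n \<Omega> a"
    and V: "L1loc n \<Omega> V" and sol: "positive_solution n p s a V \<Omega> u" and cu: "continuous_on \<Omega> u"
    and \<psi>_W1p: "W1p n p \<Omega> \<psi>" and \<psi>_Cc: "Cc \<Omega> \<psi>" and \<psi>_nonneg: "\<And>x. x \<in> \<Omega> \<Longrightarrow> 0 \<le> \<psi> x"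
begin

definition gu where "gu = wgrad n \<Omega> u"
definition g\<psi> where "g\<psi> = wgrad n \<Omega> \<psi>"

definition \<xi> where "\<xi> = (\<lambda>x i. \<psi> x * gu x i)"
definition \<eta> where "\<eta> = (\<lambda>x i. u x * g\<psi> x i)"

definition D where "D = (\<lambda>x. remainder {..<n} p s (\<lambda>i. a i x powr (1 / s) * \<xi> x i) (\<lambda>i. a i x powr (1 / s) * \<eta> x i))"

lemma Rn: "\<Omega> \<subseteq> Rn n" using openin_Rn_subset[OF dom] .

lemma a_pos: "i < n \<Longrightarrow> x \<in> \<Omega> \<Longrightarrow> 0 < a i x" using wt by (simp add: weight_def)

lemma u_pos: "x \<in> \<Omega> \<Longrightarrow> 0 < u x" using sol by (simp add: positive_solution_def)

lemma c\<psi>: "continuous_on \<Omega> \<psi>" using \<psi>_Cc by (simp add: Cc_def)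

lemma wu: "is_weak_grad n \<Omega> u gu" and w\<psi>: "is_weak_grad n \<Omega> \<psi> g\<psi>"
  using sol \<psi>_W1p weak_grad_wgrad unfolding gu_def g\<psi>_def positive_solution_def W1ploc_def W1p_def by blast+

lemma gu_Lp: "compact K \<Longrightarrow> K \<subseteq> \<Omega> \<Longrightarrow> i < n \<Longrightarrow> integrable (leb n) (\<lambda>x. \<bar>indicator K x * gu x i\<bar> powr p)"
proof -
  assume K: "compact K" "K \<subseteq> \<Omega>" and i: "i < n"
  obtain g where g: "is_weak_grad n \<Omega> u g" "\<forall>i<n. Lploc n p \<Omega> (\<lambda>x. g x i)"
    using sol unfolding positive_solution_def W1ploc_def by blast
  have "set_integrable (leb n) K (\<lambda>x. \<bar>g x i\<bar> powr p)"
    using g(2) K i unfolding Lploc_def Lp_def by blast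
  then show ?thesis by (rule weak_grad_powr_integrable[OF g(1) wu dom K i])
qed

lemma g\<psi>_Lp: "compact K \<Longrightarrow> K \<subseteq> \<Omega> \<Longrightarrow> i < n \<Longrightarrow> integrable (leb n) (\<lambda>x. \<bar>indicator K x * g\<psi> x i\<bar> powr p)"
proof -
  assume K: "compact K" "K \<subseteq> \<Omega>" and i: "i < n"
  obtain g where g: "is_weak_grad n \<Omega> \<psi> g" "\<forall>i<n. Lp n p \<Omega> (\<lambda>x. g x i)"
    using \<psi>_W1p unfolding W1p_def by blast
  have "K \<in> sets (leb n)" using compact_sets_leb K Rn by blast
  moreover have "set_integrable (leb n) \<Omega> (\<lambda>x. \<bar>g x i\<bar> powr p)"
    using g(2) i unfolding Lp_def by blast
  ultimately have "set_integrable (leb n) K (\<lambda>x. \<bar>g x i\<bar> powr p)"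
    using set_integrable_subset K by blast
  then show ?thesis by (rule weak_grad_powr_integrable[OF g(1) w\<psi> dom K i])
qed

end

lemma anorm_measurable:
  assumes "\<And>i. i < n \<Longrightarrow> A i \<in> borel_measurable M" "\<And>i. i < n \<Longrightarrow> X i \<in> borel_measurable M"
  shows "(\<lambda>x. anorm n s (\<lambda>i. A i x) (\<lambda>i. X i x)) \<in> borel_measurable M"
  unfolding anorm_def
  by (intro powr_real_measurable borel_measurable_sum borel_measurable_times borel_measurable_abs
    borel_measurable_const) (use assms in auto)

lemma R1_measurable:
  assumes "\<And>i. i < n \<Longrightarrow> A i \<in> borel_measurable M" "\<And>i. i < n \<Longrightarrow> X i \<in> borel_measurable M"
    "\<And>i. i < n \<Longrightarrow> Y i \<in> borel_measurable M"
  shows "(\<lambda>x. R1 n p s (\<lambda>i. A i x) (\<lambda>i. X i x) (\<lambda>i. Y i x) l) \<in> borel_measurable M"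
  unfolding R1_def
  by (intro powr_real_measurable borel_measurable_times borel_measurable_add anorm_measurable
    borel_measurable_const) (use assms in auto)

lemma R2_measurable:
  assumes "\<And>i. i < n \<Longrightarrow> A i \<in> borel_measurable M" "\<And>i. i < n \<Longrightarrow> X i \<in> borel_measurable M"
    "\<And>i. i < n \<Longrightarrow> Y i \<in> borel_measurable M"
  shows "(\<lambda>x. R2 n p s (\<lambda>i. A i x) (\<lambda>i. X i x) (\<lambda>i. Y i x)) \<in> borel_measurable M"
  unfolding R2_def
  by (intro powr_real_measurable borel_measurable_sum borel_measurable_times borel_measurable_add
    borel_measurable_power borel_measurable_abs anorm_measurable borel_measurable_const) (use assms in auto)

lemma anorm_cong: "(\<And>i. i < n \<Longrightarrow> g i = h i) \<Longrightarrow> anorm n s w g = anorm n s w h"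
  by (simp add: anorm_def)

context energy begin

definition K where "K = closure {x \<in> \<Omega>. \<psi> x \<noteq> 0}"

lemma K: "compact K" "K \<subseteq> \<Omega>" "x \<in> \<Omega> - K \<Longrightarrow> \<psi> x = 0"
proof -
  show "compact K" "K \<subseteq> \<Omega>" using \<psi>_Cc by (auto simp: K_def Cc_def compact_support_def)
  show "x \<in> \<Omega> - K \<Longrightarrow> \<psi> x = 0" using closure_subset[of "{x \<in> \<Omega>. \<psi> x \<noteq> 0}"] by (auto simp: K_def)
qed

text \<open>Values outside \<Omega> are arbitrary, so only cut-offs can be measurable on the whole
  carrier; they are then inserted inside \<open>anorm\<close>, \<open>R1\<close> and
  \<open>R2\<close>.\<close>

lemma measurable_on_\<Omega>:
  shows "i < n \<Longrightarrow> (\<lambda>x. indicator \<Omega> x * a i x) \<in> borel_measurable (leb n)"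
    "i < n \<Longrightarrow> (\<lambda>x. indicator \<Omega> x * gu x i) \<in> borel_measurable (leb n)"
    "i < n \<Longrightarrow> (\<lambda>x. indicator \<Omega> x * g\<psi> x i) \<in> borel_measurable (leb n)"
    "i < n \<Longrightarrow> (\<lambda>x. indicator \<Omega> x * \<xi> x i) \<in> borel_measurable (leb n)"
    "i < n \<Longrightarrow> (\<lambda>x. indicator \<Omega> x * \<eta> x i) \<in> borel_measurable (leb n)"
proof -
  assume i: "i < n"
  show "(\<lambda>x. indicator \<Omega> x * a i x) \<in> borel_measurable (leb n)"
    using wt i by (simp add: weight_def set_borel_measurable_def)
  show "(\<lambda>x. indicator \<Omega> x * gu x i) \<in> borel_measurable (leb n)"
    by (rule L1loc_measurable[OF dom is_weak_gradD(2)[OF wu i]])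
  show "(\<lambda>x. indicator \<Omega> x * g\<psi> x i) \<in> borel_measurable (leb n)"
    by (rule L1loc_measurable[OF dom is_weak_gradD(2)[OF w\<psi> i]])
  show "(\<lambda>x. indicator \<Omega> x * \<xi> x i) \<in> borel_measurable (leb n)"
    unfolding \<xi>_def by (rule L1loc_measurable[OF dom L1loc_mult_continuous[OF c\<psi> is_weak_gradD(2)[OF wu i] Rn]])
  show "(\<lambda>x. indicator \<Omega> x * \<eta> x i) \<in> borel_measurable (leb n)"
    unfolding \<eta>_def by (rule L1loc_measurable[OF dom L1loc_mult_continuous[OF cu is_weak_gradD(2)[OF w\<psi> i] Rn]])
qed

text \<open>The vector field that the weak equation pairs with the gradient of a test function, with
  the common norm factor distributed over the components.\<close>

definition flux where
  "flux = (\<lambda>i x. anorm n s (\<lambda>i. a i x) (gu x) powr (p - s) * (a i x * \<bar>gu x i\<bar> powr (s - 2) * gu x i))"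

lemma flux_K:
  assumes i: "i < n" and S: "compact S" "S \<subseteq> \<Omega>" and q: "q = p / (p - 1)"
  shows "(\<lambda>x. indicator S x * flux i x) \<in> borel_measurable (leb n)"
    "integrable (leb n) (\<lambda>x. \<bar>indicator S x * flux i x\<bar> powr q)"
proof -
  have Ss: "S \<in> sets (leb n)" using compact_sets_leb S Rn by blast
  \<comment> \<open>Inserting indicators of \<Omega> changes nothing on S and makes every factor
    measurable on the carrier.\<close>
  have eq: "indicator S x * flux i x = indicator S x *
     (anorm n s (\<lambda>i. indicator \<Omega> x * a i x) (\<lambda>i. indicator \<Omega> x * gu x i) powr (p - s) *
       (indicator \<Omega> x * a i x * \<bar>indicator \<Omega> x * gu x i\<bar> powr (s - 2) * (indicator \<Omega> x * gu x i)))" for x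
    using S by (cases "x \<in> S") (auto simp: flux_def)
  show m: "(\<lambda>x. indicator S x * flux i x) \<in> borel_measurable (leb n)"
    unfolding eq
    by (rule borel_measurable_times[OF borel_measurable_indicator[OF Ss] borel_measurable_times[OF
        powr_real_measurable[OF anorm_measurable[OF measurable_on_\<Omega>(1,2)] borel_measurable_const]
        borel_measurable_times[OF borel_measurable_times[OF measurable_on_\<Omega>(1)[OF i]
          powr_real_measurable[OF borel_measurable_abs[OF measurable_on_\<Omega>(2)[OF i]] borel_measurable_const]]
          measurable_on_\<Omega>(2)[OF i]]]])
  obtain C where C: "0 < C" "\<And>i. i < n \<Longrightarrow> AE x in leb n. x \<in> S \<longrightarrow> a i x \<le> C"
    by (rule weight_bounded_on_compact[OF dom wt S]) blast
  have AEC: "AE x in leb n. \<forall>i\<in>{..<n}. x \<in> S \<longrightarrow> a i x \<le> C"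
    using C(2) by (intro AE_finite_allI) auto
  let ?B = "C powr (q / s) * (C * real n) powr (p / s)"
  show "integrable (leb n) (\<lambda>x. \<bar>indicator S x * flux i x\<bar> powr q)"
  proof (rule integrable_abs_bound)
    show "integrable (leb n) (\<lambda>x. ?B * (\<Sum>j<n. \<bar>indicator S x * gu x j\<bar> powr p))"
      using gu_Lp[OF S] by (intro integrable_mult_right Bochner_Integration.integrable_sum) auto
    show "(\<lambda>x. \<bar>indicator S x * flux i x\<bar> powr q) \<in> borel_measurable (leb n)"
      using m by measurable
    show "AE x in leb n. \<bar>\<bar>indicator S x * flux i x\<bar> powr q\<bar> \<le> ?B * (\<Sum>j<n. \<bar>indicator S x * gu x j\<bar> powr p)"
      using AEC
    proof eventually_elim
      fix x assume x: "\<forall>i\<in>{..<n}. x \<in> S \<longrightarrow> a i x \<le> C"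
      show "\<bar>\<bar>indicator S x * flux i x\<bar> powr q\<bar> \<le> ?B * (\<Sum>j<n. \<bar>indicator S x * gu x j\<bar> powr p)"
      proof (cases "x \<in> S")
        case True
        then have "x \<in> \<Omega>" using S by blast
        then have "\<bar>flux i x\<bar> powr q \<le> C powr (q / s) * ((C * real n) powr (p / s) * (\<Sum>i<n. \<bar>gu x i\<bar> powr p))"
          unfolding flux_def using flux_powr_le[OF s p q _ _ C(1) i, of "\<lambda>i. a i x" "gu x"] a_pos x True by simp
        then show ?thesis using True by (simp add: mult.assoc)
      next
        case False
        then show ?thesis by (simp add: sum_nonneg)
      qed
    qed
  qed
qed

definition \<zeta> where "\<zeta> = (\<lambda>x i. u x * g\<psi> x i + \<psi> x * gu x i)"

lemma \<zeta>_Lp: "i < n \<Longrightarrow> integrable (leb n) (\<lambda>x. \<bar>indicator K x * \<zeta> x i\<bar> powr p)"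
  unfolding \<zeta>_def using s p
  by (intro powr_integrable_lincomb[OF Rn K(1,2) cu c\<psi>] gu_Lp g\<psi>_Lp K
    borel_measurable_integrable integrable_indicator_L1loc[OF is_weak_gradD(2)[OF wu] K(1,2)]
    integrable_indicator_L1loc[OF is_weak_gradD(2)[OF w\<psi>] K(1,2)]) auto

lemma w\<zeta>: "is_weak_grad n \<Omega> (\<lambda>x. u x * \<psi> x) \<zeta>"
  unfolding \<zeta>_def by (rule weak_grad_mult[OF dom wu w\<psi> cu c\<psi>])

text \<open>Only the support K matters: off K both \<psi> and, almost everywhere, its weak gradient
  vanish, hence so does \<zeta>. On K the weights are bounded almost everywhere and the components
  of \<zeta> are p-integrable.\<close>

lemma \<zeta>_energy: "set_integrable (leb n) \<Omega> (\<lambda>x. anorm n s (\<lambda>i. a i x) (\<zeta> x) powr p)"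
proof -
  obtain C where C: "0 < C" "\<And>i. i < n \<Longrightarrow> AE x in leb n. x \<in> K \<longrightarrow> a i x \<le> C"
    by (rule weight_bounded_on_compact[OF dom wt K(1,2)]) blast
  have AEC: "AE x in leb n. \<forall>i\<in>{..<n}. x \<in> K \<longrightarrow> a i x \<le> C"
    using C(2) by (intro AE_finite_allI) auto
  have AE0: "AE x in leb n. \<forall>i\<in>{..<n}. x \<in> \<Omega> - K \<longrightarrow> g\<psi> x i = 0"
    using weak_grad_zero[OF dom w\<psi> openin_Diff_compact[OF dom K(1,2)] Diff_subset K(3)]
    by (intro AE_finite_allI) auto
  let ?f = "\<lambda>x. indicator \<Omega> x * anorm n s (\<lambda>i. a i x) (\<zeta> x) powr p"
  let ?B = "(C * real n) powr (p / s)"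
  have m\<zeta>: "(\<lambda>x. indicator \<Omega> x * \<zeta> x i) \<in> borel_measurable (leb n)" if "i < n" for i
    by (rule L1loc_measurable[OF dom is_weak_gradD(2)[OF w\<zeta> that]])
  have eq: "?f x = indicator \<Omega> x * anorm n s (\<lambda>i. indicator \<Omega> x * a i x) (\<lambda>i. indicator \<Omega> x * \<zeta> x i) powr p" for x
    by (cases "x \<in> \<Omega>") auto
  have "integrable (leb n) ?f"
  proof (rule integrable_abs_bound)
    show "integrable (leb n) (\<lambda>x. ?B * (\<Sum>j<n. \<bar>indicator K x * \<zeta> x j\<bar> powr p))"
      using \<zeta>_Lp by (intro integrable_mult_right Bochner_Integration.integrable_sum) auto
    show "?f \<in> borel_measurable (leb n)"
      unfolding eq by (intro borel_measurable_times powr_real_measurable anorm_measurable borel_measurable_const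
        borel_measurable_indicator openin_sets_leb[OF dom] measurable_on_\<Omega>(1) m\<zeta>)
    show "AE x in leb n. \<bar>?f x\<bar> \<le> ?B * (\<Sum>j<n. \<bar>indicator K x * \<zeta> x j\<bar> powr p)"
      using AEC AE0
    proof eventually_elim
      fix x assume x: "\<forall>i\<in>{..<n}. x \<in> K \<longrightarrow> a i x \<le> C" "\<forall>i\<in>{..<n}. x \<in> \<Omega> - K \<longrightarrow> g\<psi> x i = 0"
      show "\<bar>?f x\<bar> \<le> ?B * (\<Sum>j<n. \<bar>indicator K x * \<zeta> x j\<bar> powr p)"
      proof (cases "x \<in> K")
        case True
        then have "x \<in> \<Omega>" using K by blast
        then have "anorm n s (\<lambda>i. a i x) (\<zeta> x) powr p \<le> ?B * (\<Sum>i<n. \<bar>\<zeta> x i\<bar> powr p)"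
          using s p x(1) True a_pos by (intro anorm_powr_le C) auto
        then show ?thesis using True \<open>x \<in> \<Omega>\<close> by simp
      next
        case False
        have "?f x = 0"
        proof (cases "x \<in> \<Omega>")
          case True
          then have "\<zeta> x i = 0" if "i < n" for i using x(2) K(3)[of x] False that by (simp add: \<zeta>_def)
          then have "anorm n s (\<lambda>i. a i x) (\<zeta> x) = 0" using s by (simp add: anorm_def)
          then show ?thesis by simp
        qed simp
        moreover have "0 \<le> ?B * (\<Sum>j<n. \<bar>indicator K x * \<zeta> x j\<bar> powr p)" by (simp add: sum_nonneg)
        ultimately show ?thesis by (simp only: abs_zero)
      qed
    qed
  qed
  then show ?thesis by (simp add: set_integrable_def)
qed

definition \<Phi> where "\<Phi> = (\<lambda>x. u x * \<psi> x powr p)"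
definition G where "G = (\<lambda>x i. u x * (p * \<psi> x powr (p - 1) * g\<psi> x i) + \<psi> x powr p * gu x i)"

lemma c\<psi>_powr: "0 < r \<Longrightarrow> continuous_on \<Omega> (\<lambda>x. \<psi> x powr r)"
  using \<psi>_nonneg by (intro continuous_on_powr' c\<psi> continuous_on_const) auto

lemma w\<Phi>: "is_weak_grad n \<Omega> \<Phi> G"
  unfolding \<Phi>_def G_def using s p
  by (intro weak_grad_mult[OF dom wu _ cu] weak_grad_powr[OF dom w\<psi> c\<psi>] c\<psi>_powr) (auto intro: \<psi>_nonneg)

text \<open>The equation of u with test function \<open>\<Phi>\<close>. Its potential term is that
  of Q at u \<psi>, because u^(p - 1) times u \<psi>^p is |u \<psi>|^p for positive u.\<close>

lemma tested_equation:
  "(LINT x:\<Omega>|leb n. \<Sum>i<n. flux i x * G x i) + (LINT x:\<Omega>|leb n. V x * \<bar>u x * \<psi> x\<bar> powr p) = 0"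
  "set_integrable (leb n) \<Omega> (\<lambda>x. \<Sum>i<n. flux i x * G x i)"
proof -
  define q where "q = p / (p - 1)"
  have q: "1 < p" "1 < q" "1 / p + 1 / q = 1" using s p by (auto simp: q_def field_simps)
  define b where "b = (\<lambda>x. V x * \<bar>u x\<bar> powr (p - 2) * u x)"
  \<comment> \<open>Positivity of u enters here, since the exponent \<open>p - 2\<close> may be
    negative.\<close>
  have "continuous_on \<Omega> (\<lambda>x. \<bar>u x\<bar> powr (p - 2) * u x)"
    using u_pos by (intro continuous_intros cu) force
  from L1loc_mult_continuous[OF this V Rn] have b: "L1loc n \<Omega> b"
    by (simp add: b_def ac_simps)
  have sol': "(LINT x:\<Omega>|leb n. \<Sum>i<n. flux i x * pd i \<phi> x) + (LINT x:\<Omega>|leb n. b x * \<phi> x) = 0"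
    if "Cc_infinity n \<Omega> \<phi>" for \<phi>
    using sol that unfolding positive_solution_def flux_def b_def gu_def
    by (simp add: sum_distrib_left mult.assoc)
  have c\<Phi>: "continuous_on \<Omega> \<Phi>"
    unfolding \<Phi>_def using p s by (intro continuous_on_mult cu c\<psi>_powr) auto
  have \<Phi>0: "\<Phi> x = 0" "G x i = 0" if "x \<in> \<Omega> - K" for x i
    using K(3)[OF that] by (auto simp: \<Phi>_def G_def)
  have Gp: "integrable (leb n) (\<lambda>x. \<bar>indicator K x * G x i\<bar> powr p)" if i: "i < n" for i
  proof -
    have "continuous_on \<Omega> (\<lambda>x. u x * (p * \<psi> x powr (p - 1)))"
      using s p by (intro continuous_on_mult cu c\<psi>_powr continuous_on_const) auto
    moreover have "continuous_on \<Omega> (\<lambda>x. \<psi> x powr p)" using s p by (intro c\<psi>_powr) auto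
    ultimately have "integrable (leb n) (\<lambda>x. \<bar>indicator K x * (u x * (p * \<psi> x powr (p - 1)) * g\<psi> x i + \<psi> x powr p * gu x i)\<bar> powr p)"
      using s p i by (intro powr_integrable_lincomb[OF Rn K(1,2)] gu_Lp g\<psi>_Lp K
        borel_measurable_integrable integrable_indicator_L1loc[OF is_weak_gradD(2)[OF wu] K(1,2)]
        integrable_indicator_L1loc[OF is_weak_gradD(2)[OF w\<psi>] K(1,2)]) auto
    then show ?thesis by (simp add: G_def mult.assoc)
  qed
  note ext = weak_solution_extend[OF dom q flux_K(1)[OF _ _ _ q_def] flux_K(2)[OF _ _ _ q_def] b sol' c\<Phi> w\<Phi>
     K(1,2) \<Phi>0(1) \<Phi>0(2) Gp]
  have "(LINT x:\<Omega>|leb n. b x * \<Phi> x) = (LINT x:\<Omega>|leb n. V x * \<bar>u x * \<psi> x\<bar> powr p)"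
  proof (rule set_lebesgue_integral_cong[OF openin_sets_leb[OF dom]], intro allI impI)
    fix x assume x: "x \<in> \<Omega>"
    have "\<bar>u x\<bar> powr (p - 2) * u x * u x = u x powr p"
      using u_pos[OF x] by (simp add: powr_diff power2_eq_square)
    then show "b x * \<Phi> x = V x * \<bar>u x * \<psi> x\<bar> powr p"
      using u_pos[OF x] \<psi>_nonneg[OF x] by (simp add: b_def \<Phi>_def abs_mult powr_mult mult.assoc)
  qed
  then show "(LINT x:\<Omega>|leb n. \<Sum>i<n. flux i x * G x i) + (LINT x:\<Omega>|leb n. V x * \<bar>u x * \<psi> x\<bar> powr p) = 0"
    using ext(1) by simp
  show "set_integrable (leb n) \<Omega> (\<lambda>x. \<Sum>i<n. flux i x * G x i)"
    unfolding set_integrable_def scaleR_sum_right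
    by (rule Bochner_Integration.integrable_sum) (use ext(2) in \<open>simp add: set_integrable_def\<close>)
qed

lemma D_eq:
  assumes x: "x \<in> \<Omega>"
  shows "D x = anorm n s (\<lambda>i. a i x) (\<zeta> x) powr p - (\<Sum>i<n. flux i x * G x i)"
proof -
  have s0: "0 < s" using s by simp
  have ax: "\<And>i. i < n \<Longrightarrow> 0 < a i x" using a_pos x by blast
  have an: "anorm n s (\<lambda>i. a i x) z = lnorm {..<n} s (\<lambda>i. a i x powr (1 / s) * z i)" for z
    by (rule anorm_lnorm[OF s0 ax])
  have "(\<Sum>i<n. flux i x * G x i) = anorm n s (\<lambda>i. a i x) (\<xi> x) powr p + p * anorm n s (\<lambda>i. a i x) (\<xi> x) powr (p - s) *
        (\<Sum>i<n. a i x * \<bar>\<xi> x i\<bar> powr (s - 2) * \<xi> x i * \<eta> x i)"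
    unfolding flux_def G_def \<xi>_def \<eta>_def
    by (rule Picone_identity[OF s p ax \<psi>_nonneg[OF x]])
  moreover have "anorm n s (\<lambda>i. a i x) (\<zeta> x) =
     lnorm {..<n} s (\<lambda>i. a i x powr (1 / s) * \<xi> x i + a i x powr (1 / s) * \<eta> x i)"
    unfolding an \<zeta>_def \<xi>_def \<eta>_def by (simp add: algebra_simps)
  moreover have "anorm n s (\<lambda>i. a i x) (\<xi> x) = lnorm {..<n} s (\<lambda>i. a i x powr (1 / s) * \<xi> x i)"
    by (rule an)
  moreover have fv: "first_var {..<n} s (\<lambda>i. a i x powr (1 / s) * \<xi> x i) (\<lambda>i. a i x powr (1 / s) * \<eta> x i)
     = (\<Sum>i<n. a i x * \<bar>\<xi> x i\<bar> powr (s - 2) * \<xi> x i * \<eta> x i)"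
    by (rule first_var_weighted[OF s0 ax])
  ultimately show ?thesis
    using fv by (simp add: D_def remainder_def)
qed

text \<open>The gradient part and the potential part of Q are separately integrable, so Q splits;
  the tested equation replaces the potential part by minus the flux pairing, and the difference that
  remains is D.\<close>

lemma energy_identity:
  "set_integrable (leb n) \<Omega> D" "Q n p s a V \<Omega> (\<lambda>x. u x * \<psi> x) = (LINT x:\<Omega>|leb n. D x)"
proof -
  have \<Omega>s: "\<Omega> \<in> sets (leb n)" by (rule openin_sets_leb[OF dom])
  let ?e = "\<lambda>g x. anorm n s (\<lambda>i. a i x) (g x) powr p"
  let ?v = "\<lambda>x. V x * \<bar>u x * \<psi> x\<bar> powr p"
  let ?w = "wgrad n \<Omega> (\<lambda>x. u x * \<psi> x)"
  have "continuous_on \<Omega> (\<lambda>x. \<bar>u x * \<psi> x\<bar> powr p)"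
    using s p by (intro continuous_on_powr' continuous_on_rabs continuous_on_mult cu c\<psi> continuous_on_const) auto
  from set_integrable_test[OF V this K(1,2) _ Rn] have v: "set_integrable (leb n) \<Omega> ?v"
    using K(3) s p by simp
  have ww: "is_weak_grad n \<Omega> (\<lambda>x. u x * \<psi> x) ?w" by (rule weak_grad_wgrad[OF w\<zeta>])
  \<comment> \<open>\<open>Q\<close> reads the gradient that \<open>wgrad\<close> selects for u
    \<psi>; it agrees with the one given by the product rule almost everywhere only.\<close>
  have "AE x in leb n. \<forall>i\<in>{..<n}. x \<in> \<Omega> \<longrightarrow> ?w x i = \<zeta> x i"
    using weak_grad_unique[OF dom ww w\<zeta>] by (intro AE_finite_allI) auto
  then have AE: "AE x in leb n. indicator \<Omega> x *\<^sub>R (?e ?w x + ?v x) = indicator \<Omega> x *\<^sub>R (?e \<zeta> x + ?v x)"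
  proof eventually_elim
    fix x assume x: "\<forall>i\<in>{..<n}. x \<in> \<Omega> \<longrightarrow> ?w x i = \<zeta> x i"
    show "indicator \<Omega> x *\<^sub>R (?e ?w x + ?v x) = indicator \<Omega> x *\<^sub>R (?e \<zeta> x + ?v x)"
    proof (cases "x \<in> \<Omega>")
      case True
      then have "anorm n s (\<lambda>i. a i x) (?w x) = anorm n s (\<lambda>i. a i x) (\<zeta> x)"
        using x by (intro anorm_cong) auto
      then show ?thesis by simp
    qed simp
  qed
  have m: "(\<lambda>x. indicator \<Omega> x *\<^sub>R (?e g x + ?v x)) \<in> borel_measurable (leb n)"
    if g: "is_weak_grad n \<Omega> (\<lambda>x. u x * \<psi> x) g" for g
  proof -
    have eq: "indicator \<Omega> x *\<^sub>R (?e g x + ?v x) =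
       indicator \<Omega> x * anorm n s (\<lambda>i. indicator \<Omega> x * a i x) (\<lambda>i. indicator \<Omega> x * g x i) powr p + indicator \<Omega> x *\<^sub>R ?v x" for x
      by (cases "x \<in> \<Omega>") auto
    show ?thesis unfolding eq
      using borel_measurable_integrable[OF v[unfolded set_integrable_def]]
      by (intro borel_measurable_add borel_measurable_times powr_real_measurable anorm_measurable borel_measurable_const
        borel_measurable_indicator \<Omega>s measurable_on_\<Omega>(1) L1loc_measurable[OF dom is_weak_gradD(2)[OF g]])
  qed
  have "Q n p s a V \<Omega> (\<lambda>x. u x * \<psi> x) = (LINT x:\<Omega>|leb n. ?e \<zeta> x + ?v x)"
    unfolding Q_def set_lebesgue_integral_def by (rule integral_cong_AE[OF m[OF ww] m[OF w\<zeta>] AE])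
  also have "\<dots> = (LINT x:\<Omega>|leb n. ?e \<zeta> x) + (LINT x:\<Omega>|leb n. ?v x)"
    by (rule set_integral_add(2)[OF \<zeta>_energy v])
  also have "\<dots> = (LINT x:\<Omega>|leb n. ?e \<zeta> x) - (LINT x:\<Omega>|leb n. \<Sum>i<n. flux i x * G x i)"
    using tested_equation(1) by simp
  also have "\<dots> = (LINT x:\<Omega>|leb n. ?e \<zeta> x - (\<Sum>i<n. flux i x * G x i))"
    by (rule set_integral_diff(2)[OF \<zeta>_energy tested_equation(2), symmetric])
  also have "\<dots> = (LINT x:\<Omega>|leb n. D x)"
    by (rule set_lebesgue_integral_cong[OF \<Omega>s]) (simp add: D_eq)
  finally show "Q n p s a V \<Omega> (\<lambda>x. u x * \<psi> x) = (LINT x:\<Omega>|leb n. D x)" .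
  have "set_integrable (leb n) \<Omega> (\<lambda>x. ?e \<zeta> x - (\<Sum>i<n. flux i x * G x i))"
    by (rule set_integral_diff(1)[OF \<zeta>_energy tested_equation(2)])
  moreover have "indicator \<Omega> x *\<^sub>R (?e \<zeta> x - (\<Sum>i<n. flux i x * G x i)) = indicator \<Omega> x *\<^sub>R D x" for x
    by (cases "x \<in> \<Omega>") (auto simp: D_eq)
  ultimately show "set_integrable (leb n) \<Omega> D" unfolding set_integrable_def by (simp only:)
qed

end

section \<open>Integrating the pointwise bounds\<close>

lemma R1_nonneg: "0 \<le> R1 n p s w x y l"
  by (simp add: R1_def)

lemma R2_nonneg: "0 \<le> R2 n p s w x y"
  by (simp add: R2_def sum_nonneg)

context energy begin

definition r1 where "r1 = (\<lambda>x. R1 n p s (\<lambda>i. a i x) (\<xi> x) (\<eta> x) (max s 2))"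
definition r2 where "r2 = (\<lambda>x. R2 n p s (\<lambda>i. a i x) (\<xi> x) (\<eta> x))"
definition \<Omega>1 where "\<Omega>1 = {x \<in> \<Omega>. anorm n s (\<lambda>i. a i x) (\<xi> x) \<le> anorm n s (\<lambda>i. a i x) (\<eta> x)}"
definition \<Omega>2 where "\<Omega>2 = {x \<in> \<Omega>. anorm n s (\<lambda>i. a i x) (\<xi> x) > anorm n s (\<lambda>i. a i x) (\<eta> x)}"

lemma sets_\<Omega>: "\<Omega> \<in> sets (leb n)" "\<Omega>1 \<in> sets (leb n)" "\<Omega>2 \<in> sets (leb n)"
proof -
  show \<Omega>: "\<Omega> \<in> sets (leb n)" by (rule openin_sets_leb[OF dom])
  let ?X = "\<lambda>x. anorm n s (\<lambda>i. indicator \<Omega> x * a i x) (\<lambda>i. indicator \<Omega> x * \<xi> x i)"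
  let ?Y = "\<lambda>x. anorm n s (\<lambda>i. indicator \<Omega> x * a i x) (\<lambda>i. indicator \<Omega> x * \<eta> x i)"
  have "{x \<in> space (leb n). ?X x \<le> ?Y x} \<in> sets (leb n)"
    by (intro borel_measurable_le anorm_measurable measurable_on_\<Omega>)
  with \<Omega> have "\<Omega> \<inter> {x \<in> space (leb n). ?X x \<le> ?Y x} \<in> sets (leb n)" by (rule sets.Int)
  also have "\<Omega> \<inter> {x \<in> space (leb n). ?X x \<le> ?Y x} = \<Omega>1" using Rn by (auto simp: \<Omega>1_def)
  finally show \<Omega>1: "\<Omega>1 \<in> sets (leb n)" .
  have "\<Omega>2 = \<Omega> - \<Omega>1" by (auto simp: \<Omega>1_def \<Omega>2_def)
  then show "\<Omega>2 \<in> sets (leb n)" using \<Omega> \<Omega>1 by simp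
qed

lemma r_measurable:
  "(\<lambda>x. indicator \<Omega> x * r1 x) \<in> borel_measurable (leb n)" "(\<lambda>x. indicator \<Omega> x * r2 x) \<in> borel_measurable (leb n)"
proof -
  have "(\<lambda>x. indicator \<Omega> x * r1 x) = (\<lambda>x. indicator \<Omega> x * R1 n p s (\<lambda>i. indicator \<Omega> x * a i x)
      (\<lambda>i. indicator \<Omega> x * \<xi> x i) (\<lambda>i. indicator \<Omega> x * \<eta> x i) (max s 2))"
    by (intro ext) (auto simp: r1_def indicator_def)
  then show "(\<lambda>x. indicator \<Omega> x * r1 x) \<in> borel_measurable (leb n)"
    by (simp only:) (intro borel_measurable_times borel_measurable_indicator sets_\<Omega>(1) R1_measurable measurable_on_\<Omega>)
  have "(\<lambda>x. indicator \<Omega> x * r2 x) = (\<lambda>x. indicator \<Omega> x * R2 n p s (\<lambda>i. indicator \<Omega> x * a i x)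
      (\<lambda>i. indicator \<Omega> x * \<xi> x i) (\<lambda>i. indicator \<Omega> x * \<eta> x i))"
    by (intro ext) (auto simp: r2_def indicator_def)
  then show "(\<lambda>x. indicator \<Omega> x * r2 x) \<in> borel_measurable (leb n)"
    by (simp only:) (intro borel_measurable_times borel_measurable_indicator sets_\<Omega>(1) R2_measurable measurable_on_\<Omega>)
qed

text \<open>The pointwise inequalities enter as hypotheses, with their constants as parameters, so
  that the constants can be fixed before the dimension and the functions are.\<close>

lemma energy_bounds:
  assumes c: "0 < c" and C1: "0 < C1" and C2: "0 < C2"
    and lo: "\<And>x y :: nat \<Rightarrow> real. c * (lnorm {..<n} s y powr (max s 2) * (lnorm {..<n} s y + lnorm {..<n} s x) powr (p - max s 2))
       + c * (lnorm {..<n} s x powr (p - s) * second_var {..<n} s x y) \<le> remainder {..<n} p s x y"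
    and up1: "\<And>x y :: nat \<Rightarrow> real. lnorm {..<n} s x \<le> lnorm {..<n} s y \<Longrightarrow> remainder {..<n} p s x y \<le>
       C1 * (lnorm {..<n} s y powr (max s 2) * (lnorm {..<n} s y + lnorm {..<n} s x) powr (p - max s 2))"
    and up2: "\<And>x y :: nat \<Rightarrow> real. lnorm {..<n} s y < lnorm {..<n} s x \<Longrightarrow> remainder {..<n} p s x y \<le>
       C2 * (lnorm {..<n} s x powr (p - s) * second_var {..<n} s x y)"
  defines "I1 \<equiv> \<lambda>A. LINT x:A|leb n. r1 x" and "I2 \<equiv> \<lambda>A. LINT x:A|leb n. r2 x"
    and "q \<equiv> Q n p s a V \<Omega> (\<lambda>x. u x * \<psi> x)"
  shows "c * I1 \<Omega> + c * I2 \<Omega> \<le> q" "q \<le> C1 * I1 \<Omega>1 + C2 * I2 \<Omega>2"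
    "c * (I1 \<Omega>1 + I2 \<Omega>2) \<le> q" "q \<le> max c (max C1 C2) * (I1 \<Omega>1 + I2 \<Omega>2)"
proof -
  have s0: "0 < s" using s by simp
  have rn: "0 \<le> r1 x" "0 \<le> r2 x" for x by (simp_all add: r1_def r2_def R1_nonneg R2_nonneg)
  have pw: "c * r1 x + c * r2 x \<le> D x" "x \<in> \<Omega>1 \<Longrightarrow> D x \<le> C1 * r1 x" "x \<in> \<Omega>2 \<Longrightarrow> D x \<le> C2 * r2 x"
    if x: "x \<in> \<Omega>" for x
  proof -
    have ax: "\<And>i. i < n \<Longrightarrow> 0 < a i x" using a_pos x by blast
    have an: "anorm n s (\<lambda>i. a i x) z = lnorm {..<n} s (\<lambda>i. a i x powr (1 / s) * z i)" for z
      by (rule anorm_lnorm[OF s0 ax])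
    let ?X = "\<lambda>i. a i x powr (1 / s) * \<xi> x i" and ?Y = "\<lambda>i. a i x powr (1 / s) * \<eta> x i"
    have r1: "r1 x = lnorm {..<n} s ?Y powr max s 2 * (lnorm {..<n} s ?Y + lnorm {..<n} s ?X) powr (p - max s 2)"
      unfolding r1_def by (rule R1_lnorm[OF s0 ax])
    have r2: "r2 x = lnorm {..<n} s ?X powr (p - s) * second_var {..<n} s ?X ?Y"
      unfolding r2_def by (rule R2_lnorm[OF s0 ax])
    show "c * r1 x + c * r2 x \<le> D x" unfolding r1 r2 D_def by (rule lo)
    show "D x \<le> C1 * r1 x" if "x \<in> \<Omega>1"
      unfolding r1 D_def by (rule up1) (use that in \<open>simp add: \<Omega>1_def an\<close>)
    show "D x \<le> C2 * r2 x" if "x \<in> \<Omega>2"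
      unfolding r2 D_def by (rule up2) (use that in \<open>simp add: \<Omega>2_def an\<close>)
  qed
  have D: "integrable (leb n) (\<lambda>x. indicator \<Omega> x * D x)"
    using energy_identity(1) by (simp add: set_integrable_def)
  \<comment> \<open>Integrability of the remainder terms is a consequence of the lower bound: both
    are nonnegative and c times each is at most the integrable D. Otherwise their integrals would
    take the default value 0.\<close>
  have int: "set_integrable (leb n) \<Omega> r1" "set_integrable (leb n) \<Omega> r2"
  proof -
    have b: "integrable (leb n) (\<lambda>x. 1 / c * (indicator \<Omega> x * D x))" using D by (rule integrable_mult_right)
    have le: "r1 x \<le> 1 / c * D x" "r2 x \<le> 1 / c * D x" if "x \<in> \<Omega>" for x
    proof -
      have "0 \<le> c * r1 x" "0 \<le> c * r2 x" using rn c by auto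
      then have "c * r1 x \<le> D x" "c * r2 x \<le> D x" using pw(1)[OF that] by linarith+
      then show "r1 x \<le> 1 / c * D x" "r2 x \<le> 1 / c * D x" using c by (simp_all add: field_simps)
    qed
    have "integrable (leb n) (\<lambda>x. indicator \<Omega> x * r1 x)"
      by (rule integrable_abs_bound[OF b r_measurable(1)], rule AE_I2)
        (use le(1) rn(1) in \<open>simp add: indicator_def\<close>)
    moreover have "integrable (leb n) (\<lambda>x. indicator \<Omega> x * r2 x)"
      by (rule integrable_abs_bound[OF b r_measurable(2)], rule AE_I2)
        (use le(2) rn(2) in \<open>simp add: indicator_def\<close>)
    ultimately show "set_integrable (leb n) \<Omega> r1" "set_integrable (leb n) \<Omega> r2"
      by (simp_all add: set_integrable_def)
  qed
  have sub: "\<Omega>1 \<subseteq> \<Omega>" "\<Omega>2 \<subseteq> \<Omega>" "\<Omega>1 \<inter> \<Omega>2 = {}" "\<Omega> = \<Omega>1 \<union> \<Omega>2" by (auto simp: \<Omega>1_def \<Omega>2_def)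
  note int1 = set_integrable_subset[OF int(1) sets_\<Omega>(2) sub(1)] and int2 = set_integrable_subset[OF int(2) sets_\<Omega>(3) sub(2)]
  note intD1 = set_integrable_subset[OF energy_identity(1) sets_\<Omega>(2) sub(1)]
    and intD2 = set_integrable_subset[OF energy_identity(1) sets_\<Omega>(3) sub(2)]
  have "c * I1 \<Omega> + c * I2 \<Omega> = (LINT x:\<Omega>|leb n. c * r1 x + c * r2 x)"
    using int by (simp add: I1_def I2_def set_integral_add)
  also have "\<dots> \<le> (LINT x:\<Omega>|leb n. D x)"
    using int energy_identity(1) pw(1) by (intro set_integral_mono) (auto intro: set_integral_add)
  finally show lower: "c * I1 \<Omega> + c * I2 \<Omega> \<le> q" by (simp add: q_def energy_identity(2))
  have "q = (LINT x:\<Omega>1|leb n. D x) + (LINT x:\<Omega>2|leb n. D x)"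
    unfolding q_def energy_identity(2) using set_integral_Un[OF sub(3) intD1 intD2] sub(4) by simp
  moreover have "(LINT x:\<Omega>1|leb n. D x) \<le> (LINT x:\<Omega>1|leb n. C1 * r1 x)"
    using intD1 int1 pw(2) sub(1) by (intro set_integral_mono) auto
  moreover have "(LINT x:\<Omega>2|leb n. D x) \<le> (LINT x:\<Omega>2|leb n. C2 * r2 x)"
    using intD2 int2 pw(3) sub(2) by (intro set_integral_mono) auto
  ultimately show upper: "q \<le> C1 * I1 \<Omega>1 + C2 * I2 \<Omega>2" by (simp add: I1_def I2_def)
  have nn: "0 \<le> I1 A" "0 \<le> I2 A" for A
    unfolding I1_def I2_def set_lebesgue_integral_def using rn by (auto intro!: integral_nonneg_AE)
  have "I1 \<Omega> = I1 \<Omega>1 + I1 \<Omega>2" "I2 \<Omega> = I2 \<Omega>1 + I2 \<Omega>2"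
    unfolding I1_def I2_def
    using set_integral_Un[OF sub(3) int1 set_integrable_subset[OF int(1) sets_\<Omega>(3) sub(2)]]
      set_integral_Un[OF sub(3) set_integrable_subset[OF int(2) sets_\<Omega>(2) sub(1)] int2] sub(4) by simp_all
  then have "I1 \<Omega>1 + I2 \<Omega>2 \<le> I1 \<Omega> + I2 \<Omega>" using nn by simp
  then have "c * (I1 \<Omega>1 + I2 \<Omega>2) \<le> c * (I1 \<Omega> + I2 \<Omega>)" using c by (intro mult_left_mono) auto
  then show "c * (I1 \<Omega>1 + I2 \<Omega>2) \<le> q" using lower by (simp add: distrib_left)
  have "C1 * I1 \<Omega>1 \<le> max c (max C1 C2) * I1 \<Omega>1" "C2 * I2 \<Omega>2 \<le> max c (max C1 C2) * I2 \<Omega>2"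
    using nn by (intro mult_right_mono; simp)+
  then show "q \<le> max c (max C1 C2) * (I1 \<Omega>1 + I2 \<Omega>2)" using upper by (simp add: distrib_left)
qed

end

theorem lemma3p19:
  fixes p s :: real
  assumes "1 < s" and "s < p"
  shows
    "\<exists>(c::real) (C::real) (Cn::nat \<Rightarrow> real) (c'::nat \<Rightarrow> real) (C'::nat \<Rightarrow> real).
       0 < c \<and> 0 < C \<and> (\<forall>n\<ge>2. 0 < Cn n) \<and> (\<forall>n\<ge>2. 0 < c' n \<and> c' n \<le> C' n) \<and>
       (\<forall>(n::nat) (q::real) (\<Omega>::(nat \<Rightarrow> real) set) (a::nat \<Rightarrow> (nat \<Rightarrow> real) \<Rightarrow> real)
          (V::(nat \<Rightarrow> real) \<Rightarrow> real) (u::(nat \<Rightarrow> real) \<Rightarrow> real) (\<psi>::(nat \<Rightarrow> real) \<Rightarrow> real).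
          2 \<le> n \<and> is_domain n \<Omega> \<and> weight n \<Omega> a \<and>
          morrey_exponent n p q \<and> morrey_loc n p q \<Omega> V \<and>
          (\<forall>\<phi>. Cc_infinity n \<Omega> \<phi> \<longrightarrow> 0 \<le> Q n p s a V \<Omega> \<phi>) \<and>
          positive_solution n p s a V \<Omega> u \<and> continuous_on \<Omega> u \<and>
          W1p n p \<Omega> \<psi> \<and> Cc \<Omega> \<psi> \<and> (\<forall>x\<in>\<Omega>. 0 \<le> \<psi> x)
          \<longrightarrow>
          (let M = max s 2;
               w = (\<lambda>x i. a i x);
               \<xi> = (\<lambda>x i. \<psi> x * wgrad n \<Omega> u x i);
               \<eta> = (\<lambda>x i. u x * wgrad n \<Omega> \<psi> x i);
               \<Omega>1 = {x \<in> \<Omega>. anorm n s (w x) (\<xi> x) \<le> anorm n s (w x) (\<eta> x)};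
               \<Omega>2 = {x \<in> \<Omega>. anorm n s (w x) (\<xi> x) > anorm n s (w x) (\<eta> x)};
               I1 = (\<lambda>A. LINT x:A|leb n. R1 n p s (w x) (\<xi> x) (\<eta> x) M);
               I2 = (\<lambda>A. LINT x:A|leb n. R2 n p s (w x) (\<xi> x) (\<eta> x));
               E = I1 \<Omega>1 + I2 \<Omega>2;
               Qu\<psi> = Q n p s a V \<Omega> (\<lambda>x. u x * \<psi> x)
           in Qu\<psi> \<ge> c * I1 \<Omega> + c * I2 \<Omega> \<and>
              Qu\<psi> \<le> C * I1 \<Omega>1 + Cn n * I2 \<Omega>2 \<and>
              c' n * E \<le> Qu\<psi> \<and> Qu\<psi> \<le> C' n * E))"
proof -
  let ?\<rho>1 = "\<lambda>I x y :: nat \<Rightarrow> real. lnorm I s y powr (max s 2) * (lnorm I s y + lnorm I s x) powr (p - max s 2)"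
  let ?\<rho>2 = "\<lambda>I x y :: nat \<Rightarrow> real. lnorm I s x powr (p - s) * second_var I s x y"
  obtain c1 where c1: "0 < c1" "\<And>(I::nat set) x y. finite I \<Longrightarrow> c1 * ?\<rho>1 I x y \<le> remainder I p s x y"
    by (rule remainder_ge_R1[OF assms, where 'a = nat]) blast
  obtain c2 where c2: "0 < c2" "\<And>(I::nat set) x y. c2 * ?\<rho>2 I x y \<le> remainder I p s x y"
    by (rule remainder_ge_second_var[OF assms, where 'a = nat]) blast
  obtain C1 where C1: "0 < C1" "\<And>(I::nat set) x y. finite I \<Longrightarrow> lnorm I s x \<le> lnorm I s y \<Longrightarrow>
      remainder I p s x y \<le> C1 * ?\<rho>1 I x y"
    by (rule remainder_le_R1[OF assms, where 'a = nat]) blast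
  obtain C2 where C2: "0 < C2" "\<And>(I::nat set) x y. finite I \<Longrightarrow> lnorm I s y < lnorm I s x \<Longrightarrow>
      remainder I p s x y \<le> C2 * ?\<rho>2 I x y"
    by (rule remainder_le_R2[OF assms, where 'a = nat]) blast
  \<comment> \<open>Half of the smaller constant: the bound by the sum of both remainder terms is
    the average of the two separate bounds.\<close>
  define c where "c = min c1 c2 / 2"
  have c: "0 < c" using c1(1) c2(1) by (simp add: c_def)
  have lo: "c * ?\<rho>1 {..<n} x y + c * ?\<rho>2 {..<n} x y \<le> remainder {..<n} p s x y" for n x y
  proof -
    have "2 * c * ?\<rho>1 {..<n} x y \<le> c1 * ?\<rho>1 {..<n} x y" "2 * c * ?\<rho>2 {..<n} x y \<le> c2 * ?\<rho>2 {..<n} x y"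
      by (intro mult_right_mono; simp add: c_def)+
    then show ?thesis using c1(2)[where I = "{..<n}" and x = x and y = y] c2(2)[where I = "{..<n}" and x = x and y = y] by simp
  qed
  show ?thesis
  proof (intro exI conjI allI impI)
    show "0 < c" "0 < C1" by (fact c C1(1))+
    \<comment> \<open>The constants allowed to depend on n are chosen as constant functions; the
      entry \<open>c\<close> in the last maximum guarantees that the lower constant does not exceed
      the upper one.\<close>
    show "0 < (\<lambda>_::nat. C2) n" "0 < (\<lambda>_::nat. c) n" "(\<lambda>_::nat. c) n \<le> (\<lambda>_::nat. max c (max C1 C2)) n" for n
      using C2(1) c by auto
  next
    fix n q \<Omega> a V u \<psi>
    assume h: "2 \<le> n \<and> is_domain n \<Omega> \<and> weight n \<Omega> a \<and> morrey_exponent n p q \<and> morrey_loc n p q \<Omega> V \<and>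
          (\<forall>\<phi>. Cc_infinity n \<Omega> \<phi> \<longrightarrow> 0 \<le> Q n p s a V \<Omega> \<phi>) \<and>
          positive_solution n p s a V \<Omega> u \<and> continuous_on \<Omega> u \<and>
          W1p n p \<Omega> \<psi> \<and> Cc \<Omega> \<psi> \<and> (\<forall>x\<in>\<Omega>. 0 \<le> \<psi> x)"
    then have dom: "openin (top_of_set (Rn n)) \<Omega>" by (simp add: is_domain_def)
    interpret energy n p s \<Omega> a V u \<psi>
      using h assms dom morrey_loc_L1loc[OF dom, of p q V] by unfold_locales auto
    have fin: "finite {..<n}" by simp
    show "let M = max s 2;
               w = (\<lambda>x i. a i x);
               \<xi> = (\<lambda>x i. \<psi> x * wgrad n \<Omega> u x i);
               \<eta> = (\<lambda>x i. u x * wgrad n \<Omega> \<psi> x i);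
               \<Omega>1 = {x \<in> \<Omega>. anorm n s (w x) (\<xi> x) \<le> anorm n s (w x) (\<eta> x)};
               \<Omega>2 = {x \<in> \<Omega>. anorm n s (w x) (\<xi> x) > anorm n s (w x) (\<eta> x)};
               I1 = (\<lambda>A. LINT x:A|leb n. R1 n p s (w x) (\<xi> x) (\<eta> x) M);
               I2 = (\<lambda>A. LINT x:A|leb n. R2 n p s (w x) (\<xi> x) (\<eta> x));
               E = I1 \<Omega>1 + I2 \<Omega>2;
               Qu\<psi> = Q n p s a V \<Omega> (\<lambda>x. u x * \<psi> x)
           in Qu\<psi> \<ge> c * I1 \<Omega> + c * I2 \<Omega> \<and>
              Qu\<psi> \<le> C1 * I1 \<Omega>1 + (\<lambda>_::nat. C2) n * I2 \<Omega>2 \<and>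
              (\<lambda>_::nat. c) n * E \<le> Qu\<psi> \<and> Qu\<psi> \<le> (\<lambda>_::nat. max c (max C1 C2)) n * E"
      using energy_bounds[OF c C1(1) C2(1) lo C1(2)[OF fin] C2(2)[OF fin]]
      unfolding r1_def r2_def \<Omega>1_def \<Omega>2_def \<xi>_def \<eta>_def gu_def g\<psi>_def Let_def by blast
  qed
qed

end
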